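(* Let $p\ge11$ be a prime and $X:=2p\mathcal{B}_{2(p-1)}-p^2\mathcal{B}_{p-1}^2$. Then, modulo $p^4$ in $\mathbb{Z}_p$, \begin{align*} A^\star_{p-1}\equiv-\frac{1}{p-1}\Bigg(&-\frac{p^3}{3}\mathcal{T}(p-1)+\frac{p^3}{4}\Big(w_p\mathcal{B}_{p-3}+(\mathcal{B}_{2p-4}-\mathcal{B}_{p-3})_1\Big)-\frac{p^3}{72}\mathcal{B}_{p-5}+\frac{7p^3}{12}\mathcal{B}_{p-3}\\ &+\frac{1}{2}p^3\big(\mathcal{C}(p-1)\big)_1+\frac{1-p}{2}(1+pw_p)p^2(X)_2\\ &-\frac{p^2}{6}(1+pw_p)\Big(\frac{1}{2}\mathcal{B}_{p-3}+\frac{1}{5}\mathcal{B}_{p-5}\Big)-\frac{p^3}{2}\sum_{a=1}^{p-1}\sum_{i=6}^{p-5}\frac{B_i}{a^i}q_a^2\\ &+\frac{13p^3+12p-12}{3}+\frac{19p^3-12}{2}pB_{p-1}+(4-7p^3)pB_{2(p-1)}+\frac{11p^3-6}{6}pB_{3(p-1)}\\ &+p(2\mathcal{B}_{p-3}-\mathcal{B}_{2p-4})\Big(\big(\tfrac{1}{2}-3B_{p+1}\big)p-\tfrac{4}{3}p^2\Big)\\ &+2p(\mathcal{B}_{2p-4}-2\mathcal{B}_{p-3})\Big(\frac{p}{12}-\frac{11p^2}{24}+\frac{p^2}{12}(pB_{p-1})_1\Big)\\ &+4p(\mathcal{B}_{2p-6}-2\mathcal{B}_{p-5})\Big(p(2\mathcal{B}_4-\mathcal{B}_{p+3})+\frac{1}{2}\Big(\frac{7}{720}p^2+2p\mathcal{B}_{p+3}+2p\mathcal{B}_4(pB_{p-1})\Big)\Big)\Bigg)\pmod{p^4}.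 \end{align*}
   Context: $A^\star_k:=\sum_{1\le i_1<\dots<i_k\le p-1}\frac{1}{i_1\cdots i_k}$ (so $A^\star_{p-1}=1/(p-1)!$). $w_p:=\frac{(p-1)!+1}{p}$, $q_a:=\frac{a^{p-1}-1}{p}$. $B_n$ is the $n$-th Bernoulli number, $\mathcal{B}_n:=B_n/n$; for even $m\ge4$, $\mathcal{C}(m):=\sum_{i=2}^{m-2}\mathcal{B}_i\mathcal{B}_{m-i}$ and $\mathcal{T}(m):=\sum_{i=2}^{m-4}\mathcal{B}_i\mathcal{C}(m-i)$. Hensel digits: for $x\in\mathbb{Q}_p$ with expansion $\sum_{i\ge-m}x_ip^i$, $x_i\in\{0,\dots,p-1\}$, $(x)_i:=x_i$; exception: $(pB_{p-1})_1:=(pB_{p-1}+1)/p$ (Agoh–Giuga quotient). $x\equiv y\pmod{p^4}$ means $x-y\in p^4\mathbb{Z}_p$. *)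

theory Defs
  imports Complex_Main "HOL-Computational_Algebra.Primes"
begin

(* B_n, with B_1 = -1/2. *)
fun bernoulli :: "nat \<Rightarrow> rat" where
  "bernoulli 0 = 1"
| "bernoulli (Suc n) =
     - (\<Sum>k\<le>n. of_nat ((n + 2) choose k) * bernoulli k) / of_nat (n + 2)"

definition divided_bernoulli :: "nat \<Rightarrow> rat" where
  "divided_bernoulli n = bernoulli n / of_nat n"

definition bernoulli_conv2 :: "nat \<Rightarrow> rat" where
  "bernoulli_conv2 m = (\<Sum>i=2..m-2. divided_bernoulli i * divided_bernoulli (m - i))"

(* bernoulli_conv2 is meant for even arguments; the summands with odd i below vanish,
   since bernoulli i = 0 for odd i > 1. *)
definition bernoulli_conv3 :: "nat \<Rightarrow> rat" where
  "bernoulli_conv3 m = (\<Sum>i=2..m-4. divided_bernoulli i * bernoulli_conv2 (m - i))"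

(* Elementary symmetric function of degree k in 1/1, ..., 1/(p-1): the index tuples
   i_1 < ... < i_k are identified with the k-element subsets of {1..p-1}. *)
definition A_star :: "nat \<Rightarrow> nat \<Rightarrow> rat" where
  "A_star p k = (\<Sum>S | S \<subseteq> {1..p-1} \<and> card S = k. \<Prod>i\<in>S. 1 / of_nat i)"

definition wilson_quotient :: "nat \<Rightarrow> rat" where
  "wilson_quotient p = (fact (p - 1) + 1) / of_nat p"

definition fermat_quotient :: "nat \<Rightarrow> nat \<Rightarrow> rat" where
  "fermat_quotient p a = (of_nat a ^ (p - 1) - 1) / of_nat p"

(* This replaces the first Hensel digit in the case of p B_{p-1}; it is in general not a digit. *)
definition agoh_giuga_quotient :: "nat \<Rightarrow> rat" where
  "agoh_giuga_quotient p = (of_nat p * bernoulli (p - 1) + 1) / of_nat p"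

(* All p-adic numbers considered here are rational, so Z_p is represented by its
   intersection with the rationals, the localisation of Z at p. *)
definition padic_integers :: "nat \<Rightarrow> rat set" where
  "padic_integers p = {of_int a / of_int b | a b :: int. \<not> int p dvd b}"

definition padic_cong :: "nat \<Rightarrow> nat \<Rightarrow> rat \<Rightarrow> rat \<Rightarrow> bool" where
  "padic_cong p n x y \<longleftrightarrow> (\<exists>z\<in>padic_integers p. x - y = of_nat p ^ n * z)"

(* x is the p-adic sum of the series of all d i * p^i with i \<ge> -m: a series of this shape
   converges to x iff, for every N, its part below p^N is congruent to x modulo p^N. *)
definition is_hensel_expansion :: "nat \<Rightarrow> rat \<Rightarrow> (int \<Rightarrow> nat) \<Rightarrow> bool" where
  "is_hensel_expansion p x d \<longleftrightarrow>
     (\<forall>i. d i < p) \<and>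
     (\<exists>m::nat. (\<forall>i < - int m. d i = 0) \<and>
        (\<forall>N::nat. padic_cong p N x
           (\<Sum>i = - int m..<int N. of_nat (d i) * of_nat p powi i)))"

(* For prime p the expansion exists and is unique. *)
definition hensel_digit :: "nat \<Rightarrow> rat \<Rightarrow> int \<Rightarrow> nat" where
  "hensel_digit p x = (THE d. is_hensel_expansion p x d)"

end

theory Submission
  imports Defs "HOL-Computational_Algebra.Formal_Power_Series" "HOL-Number_Theory.Residue_Primitive_Roots"
begin

text \<open>
  Write \<open>q a\<close> for the Fermat quotients, \<open>D k\<close> for the divided Bernoulli numbers and \<open>Q j\<close> for the sum of
  \<open>(q a) ^ j\<close> over \<open>0 < a < p\<close>. Since \<open>a ^ (k * (p - 1)) = (1 + p * q a) ^ k\<close>, Faulhaber's formula expresses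
  \<open>p * B (k * (p - 1))\<close> for \<open>k = 1, 2, 3\<close> modulo \<open>p ^ 4\<close> by \<open>Q 1, Q 2, Q 3\<close> and \<open>D (p - 3)\<close>, and the product of
  all \<open>1 + p * q a\<close> is \<open>(1 - p * w) ^ (p - 1)\<close>, which determines \<open>Q 1\<close> by \<open>w, Q 2, Q 3\<close>.

  By the Kummer congruences the numbers \<open>D r\<close> are, up to sign, the Fourier coefficients of \<open>a \<mapsto> q a\<close> on the units
  modulo \<open>p\<close>. Plancherel's formula, in the refined version modulo \<open>p ^ 2\<close> for Teichmueller characters and
  logarithms, evaluates the double convolution \<open>C\<close> modulo \<open>p ^ 2\<close>; summing the cube of the Fourier series
  evaluates the triple convolution modulo \<open>p\<close>. The first differences \<open>(D (k + p - 1) - D k) / p\<close> are Fourier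
  coefficients of \<open>a \<mapsto> (q a) ^ 2\<close>, which accounts for the summands missing from the double sum of the theorem.

  After these substitutions the bracket is a polynomial in \<open>p, w, Q 2, Q 3\<close> and Bernoulli terms in which everything
  but \<open>(p - 1) * (1 + p * w + p ^ 2 * w ^ 2 + p ^ 3 * w ^ 3)\<close> cancels modulo \<open>p ^ 4\<close>, and \<open>(p - 1)! = p * w - 1\<close>.
\<close>

section \<open>Bernoulli numbers and power sums\<close>

text \<open>The number \<open>bernoulli (p - 1)\<close> has denominator \<open>p\<close>, so the
  trivial character must be left out of every Fourier sum; this is how the Wilson quotient enters
  the convolutions. The quantities \<open>gsum 2 0\<close>, \<open>delta\<close>, \<open>eps\<close>
  and \<open>beta\<close> are never evaluated: each occurs in several terms of the bracket, with
  coefficients of sum 0. The weights 4, -6, 4, -1 of \<open>P - 1\<close> and of the three numbers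
  \<open>P * B (k * (p - 1))\<close> extrapolate a cubic in \<open>k\<close> from 0, 1, 2, 3 to -1,
  which produces the sum of the inverses of \<open>1 + p * q a\<close>. A digit multiplied by
  \<open>p ^ 2\<close> must be known exactly and not only modulo \<open>p\<close>: digit 2 of
  \<open>X\<close> turns out to be digit 0 of the double convolution, and together with its digit 1
  the convolution itself reappears, which is why it is needed modulo \<open>p ^ 2\<close> while the
  triple one is needed modulo \<open>p\<close> only. The exceptional value \<open>B 1\<close>
  matters only at exponent 2; there the index 2 is paired with \<open>p - 3\<close>, so that
  multiples of \<open>D (p - 3)\<close> are left.\<close>

lemma sum_choose_bernoulli:
  assumes "m \<ge> 1"
  shows "(\<Sum>k\<le>m. of_nat (Suc m choose k) * bernoulli k) = 0"
proof -
  obtain n where m: "m = Suc n" using assms by (cases m) auto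
  have "of_nat (n+2) * bernoulli (Suc n) = - (\<Sum>k\<le>n. of_nat ((n + 2) choose k) * bernoulli k)"
    unfolding bernoulli.simps(2) by (simp del: of_nat_add)
  moreover have "Suc (Suc n) choose Suc n = n + 2" using binomial_Suc_n[of "Suc n"] by simp
  ultimately show ?thesis unfolding m by (simp del: of_nat_add bernoulli.simps binomial_Suc_Suc add: sum.atMost_Suc)
qed

declare bernoulli.simps(2) [simp del]

definition bernoulli_fps :: "rat fps" where
  "bernoulli_fps = Abs_fps (\<lambda>n. bernoulli n / fact n)"

text \<open>This is the generating function \<open>X / (exp X - 1)\<close>. It is stated as a
  product because \<open>fps_exp 1 - 1\<close> has constant coefficient 0 and hence no
  inverse.\<close>

lemma bernoulli_fps_mult_exp: "bernoulli_fps * (fps_exp 1 - 1) = fps_X"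
proof (rule fps_ext)
  fix n
  show "fps_nth (bernoulli_fps * (fps_exp 1 - 1)) n = fps_nth fps_X n"
  proof (cases n)
    case 0
    then show ?thesis by simp
  next
    case (Suc m)
    have "fps_nth (bernoulli_fps * (fps_exp 1 - 1)) n
        = (\<Sum>i\<le>Suc m. bernoulli i / fact i * fps_nth (fps_exp 1 - 1) (Suc m - i))"
      unfolding fps_mult_nth Suc by (simp add: bernoulli_fps_def atLeast0AtMost)
    also have "\<dots> = (\<Sum>i\<le>m. bernoulli i / fact i / fact (Suc m - i))"
      by (subst sum.atMost_Suc) (auto intro!: sum.cong simp: divide_simps)
    also have "\<dots> = (\<Sum>i\<le>m. of_nat (Suc m choose i) * bernoulli i) / fact (Suc m)"
      unfolding sum_divide_distrib
      by (intro sum.cong refl) (simp add: binomial_fact field_simps del: fact_Suc binomial_Suc_Suc)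
    also have "\<dots> = fps_nth fps_X n"
      using sum_choose_bernoulli[of m] by (cases m) (simp_all add: Suc)
    finally show ?thesis .
  qed
qed

lemma fps_exp_1_minus_1_nonzero: "fps_exp (1::rat) - 1 \<noteq> 0"
proof
  assume "fps_exp (1::rat) - 1 = 0"
  then have "fps_nth (fps_exp (1::rat) - 1) 1 = 0" by simp
  then show False by simp
qed

text \<open>Substituting \<open>-X\<close> and multiplying by \<open>exp X\<close> yields
  \<open>b(-X) = b(X) + X\<close> for the generating function \<open>b\<close>, which is therefore
  even up to its coefficient at 1. The factor \<open>exp X - 1\<close> may be cancelled since power
  series over a field have no zero divisors.\<close>

lemma bernoulli_odd:
  assumes "odd n" "n > 1"
  shows "bernoulli n = 0"
proof -
  let ?b = bernoulli_fps and ?e = "fps_exp (1::rat)"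
  let ?c = "?b oo (- fps_X)"
  have e: "?e oo (- fps_X) = fps_exp (-1)"
  proof -
    have "?e oo (fps_const (-1) * fps_X) = fps_exp (-1)"
      by (subst fps_compose_linear) (simp add: fps_exp_def fps_eq_iff power_minus')
    then show ?thesis by (simp add: fps_const_neg[symmetric] del: fps_const_neg)
  qed
  have "(?b * (?e - 1)) oo (- fps_X) = fps_X oo (- fps_X :: rat fps)"
    by (simp add: bernoulli_fps_mult_exp)
  then have "?c * (fps_exp (-1) - 1) = - fps_X"
    by (simp add: fps_compose_mult_distrib fps_compose_sub_distrib e)
  then have "?c * (fps_exp (-1) - 1) * ?e = - fps_X * ?e" by simp
  moreover have "(fps_exp (-1) - 1) * ?e = 1 - ?e"
    by (simp add: algebra_simps flip: fps_exp_add_mult)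
  ultimately have "?c * (?e - 1) = fps_X * ?e" by (metis (no_types, lifting) minus_diff_eq minus_mult_left minus_mult_right mult.assoc neg_equal_iff_equal)
  also have "\<dots> = (?b + fps_X) * (?e - 1)"
    by (simp add: algebra_simps) (metis bernoulli_fps_mult_exp mult.commute add_diff_cancel_left' diff_add_cancel left_diff_distrib mult_1)
  finally have "?c = ?b + fps_X" using fps_exp_1_minus_1_nonzero by simp
  then have "fps_nth ?c n = fps_nth (?b + fps_X) n" by simp
  moreover have "fps_nth ?c n = (-1)^n * fps_nth ?b n"
  proof -
    have "?b oo (fps_const (-1) * fps_X) = Abs_fps (\<lambda>n. (-1)^n * fps_nth ?b n)"
      by (rule fps_compose_linear)
    then show ?thesis by (simp add: fps_const_neg[symmetric] del: fps_const_neg)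
  qed
  ultimately show ?thesis using assms by (simp add: bernoulli_fps_def)
qed

text \<open>Coefficients are compared in \<open>b(X) * (exp (n X) - 1) = X * (1 + exp X + ... + exp
  ((n - 1) X))\<close>, which rests on a telescoping product. The terms are sorted by powers of
  \<open>n\<close>: for \<open>n = p\<close> the summand \<open>j = 0\<close> is
  \<open>p * B k\<close>, and the later ones carry higher powers of \<open>p\<close>.\<close>

lemma sum_powers_bernoulli:
  "(\<Sum>a<n. of_nat a ^ k) = (\<Sum>j\<le>k. of_nat (k choose j) * bernoulli (k - j) * of_nat n ^ Suc j / of_nat (Suc j))"
proof -
  let ?e = "fps_exp (1::rat)"
  have ge: "fps_exp (of_nat n) - 1 = (?e - 1) * (\<Sum>a<n. fps_exp (of_nat a :: rat))"
  proof (induction n)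
    case 0
    then show ?case by simp
  next
    case (Suc n)
    have "fps_exp (of_nat (Suc n)) = ?e * fps_exp (of_nat n :: rat)"
      by (simp flip: fps_exp_add_mult)
    then have "fps_exp (of_nat (Suc n)) - 1 = (fps_exp (of_nat n) - 1) + (?e - 1) * fps_exp (of_nat n :: rat)"
      by (simp only: left_diff_distrib) simp
    then show ?case unfolding Suc by (simp add: distrib_left)
  qed
  then have "bernoulli_fps * (fps_exp (of_nat n) - 1) = fps_X * (\<Sum>a<n. fps_exp (of_nat a :: rat))"
    by (simp add: bernoulli_fps_mult_exp flip: mult.assoc)
  then have "fps_nth (bernoulli_fps * (fps_exp (of_nat n) - 1)) (Suc k)
     = fps_nth (fps_X * (\<Sum>a<n. fps_exp (of_nat a :: rat))) (Suc k)" by simp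
  moreover have "fps_nth (fps_X * (\<Sum>a<n. fps_exp (of_nat a :: rat))) (Suc k) = (\<Sum>a<n. of_nat a ^ k) / fact k"
    by (simp add: fps_sum_nth sum_divide_distrib)
  moreover have "fps_nth (bernoulli_fps * (fps_exp (of_nat n) - 1)) (Suc k)
     = (\<Sum>i\<le>k. bernoulli i / fact i * (of_nat n ^ (Suc k - i) / fact (Suc k - i)))"
  proof -
    have "fps_nth (bernoulli_fps * (fps_exp (of_nat n) - 1)) (Suc k)
     = (\<Sum>i\<le>Suc k. bernoulli i / fact i * (fps_nth (fps_exp (of_nat n) - 1) (Suc k - i)))"
      unfolding fps_mult_nth by (simp add: bernoulli_fps_def atLeast0AtMost)
    also have "\<dots> = (\<Sum>i\<le>k. bernoulli i / fact i * (of_nat n ^ (Suc k - i) / fact (Suc k - i)))"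
      by (subst sum.atMost_Suc) (auto intro!: sum.cong)
    finally show ?thesis .
  qed
  ultimately have "(\<Sum>a<n. of_nat a ^ k) = fact k * (\<Sum>i\<le>k. bernoulli i / fact i * (of_nat n ^ (Suc k - i) / fact (Suc k - i)))"
    by simp
  also have "\<dots> = fact k * (\<Sum>j\<le>k. bernoulli (k - j) / fact (k - j) * (of_nat n ^ Suc j / fact (Suc j)))"
    by (intro arg_cong2[where f="(*)"] refl sum.reindex_bij_witness[of _ "\<lambda>j. k - j" "\<lambda>j. k - j"])
       (auto simp: Suc_diff_le)
  also have "\<dots> = (\<Sum>j\<le>k. of_nat (k choose j) * bernoulli (k - j) * of_nat n ^ Suc j / of_nat (Suc j))"
    unfolding sum_distrib_left
    by (intro sum.cong refl) (simp add: binomial_fact field_simps)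
  finally show ?thesis .
qed

lemma bernoulli_values:
  "bernoulli 0 = 1" "bernoulli (Suc 0) = -1/2" "bernoulli 2 = 1/6" "bernoulli 4 = -1/30"
proof -
  show *: "bernoulli 0 = 1" "bernoulli (Suc 0) = -1/2" by (simp_all add: bernoulli.simps)
  show **: "bernoulli 2 = 1/6"
    using bernoulli.simps(2)[of 1] * by (simp add: numeral_2_eq_2)
  have "bernoulli 3 = 0" by (rule bernoulli_odd) auto
  then show "bernoulli 4 = -1/30"
    using bernoulli.simps(2)[of 3] * ** by (simp add: eval_nat_numeral)
qed

text \<open>Each p-th power gains one factor \<open>p\<close>: in the factorization of
  \<open>x ^ p - y ^ p\<close> the cofactor of \<open>x - y\<close> is congruent to
  \<open>p * y ^ (p - 1)\<close> as soon as \<open>x\<close> and \<open>y\<close> agree modulo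
  \<open>p\<close>.\<close>

lemma lift_power_dvd:
  fixes x y :: int
  assumes "int p dvd x - y"
  shows "int p ^ Suc n dvd x ^ (p ^ n) - y ^ (p ^ n)"
proof (induction n)
  case 0
  then show ?case using assms by simp
next
  case (Suc n)
  let ?x = "x ^ (p ^ n)" and ?y = "y ^ (p ^ n)"
  have xy: "[?x = ?y] (mod int p)"
    using assms by (intro cong_pow) (simp add: cong_iff_dvd_diff)
  have "[(\<Sum>i<p. ?x ^ i * ?y ^ (p - Suc i)) = (\<Sum>i<p. ?y ^ i * ?y ^ (p - Suc i))] (mod int p)"
    by (intro cong_sum cong_mult cong_pow xy cong_refl)
  also have "(\<Sum>i<p. ?y ^ i * ?y ^ (p - Suc i)) = (\<Sum>i<p. ?y ^ (p - 1))"
    by (intro sum.cong refl) (simp flip: power_add)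
  finally have "int p dvd (\<Sum>i<p. ?x ^ i * ?y ^ (p - Suc i))"
    by (simp add: cong_dvd_iff)
  with Suc have "int p ^ Suc n * int p dvd (?x - ?y) * (\<Sum>i<p. ?x ^ i * ?y ^ (p - Suc i))"
    by (rule mult_dvd_mono)
  also have "(?x - ?y) * (\<Sum>i<p. ?x ^ i * ?y ^ (p - Suc i)) = ?x ^ p - ?y ^ p"
    by (simp add: power_diff_sumr2 mult.commute)
  finally show ?case by (simp add: power_mult mult.commute flip: power_mult)
qed

section \<open>Congruences in the localisation at a prime\<close>

lemma padic_integersI: "\<not> int p dvd b \<Longrightarrow> of_int a / of_int b \<in> padic_integers p"
  unfolding padic_integers_def by blast

lemma padic_integersE:
  assumes "x \<in> padic_integers p"
  obtains a b where "\<not> int p dvd b" "b \<noteq> 0" "x = of_int a / of_int b"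
  using assms unfolding padic_integers_def by fastforce

locale padic_prime =
  fixes p :: nat
  assumes prime: "prime p" and p_ge: "p \<ge> 11"
begin

abbreviation R :: "rat set" where "R \<equiv> padic_integers p"
abbreviation P :: rat where "P \<equiv> of_nat p"
abbreviation pcong :: "nat \<Rightarrow> rat \<Rightarrow> rat \<Rightarrow> bool" where "pcong \<equiv> padic_cong p"

lemma P_nonzero [simp]: "P \<noteq> 0"
  using p_ge by simp

lemma R_of_int [simp, intro]: "of_int a \<in> R"
  using padic_integersI[of p 1 a] p_ge by (simp add: zdvd1_eq)

lemma R_of_nat [simp, intro]: "of_nat a \<in> R"
  using R_of_int[of "int a"] by simp

lemma R_0 [simp, intro]: "0 \<in> R" and R_1 [simp, intro]: "1 \<in> R" and R_numeral [simp, intro]: "numeral n \<in> R"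
  using R_of_int[of 0] R_of_int[of 1] R_of_int[of "numeral n"] by simp_all

lemma R_add [simp, intro]: assumes "x \<in> R" "y \<in> R" shows "x + y \<in> R"
proof -
  from assms obtain a b c d where "\<not> int p dvd b" "\<not> int p dvd d" "b \<noteq> 0" "d \<noteq> 0"
    "x = of_int a / of_int b" "y = of_int c / of_int d" by (auto elim!: padic_integersE)
  moreover from this have "x + y = of_int (a * d + c * b) / of_int (b * d)"
    by (simp add: field_simps)
  ultimately show ?thesis using prime by (metis padic_integersI prime_dvd_mult_iff prime_nat_int_transfer)
qed

lemma R_mult [simp, intro]: assumes "x \<in> R" "y \<in> R" shows "x * y \<in> R"
proof -
  from assms obtain a b c d where "\<not> int p dvd b" "\<not> int p dvd d" "b \<noteq> 0" "d \<noteq> 0"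
    "x = of_int a / of_int b" "y = of_int c / of_int d" by (auto elim!: padic_integersE)
  moreover from this have "x * y = of_int (a * c) / of_int (b * d)"
    by (simp add: field_simps)
  ultimately show ?thesis using prime by (metis padic_integersI prime_dvd_mult_iff prime_nat_int_transfer)
qed

lemma R_minus [simp, intro]: "x \<in> R \<Longrightarrow> - x \<in> R"
  using R_mult[of "-1" x] R_of_int[of "-1"] by simp

lemma R_diff [simp, intro]: "x \<in> R \<Longrightarrow> y \<in> R \<Longrightarrow> x - y \<in> R"
  using R_add[of x "-y"] by simp

lemma R_power [simp, intro]: "x \<in> R \<Longrightarrow> x ^ n \<in> R"
  by (induction n) auto

lemma R_sum [intro]: "(\<And>i. i \<in> A \<Longrightarrow> f i \<in> R) \<Longrightarrow> (\<Sum>i\<in>A. f i) \<in> R"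
  by (induction A rule: infinite_finite_induct) auto

lemma R_divide_of_int: "x \<in> R \<Longrightarrow> \<not> int p dvd b \<Longrightarrow> x / of_int b \<in> R"
  using R_mult[of x "1 / of_int b"] padic_integersI[of p b 1] by simp

lemma R_divide_of_nat: "x \<in> R \<Longrightarrow> \<not> p dvd b \<Longrightarrow> x / of_nat b \<in> R"
  using R_divide_of_int[of x "int b"] by simp

lemma R_divide_less: "x \<in> R \<Longrightarrow> 0 < b \<Longrightarrow> b < p \<Longrightarrow> x / of_nat b \<in> R"
  by (rule R_divide_of_nat) (auto dest: dvd_imp_le)

lemma R_divide_numeral [simp, intro]:
  assumes "x \<in> R"
  shows "x / 2 \<in> R" "x / 3 \<in> R" "x / 4 \<in> R" "x / 5 \<in> R" "x / 6 \<in> R" "x / 10 \<in> R"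
    "x / 12 \<in> R" "x / 24 \<in> R" "x / 72 \<in> R"
proof -
  note * = R_divide_less[of _ "numeral k" for k, simplified]
  have 2: "x / 2 \<in> R" if "x \<in> R" for x using *[of x "Num.Bit0 Num.One"] that p_ge by simp
  have 3: "x / 3 \<in> R" if "x \<in> R" for x using *[of x "Num.Bit1 Num.One"] that p_ge by simp
  have 5: "x / 5 \<in> R" if "x \<in> R" for x using *[of x "Num.Bit1 (Num.Bit0 Num.One)"] that p_ge by simp
  show "x / 2 \<in> R" "x / 3 \<in> R" "x / 5 \<in> R" using 2 3 5 assms by auto
  show "x / 4 \<in> R" using 2[OF 2[OF assms]] by simp
  show "x / 6 \<in> R" using 2[OF 3[OF assms]] by simp
  show "x / 10 \<in> R" using 2[OF 5[OF assms]] by simp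
  show "x / 12 \<in> R" using 2[OF 2[OF 3[OF assms]]] by simp
  show "x / 24 \<in> R" using 2[OF 2[OF 2[OF 3[OF assms]]]] by simp
  show "x / 72 \<in> R" using 3[OF 2[OF 2[OF 2[OF 3[OF assms]]]]] by simp
qed

lemma pcongI: "x - y = P ^ n * z \<Longrightarrow> z \<in> R \<Longrightarrow> pcong n x y"
  unfolding padic_cong_def by blast

lemma pcongE:
  assumes "pcong n x y"
  obtains z where "z \<in> R" "x = y + P ^ n * z"
  using assms unfolding padic_cong_def by (metis add_diff_cancel_left' diff_add_cancel add.commute)

lemma pcong_refl [simp, intro]: "pcong n x x"
  by (rule pcongI[of _ _ _ 0]) auto

lemma pcong_sym: "pcong n x y \<Longrightarrow> pcong n y x"
  by (elim pcongE, rule_tac z="-z" in pcongI) auto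

lemma pcong_trans [trans]:
  assumes "pcong n x y" "pcong n y z" shows "pcong n x z"
proof -
  from assms obtain u v where "u \<in> R" "v \<in> R" "x = y + P ^ n * u" "y = z + P ^ n * v"
    by (auto elim!: pcongE)
  then show ?thesis by (intro pcongI[of _ _ _ "u + v"]) (auto simp: algebra_simps)
qed

lemma pcong_add: "pcong n a b \<Longrightarrow> pcong n c d \<Longrightarrow> pcong n (a + c) (b + d)"
  by (elim pcongE, rule_tac z="z + za" in pcongI) (auto simp: algebra_simps)

lemma pcong_minus: "pcong n a b \<Longrightarrow> pcong n (- a) (- b)"
  by (elim pcongE, rule_tac z="- z" in pcongI) (auto simp: algebra_simps)

lemma pcong_diff: "pcong n a b \<Longrightarrow> pcong n c d \<Longrightarrow> pcong n (a - c) (b - d)"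
  using pcong_add[of n a b "-c" "-d"] pcong_minus[of n c d] by simp

lemma pcong_cmult: "pcong n a b \<Longrightarrow> c \<in> R \<Longrightarrow> pcong n (c * a) (c * b)"
  by (elim pcongE, rule_tac z="c * z" in pcongI) (auto simp: algebra_simps)

lemma pcong_mult:
  assumes "pcong n a b" "pcong n c d" "a \<in> R" "d \<in> R" shows "pcong n (a * c) (b * d)"
proof -
  have "pcong n (a * c) (a * d)" using assms by (intro pcong_cmult)
  also have "pcong n (a * d) (b * d)" using pcong_cmult[OF assms(1,4)] by (simp add: mult.commute)
  finally show ?thesis .
qed

lemma pcong_R: "pcong n a b \<Longrightarrow> b \<in> R \<Longrightarrow> a \<in> R"
  by (elim pcongE) auto

lemma pcong_R': "pcong n a b \<Longrightarrow> a \<in> R \<Longrightarrow> b \<in> R"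
  using pcong_R pcong_sym by blast

lemma pcong_power: "pcong n a b \<Longrightarrow> a \<in> R \<Longrightarrow> pcong n (a ^ k) (b ^ k)"
  by (induction k) (auto intro!: pcong_mult dest: pcong_R')

lemma pcong_sum: "(\<And>i. i \<in> A \<Longrightarrow> pcong n (f i) (g i)) \<Longrightarrow> pcong n (\<Sum>i\<in>A. f i) (\<Sum>i\<in>A. g i)"
  by (induction A rule: infinite_finite_induct) (auto intro!: pcong_add)

lemma pcong_le: "pcong m x y \<Longrightarrow> n \<le> m \<Longrightarrow> pcong n x y"
  by (elim pcongE, rule_tac z="P ^ (m - n) * z" in pcongI) (auto simp flip: mult.assoc power_add)

text \<open>A factor \<open>P ^ k\<close> gains \<open>k\<close> digits, so its cofactor need only
  be known modulo a lower power of \<open>p\<close>. Most of the precision bookkeeping is done by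
  this rule and its converse \<open>pcong_unscale\<close>.\<close>

lemma pcong_scale: "pcong m x y \<Longrightarrow> n \<le> m + k \<Longrightarrow> pcong n (P ^ k * x) (P ^ k * y)"
  by (rule pcong_le[of "k + m"], elim pcongE, rule_tac z=z in pcongI) (auto simp: algebra_simps power_add)

lemma pcong_scale1: "pcong m x y \<Longrightarrow> n \<le> Suc m \<Longrightarrow> pcong n (P * x) (P * y)"
  using pcong_scale[of m x y n 1] by simp

lemma pcong_unscale:
  assumes "pcong (n + k) (P ^ k * x) (P ^ k * y)" shows "pcong n x y"
proof -
  from assms obtain z where "z \<in> R" "P ^ k * x - P ^ k * y = P ^ (n + k) * z"
    unfolding padic_cong_def by blast
  then have "P ^ k * (x - y) = P ^ k * (P ^ n * z)" by (simp add: algebra_simps power_add)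
  then have "x - y = P ^ n * z" using p_ge by simp
  with \<open>z \<in> R\<close> show ?thesis by (rule pcongI[rotated])
qed

lemma pcong_unscale1: "pcong (Suc n) (P * x) (P * y) \<Longrightarrow> pcong n x y"
  using pcong_unscale[of n 1 x y] by simp

lemma pcong_P_mult: "x \<in> R \<Longrightarrow> n \<le> k \<Longrightarrow> pcong n (P ^ k * x) 0"
  using pcong_scale[of 0 x 0 n k] by (simp add: pcongI[of x 0 0 x])

lemma pcong_0 [simp]: "pcong 0 x y \<longleftrightarrow> x - y \<in> R"
  by (auto simp: padic_cong_def)

lemma pcong_eq_diff: "pcong n x y \<longleftrightarrow> pcong n (x - y) 0"
  by (simp add: padic_cong_def)

lemma pcong_cancel:
  assumes "pcong n (of_nat c * x) (of_nat c * y)" "\<not> p dvd c"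
  shows "pcong n x y"
proof -
  have "c \<noteq> 0" using assms(2) by (metis dvd_0_right)
  with assms(2) have c: "1 / of_nat c \<in> R" "of_nat c \<noteq> (0::rat)"
    by (auto intro!: R_divide_of_nat)
  with pcong_cmult[OF assms(1) c(1)] show ?thesis by simp
qed

lemma pcong_of_int: "pcong n (of_int x) (of_int y) \<longleftrightarrow> int p ^ n dvd x - y"
proof
  assume "pcong n (of_int x) (of_int y)"
  then obtain z where z: "z \<in> R" "of_int x = of_int y + P ^ n * z" by (rule pcongE)
  from z(1) obtain a b where ab: "\<not> int p dvd b" "b \<noteq> 0" "z = of_int a / of_int b" by (rule padic_integersE)
  from z(2) ab have "of_int ((x - y) * b) = (of_int (int p ^ n * a) :: rat)" by (simp add: field_simps)
  then have "(x - y) * b = int p ^ n * a" by (simp only: of_int_eq_iff)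
  then have "int p ^ n dvd (x - y) * b" by simp
  moreover have "coprime (int p ^ n) b"
    using ab(1) prime by (simp add: prime_imp_coprime)
  ultimately show "int p ^ n dvd x - y" by (simp add: coprime_dvd_mult_left_iff)
next
  assume "int p ^ n dvd x - y"
  then obtain z where "x - y = int p ^ n * z" by (auto elim: dvdE)
  then have "of_int x - of_int y = (of_int (int p ^ n * z) :: rat)" by (metis of_int_diff)
  then show "pcong n (of_int x) (of_int y)" by (intro pcongI[of _ _ _ "of_int z"]) auto
qed

lemma pcong_of_nat: "pcong n (of_nat x) (of_nat y) \<longleftrightarrow> [x = y] (mod p ^ n)"
  using pcong_of_int[of n "int x" "int y"] by (simp add: cong_iff_dvd_diff flip: cong_int_iff)

section \<open>Power sums modulo powers of a prime\<close>

text \<open>Controls the denominators \<open>j + 1\<close> in Faulhaber's formula: from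
  \<open>j = 4\<close> on, a summand keeps four factors \<open>p\<close> after the division.\<close>

lemma R_P_power_divide:
  assumes "j \<ge> 4"
  shows "P ^ (j - 4) / of_nat (Suc j) \<in> R"
proof -
  define v where "v = multiplicity p (Suc j)"
  obtain u where u: "Suc j = p ^ v * u" "\<not> p dvd u"
    unfolding v_def by (rule multiplicity_decompose'[of "Suc j" p]) (use prime in \<open>auto simp: prime_nat_iff\<close>)
  have "v \<le> j - 4"
  proof (rule ccontr)
    assume "\<not> v \<le> j - 4"
    then have v: "j \<le> v + 3" "v \<ge> 1" using assms by auto
    have "u > 0" using u(2) by (cases u) auto
    \<comment> \<open>Together with \<open>j + 1 <= v + 4\<close> this chain would give
      \<open>1 + 10 * v <= v + 4\<close>, which is impossible for \<open>v >= 1\<close>.\<close>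
    have "1 + 10 * v \<le> 11 ^ v" by (induction v) auto
    also have "\<dots> \<le> p ^ v" using p_ge by (simp add: power_mono)
    also have "\<dots> \<le> Suc j" using u(1) \<open>u > 0\<close> by simp
    finally show False using v by simp
  qed
  then have "P ^ (j - 4) = P ^ v * P ^ (j - 4 - v)" by (metis le_add_diff_inverse power_add)
  moreover have "of_nat (Suc j) = P ^ v * of_nat u" using u(1) by (metis of_nat_mult of_nat_power)
  ultimately have "P ^ (j - 4) / of_nat (Suc j) = P ^ (j - 4 - v) / of_nat u" using p_ge by simp
  also have "\<dots> \<in> R" using u(2) by (intro R_divide_of_nat) auto
  finally show ?thesis .
qed

lemma R_P_power_divide1: 
  assumes "j \<ge> 1"
  shows "P ^ j / of_nat (Suc j) \<in> R"
proof (cases "j \<ge> 4")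
  case True
  then have "P ^ j / of_nat (Suc j) = P ^ 4 * (P ^ (j - 4) / of_nat (Suc j))"
    by (simp flip: power_add)
  then show ?thesis using R_P_power_divide[OF True] by (metis R_mult R_of_nat R_power)
next
  case False
  then have "Suc j < p" using p_ge by simp
  then show ?thesis by (intro R_divide_less) auto
qed

lemma sum_powers_split:
  "(\<Sum>a<p. of_nat a ^ k) = P * bernoulli k +
     (\<Sum>j=1..k. of_nat (k choose j) * (P * bernoulli (k - j)) * (P ^ j / of_nat (Suc j)))"
proof -
  have "{..k} = insert 0 {1..k}" by auto
  then show ?thesis unfolding sum_powers_bernoulli by (simp add: mult_ac)
qed

text \<open>The weak form of von Staudt's theorem: Faulhaber's formula, solved for its leading term,
  expresses \<open>P * B k\<close> by integers and earlier values, with coefficients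
  \<open>P ^ j / (j + 1)\<close> from \<open>R\<close>.\<close>

lemma R_P_bernoulli [simp, intro]: "P * bernoulli k \<in> R"
proof (induction k rule: less_induct)
  case (less k)
  have "(\<Sum>j=1..k. of_nat (k choose j) * (P * bernoulli (k - j)) * (P ^ j / of_nat (Suc j))) \<in> R"
    by (intro R_sum R_mult R_P_power_divide1 less) auto
  moreover have "P * bernoulli k = (\<Sum>a<p. of_nat a ^ k) -
     (\<Sum>j=1..k. of_nat (k choose j) * (P * bernoulli (k - j)) * (P ^ j / of_nat (Suc j)))"
    using sum_powers_split[of k] by simp
  ultimately show ?case by (metis (no_types, lifting) R_diff R_of_nat R_power R_sum)
qed

text \<open>For even \<open>k\<close> the summands \<open>j = 1\<close> and \<open>j = 3\<close>
  contain Bernoulli numbers of odd index. Only \<open>B 1\<close>, at \<open>k = 4\<close> and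
  \<open>j = 3\<close>, is nonzero, and its summand is a multiple of \<open>P ^ 4\<close>. The
  correction that remains belongs to \<open>j = 2\<close>.\<close>

lemma sum_powers_pcong:
  assumes "even k" "k \<ge> 4"
  shows "pcong 4 (\<Sum>a<p. of_nat a ^ k) (P * bernoulli k + of_nat (k choose 2) * P ^ 3 / 3 * bernoulli (k - 2))"
proof -
  let ?f = "\<lambda>j. of_nat (k choose j) * (P * bernoulli (k - j)) * (P ^ j / of_nat (Suc j))"
  have "(\<Sum>a<p. of_nat a ^ k) = P * bernoulli k + (\<Sum>j=1..k. ?f j)" by (rule sum_powers_split)
  also have "{1..k} = {1,2,3} \<union> {4..k}" using assms by auto
  also have "sum ?f \<dots> = ?f 1 + ?f 2 + ?f 3 + (\<Sum>j=4..k. ?f j)"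
    by (subst sum.union_disjoint) auto
  also have "?f 1 = 0" using assms bernoulli_odd[of "k - 1"] by simp
  finally have eq: "(\<Sum>a<p. of_nat a ^ k) - (P * bernoulli k + ?f 2) = ?f 3 + (\<Sum>j=4..k. ?f j)" by simp
  have "pcong 4 (?f 3) 0"
  proof (cases "k = 4")
    case True
    then have "?f 3 = P ^ 4 * (- (1/2))" by (simp add: bernoulli_values eval_nat_numeral)
    then show ?thesis by (metis R_1 R_divide_numeral(1) R_minus pcong_P_mult order_refl)
  next
    case False
    with assms have "k \<ge> 6" by presburger
    then have "bernoulli (k - 3) = 0" using assms by (intro bernoulli_odd) auto
    then show ?thesis by simp
  qed
  moreover have "pcong 4 (\<Sum>j=4..k. ?f j) (\<Sum>j=4..k. 0)"
  proof (rule pcong_sum)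
    fix j assume "j \<in> {4..k}"
    then have j: "j \<ge> 4" by simp
    then have "?f j = P ^ 4 * (of_nat (k choose j) * (P * bernoulli (k - j)) * (P ^ (j - 4) / of_nat (Suc j)))"
      by (simp flip: power_add)
    then show "pcong 4 (?f j) 0"
      using R_P_power_divide[OF j] by (metis R_P_bernoulli R_mult R_of_nat pcong_P_mult order_refl)
  qed
  ultimately have "pcong 4 (?f 3 + (\<Sum>j=4..k. ?f j)) (0 + (\<Sum>j=4..k. 0))" by (rule pcong_add)
  with eq have "pcong 4 (\<Sum>a<p. of_nat a ^ k) (P * bernoulli k + ?f 2)"
    by (subst pcong_eq_diff) simp
  moreover have "?f 2 = of_nat (k choose 2) * P ^ 3 / 3 * bernoulli (k - 2)"
    by (simp add: power2_eq_square power3_eq_cube)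
  ultimately show ?thesis by (simp only:)
qed

section \<open>Moments of the Fermat quotients\<close>

abbreviation q :: "nat \<Rightarrow> rat" where "q \<equiv> fermat_quotient p"

text \<open>With integer exponents \<open>k\<close> the same sums serve as power sums
  (\<open>j = 0\<close>), as Fourier coefficients of powers of \<open>q\<close>, and as plain
  moments (\<open>k = 0\<close>).\<close>

definition qsum :: "nat \<Rightarrow> int \<Rightarrow> rat" where
  "qsum j k = (\<Sum>a=1..p-1. of_nat a powi k * q a ^ j)"

lemma not_p_dvd: "a \<in> {1..p-1} \<Longrightarrow> \<not> p dvd a"
  using p_ge by (auto dest: dvd_imp_le)

lemma power_p_minus_1: "of_nat a ^ (p - 1) = 1 + P * q a"
  by (simp add: fermat_quotient_def)

lemma R_q [simp, intro]:
  assumes "\<not> p dvd a" shows "q a \<in> R"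
proof -
  have "[a ^ (p - 1) = 1] (mod p)" using prime assms by (rule fermat_theorem)
  then have "pcong 1 (of_nat (a ^ (p - 1))) (of_nat 1)" by (subst pcong_of_nat) simp
  then have "pcong (Suc 0) (P * q a) (P * 0)"
    using p_ge by (subst (asm) pcong_eq_diff) (simp add: fermat_quotient_def)
  then have "pcong 0 (q a) 0" by (rule pcong_unscale1)
  then show ?thesis by simp
qed

lemma R_powi [simp, intro]:
  assumes "\<not> p dvd a" shows "of_nat a powi k \<in> R"
  using assms R_power[OF R_divide_of_nat[OF R_1 assms], of "nat (-k)"]
  by (cases "k \<ge> 0") (auto simp: power_int_def divide_simps power_inverse)

lemma R_qsum [simp, intro]: "qsum j k \<in> R"
  unfolding qsum_def using not_p_dvd by (intro R_sum R_mult R_power R_powi R_q)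

text \<open>Since \<open>a ^ (p - 1) = 1 + P * q a\<close>, raising the exponent by one period
  \<open>p - 1\<close> acts as a difference operator; the sums with higher \<open>j\<close> are the
  iterated differences divided by powers of \<open>P\<close>.\<close>

lemma qsum_shift: "qsum j (k + int (p - 1)) = qsum j k + P * qsum (Suc j) k"
  unfolding qsum_def sum_distrib_left sum.distrib[symmetric]
  by (intro sum.cong refl) (simp add: power_int_add power_p_minus_1[unfolded One_nat_def] algebra_simps)

lemma sum_lessThan_qsum: "k > 0 \<Longrightarrow> (\<Sum>a<p. of_nat a ^ k) = qsum 0 (int k)"
proof -
  assume "k > 0"
  have "{..<p} = insert 0 {1..p-1}" using p_ge by auto
  with \<open>k > 0\<close> show ?thesis by (simp add: qsum_def)
qed

text \<open>Multiplication by a primitive root \<open>g\<close> permutes the residues. Reducing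
  \<open>g * a\<close> modulo \<open>p\<close> inside the power changes it only by multiples of
  \<open>p ^ Suc n\<close>, because the exponent \<open>m = k * p ^ n\<close> contains
  \<open>p ^ n\<close>. So \<open>g ^ m - 1\<close> times the sum vanishes, and this factor is a
  unit as \<open>p - 1\<close> does not divide \<open>m\<close>.\<close>

lemma qsum_0_power_p:
  assumes "\<not> (p - 1) dvd k"
  shows "pcong (Suc n) (qsum 0 (int (k * p ^ n))) 0"
proof -
  obtain g where g: "residue_primroot p g"
    using prime prime_primitive_root_exists[of p] prime_gt_1_nat by blast
  let ?m = "k * p ^ n"
  have cop: "coprime p g" and ord: "ord p g = p - 1"
    using g prime unfolding residue_primroot_def by (auto simp: totient_prime)
  have inj: "inj_on (\<lambda>a. (g * a) mod p) {1..p-1}"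
  proof (rule inj_onI)
    fix a b assume ab: "a \<in> {1..p-1}" "b \<in> {1..p-1}" "(g * a) mod p = (g * b) mod p"
    then have "[g * a = g * b] (mod p)" by (simp add: cong_def)
    then have "[a = b] (mod p)" using cop by (simp add: cong_mult_lcancel_nat coprime_commute)
    then show "a = b" using ab p_ge by (auto simp: cong_def mod_less)
  qed
  have "(\<lambda>a. (g * a) mod p) ` {1..p-1} \<subseteq> {1..p-1}"
  proof
    fix b assume "b \<in> (\<lambda>a. (g * a) mod p) ` {1..p-1}"
    then obtain a where a: "a \<in> {1..p-1}" "b = (g * a) mod p" by auto
    have "\<not> p dvd g" using cop prime by (metis coprime_absorb_left not_prime_unit)
    then have "\<not> p dvd g * a" using not_p_dvd[OF a(1)] prime by (simp add: prime_dvd_mult_iff)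
    then have "b \<noteq> 0" using a by (auto simp: mod_eq_0_iff_dvd)
    moreover have "b < p" using a p_ge by simp
    ultimately show "b \<in> {1..p-1}" by auto
  qed
  then have img: "(\<lambda>a. (g * a) mod p) ` {1..p-1} = {1..p-1}"
    using inj by (intro endo_inj_surj) auto
  define s where "s = (\<Sum>a=1..p-1. int a ^ ?m)"
  have "s = (\<Sum>a=1..p-1. int ((g * a) mod p) ^ ?m)"
    unfolding s_def by (subst img[symmetric], subst sum.reindex[OF inj]) simp
  also have "[\<dots> = (\<Sum>a=1..p-1. int (g * a) ^ ?m)] (mod int p ^ Suc n)"
  proof (rule cong_sum)
    fix a
    have "int p dvd int ((g * a) mod p) - int (g * a)"
      by (metis cong_iff_dvd_diff cong_int_iff cong_mod_left cong_refl)
    then have "int p dvd int ((g * a) mod p) ^ k - int (g * a) ^ k"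
      by (metis cong_iff_dvd_diff cong_pow)
    from lift_power_dvd[OF this, of n]
    show "[int ((g * a) mod p) ^ ?m = int (g * a) ^ ?m] (mod int p ^ Suc n)"
      by (simp add: cong_iff_dvd_diff power_mult)
  qed
  also have "(\<Sum>a=1..p-1. int (g * a) ^ ?m) = int g ^ ?m * s"
    unfolding s_def by (simp add: power_mult_distrib sum_distrib_left)
  finally have "int p ^ Suc n dvd (int g ^ ?m - 1) * s"
    by (simp add: cong_iff_dvd_diff algebra_simps dvd_diff_commute)
  moreover have "coprime (int p ^ Suc n) (int g ^ ?m - 1)"
  proof -
    have "\<not> int p dvd int g ^ ?m - 1"
    proof
      assume "int p dvd int g ^ ?m - 1"
      then have "[g ^ ?m = 1] (mod p)"
        by (metis cong_iff_dvd_diff cong_int_iff of_nat_1 of_nat_power)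
      then have "p - 1 dvd k * p ^ n" using ord by (metis ord_divides)
      moreover have "coprime (p - 1) (p ^ n)"
        using p_ge coprime_diff_one_left_nat[of p] by simp
      ultimately show False using assms by (simp add: coprime_dvd_mult_left_iff)
    qed
    then show ?thesis using prime by (simp add: prime_imp_coprime)
  qed
  ultimately have "int p ^ Suc n dvd s - 0" by (simp add: coprime_dvd_mult_right_iff)
  then have "pcong (Suc n) (of_int s) (of_int 0)" by (simp only: pcong_of_int)
  moreover have "of_int s = qsum 0 (int ?m)"
    by (simp add: s_def qsum_def power_int_of_nat del: of_nat_mult of_nat_power)
  ultimately show ?thesis by simp
qed

lemma qsum_pcong1: "pcong 1 (qsum j (k + int s * int (p - 1))) (qsum j k)"
proof (induction s)
  case 0
  then show ?case by simp
next
  case (Suc s)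
  have "qsum j (k + int (Suc s) * int (p - 1)) = qsum j (k + int s * int (p - 1)) + P * qsum (Suc j) (k + int s * int (p - 1))"
    by (subst qsum_shift[symmetric]) (simp add: algebra_simps)
  also have "pcong 1 \<dots> (qsum j k + 0)"
    using pcong_P_mult[of _ 1 1] by (intro pcong_add Suc) auto
  finally show ?case by simp
qed

lemma qsum_pcong2: "pcong 2 (qsum j (k + int s * int (p - 1))) (qsum j k + of_nat s * P * qsum (Suc j) k)"
proof (induction s)
  case 0
  then show ?case by simp
next
  case (Suc s)
  have "qsum j (k + int (Suc s) * int (p - 1)) = qsum j (k + int s * int (p - 1)) + P * qsum (Suc j) (k + int s * int (p - 1))"
    by (subst qsum_shift[symmetric]) (simp add: algebra_simps)
  also have "pcong 2 \<dots> (qsum j k + of_nat s * P * qsum (Suc j) k + P * qsum (Suc j) k)"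
    by (intro pcong_add Suc pcong_scale1[OF qsum_pcong1]) auto
  finally show ?case by (simp add: algebra_simps)
qed

text \<open>Newton's forward expansion in the number \<open>s\<close> of periods, cut off where the
  next difference would carry \<open>P ^ 3\<close>.\<close>

lemma qsum_pcong3: "pcong 3 (qsum j (k + int s * int (p - 1)))
   (qsum j k + of_nat s * P * qsum (Suc j) k + of_nat s * (of_nat s - 1) / 2 * P ^ 2 * qsum (Suc (Suc j)) k)"
proof (induction s)
  case 0
  then show ?case by simp
next
  case (Suc s)
  have "qsum j (k + int (Suc s) * int (p - 1)) = qsum j (k + int s * int (p - 1)) + P * qsum (Suc j) (k + int s * int (p - 1))"
    by (subst qsum_shift[symmetric]) (simp add: algebra_simps)
  also have "pcong 3 \<dots> ((qsum j k + of_nat s * P * qsum (Suc j) k + of_nat s * (of_nat s - 1) / 2 * P ^ 2 * qsum (Suc (Suc j)) k)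
     + P * (qsum (Suc j) k + of_nat s * P * qsum (Suc (Suc j)) k))"
    by (intro pcong_add Suc pcong_scale1[OF qsum_pcong2]) auto
  finally show ?case by (simp add: field_simps power2_eq_square)
qed

section \<open>Kummer congruences\<close>

abbreviation B :: "nat \<Rightarrow> rat" where "B \<equiv> bernoulli"
abbreviation D :: "nat \<Rightarrow> rat" where "D \<equiv> divided_bernoulli"

lemma B_eq_D: "k > 0 \<Longrightarrow> B k = of_nat k * D k"
  by (simp add: divided_bernoulli_def)

lemma even_p_minus_1: "even (p - 1)" and odd_p: "odd p"
  using prime p_ge prime_odd_nat[of p] by auto

lemma qsum_0_pcong_P_bernoulli:
  assumes "even k" "k \<ge> 4"
  shows "pcong 2 (qsum 0 (int k)) (P * B k)"
proof -
  have "pcong 4 (qsum 0 (int k)) (P * B k + of_nat (k choose 2) * P ^ 3 / 3 * B (k - 2))"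
    using sum_powers_pcong[OF assms] sum_lessThan_qsum[of k] assms by simp
  then have "pcong 2 (qsum 0 (int k)) (P * B k + of_nat (k choose 2) * P ^ 3 / 3 * B (k - 2))"
    by (rule pcong_le) simp
  also have "of_nat (k choose 2) * P ^ 3 / 3 * B (k - 2) = P ^ 2 * (of_nat (k choose 2) / 3 * (P * B (k - 2)))"
    by (simp add: power2_eq_square power3_eq_cube)
  also have "pcong 2 (P * B k + \<dots>) (P * B k + 0)"
    by (intro pcong_add pcong_refl pcong_P_mult R_mult R_P_bernoulli R_divide_numeral) auto
  finally show ?thesis by simp
qed

text \<open>The power sum of exponent \<open>k\<close> vanishes modulo \<open>p\<close>, so the
  p-integral number \<open>P * B k\<close> has a factor \<open>p\<close> to spare.\<close>

lemma R_bernoulli: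
  assumes "\<not> (p - 1) dvd k"
  shows "B k \<in> R"
proof -
  consider "k = 0" | "k = 1" | "k = 2" | "k \<ge> 3" "odd k" | "k \<ge> 4" "even k" 
    by atomize_elim presburger
  then show ?thesis
  proof cases
    case 4
    then have "B k = 0" by (intro bernoulli_odd) auto
    then show ?thesis by simp
  next
    case 5
    have "pcong 2 (P * B k) (qsum 0 (int k))" using 5 by (intro pcong_sym[OF qsum_0_pcong_P_bernoulli])
    then have "pcong 1 (P * B k) (qsum 0 (int k))" by (rule pcong_le) simp
    also have "pcong 1 (qsum 0 (int k)) (P * 0)" using qsum_0_power_p[OF assms, of 0] by simp
    finally have "pcong (Suc 0) (P * B k) (P * 0)" by simp
    then have "pcong 0 (B k) 0" by (rule pcong_unscale1)
    then show ?thesis by simp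
  qed (use R_divide_numeral(1)[of "-1"] in \<open>auto simp: bernoulli_values\<close>)
qed

text \<open>The correction \<open>(k choose 2) * P ^ 3 / 3 * B (k - 2)\<close> is harmless unless
  \<open>B (k - 2)\<close> has denominator \<open>p\<close>. The exception \<open>k = p + 1\<close>
  is the Kummer shift of the index 2: there \<open>B (p - 1)\<close> occurs, and the binomial
  coefficient \<open>p * (p + 1) / 2\<close> makes up for its denominator.\<close>

lemma qsum_0_pcong3:
  assumes "even k" "k \<ge> 4" "\<not> (p - 1) dvd k - 2 \<or> k = p + 1"
  shows "pcong 3 (qsum 0 (int k)) (P * B k)"
proof -
  have "pcong 4 (qsum 0 (int k)) (P * B k + of_nat (k choose 2) * P ^ 3 / 3 * B (k - 2))"
    using sum_powers_pcong[OF assms(1,2)] sum_lessThan_qsum[of k] assms by simp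
  then have "pcong 3 (qsum 0 (int k)) (P * B k + of_nat (k choose 2) * P ^ 3 / 3 * B (k - 2))"
    by (rule pcong_le) simp
  also have "pcong 3 (P * B k + of_nat (k choose 2) * P ^ 3 / 3 * B (k - 2)) (P * B k + 0)"
  proof (intro pcong_add pcong_refl)
    from assms(3) obtain z where "z \<in> R" "of_nat (k choose 2) * B (k - 2) = z"
    proof
      assume "\<not> (p - 1) dvd k - 2"
      then show thesis using that[OF _ refl] by (blast intro: R_mult R_of_nat R_bernoulli)
    next
      assume k: "k = p + 1"
      have "2 * (k choose 2) = p * (p + 1)" unfolding k by (simp add: choose_two)
      then have "of_nat (2 * (k choose 2)) = (of_nat (p * (p + 1)) :: rat)" by (simp only:)
      then have "of_nat (k choose 2) = P * (P + 1) / 2" by (simp add: field_simps)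
      then have "of_nat (k choose 2) * B (k - 2) = (P + 1) / 2 * (P * B (k - 2))" by (simp only:) (simp add: mult_ac)
      moreover have "\<dots> \<in> R" by (intro R_mult R_P_bernoulli R_divide_numeral R_add) auto
      ultimately show thesis using that by metis
    qed
    then have "of_nat (k choose 2) * P ^ 3 / 3 * B (k - 2) = P ^ 3 * (z / 3)" by (auto simp: field_simps)
    then show "pcong 3 (of_nat (k choose 2) * P ^ 3 / 3 * B (k - 2)) 0"
      using \<open>z \<in> R\<close> by (simp only:) (intro pcong_P_mult R_divide_numeral; simp)
  qed
  finally show ?thesis by simp
qed

text \<open>At exponent 2 the power sum carries the extra summand \<open>B 1 * P ^ 2\<close>, since \<open>B 1\<close> is the only
  nonzero Bernoulli number of odd index; \<open>D'\<close> absorbs it.\<close>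

definition D' :: "nat \<Rightarrow> rat" where
  "D' k = D k - (if k = 2 then P / 4 else 0)"

lemma qsum_0_2: "pcong 3 (qsum 0 2) (P * 2 * D' 2)"
proof -
  have "qsum 0 2 = (\<Sum>a<p. of_nat a ^ 2)" using sum_lessThan_qsum[of 2] by simp
  also have "\<dots> = P / 6 - P ^ 2 / 2 + P ^ 3 / 3"
    unfolding sum_powers_bernoulli by (simp add: eval_nat_numeral) (simp add: bernoulli_values[unfolded numeral_2_eq_2])
  also have "pcong 3 \<dots> (P / 6 - P ^ 2 / 2 + 0)"
    using pcong_P_mult[of "1/3" 3 3] by (intro pcong_add pcong_refl) auto
  also have "\<dots> = P * 2 * D' 2" by (simp add: D'_def divided_bernoulli_def bernoulli_values power2_eq_square field_simps)
  finally show ?thesis .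
qed

lemma not_dvd_between: "0 < k \<Longrightarrow> k < p - 1 \<Longrightarrow> \<not> (p - 1) dvd k"
  by (auto dest: dvd_imp_le)

lemma qsum_0_pcong_D':
  assumes "even k" "k \<in> {2..p-3}"
  shows "pcong 3 (qsum 0 (int k)) (P * of_nat k * D' k)"
proof (cases "k = 2")
  case True
  then show ?thesis using qsum_0_2 by simp
next
  case False
  with assms have "k \<ge> 4" by (auto elim!: evenE)
  have "pcong 3 (qsum 0 (int k)) (P * B k)"
    using assms \<open>k \<ge> 4\<close> by (intro qsum_0_pcong3 disjI1 not_dvd_between) auto
  with False \<open>k \<ge> 4\<close> show ?thesis by (simp add: D'_def B_eq_D mult.assoc)
qed

lemma R_D: 
  assumes "k \<in> {2..p-3}" shows "D k \<in> R"
  unfolding divided_bernoulli_def using assms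
  by (intro R_divide_less R_bernoulli not_dvd_between) auto

lemma R_D': 
  assumes "k \<in> {2..p-3}" shows "D' k \<in> R"
  unfolding D'_def using R_D[OF assms] by auto

lemma pcong_D_D': "pcong 1 (D k) (D' k)"
  using pcong_scale1[of 0 "1/4" 0 1] by (subst pcong_eq_diff) (auto simp: D'_def)

text \<open>The power sum of exponent \<open>k * p ^ 2\<close> vanishes modulo \<open>p ^ 3\<close>; the formula comes from expanding it
  around the exponent \<open>k\<close>.\<close>

lemma D'_pcong:
  assumes "even k" "k \<in> {2..p-3}"
  shows "pcong 2 (D' k) (- (1 + P) * qsum 1 k - (of_nat k - 1) / 2 * P * qsum 2 k)"
proof -
  \<comment> \<open>\<open>s\<close> counts periods:
    \<open>k * p ^ 2 = k + k * (p + 1) * (p - 1)\<close>.\<close>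
  define s where "s = k * (p + 1)"
  have k: "k > 0" "k < p - 1" "\<not> p dvd k" using assms p_ge by (auto dest: dvd_imp_le)
  have "int (k * p ^ 2) = int k + int s * int (p - 1)"
    using p_ge by (simp add: s_def power2_eq_square algebra_simps of_nat_diff)
  then have "pcong 3 (qsum 0 (int k) + of_nat s * P * qsum 1 k + of_nat s * (of_nat s - 1) / 2 * P ^ 2 * qsum 2 k) 0"
    using qsum_0_power_p[OF not_dvd_between[OF k(1,2)], of 2] qsum_pcong3[of 0 k s]
    by (metis One_nat_def Suc_1 numeral_3_eq_3 pcong_sym pcong_trans)
  moreover have "pcong 3 (qsum 0 (int k) + of_nat s * P * qsum 1 k + of_nat s * (of_nat s - 1) / 2 * P ^ 2 * qsum 2 k)
      (P * of_nat k * D' k + of_nat s * P * qsum 1 k + of_nat s * (of_nat s - 1) / 2 * P ^ 2 * qsum 2 k)"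
    by (intro pcong_add pcong_refl qsum_0_pcong_D' assms)
  ultimately have 0: "pcong 3 (P * of_nat k * D' k + of_nat s * P * qsum 1 k + of_nat s * (of_nat s - 1) / 2 * P ^ 2 * qsum 2 k) 0"
    using pcong_sym pcong_trans by blast
  define r where "r = - (1 + P) * qsum 1 k - (of_nat k - 1) / 2 * P * qsum 2 k"
  define z where "z = of_nat k * (of_nat k * (P + 2) - 1) / 2 * qsum 2 k"
  have "z \<in> R" unfolding z_def by auto
  have "P * of_nat k * D' k + of_nat s * P * qsum 1 k + of_nat s * (of_nat s - 1) / 2 * P ^ 2 * qsum 2 k
     = P * (of_nat k * (D' k - r)) + P ^ 3 * z"
    unfolding s_def r_def z_def by (simp add: field_simps power2_eq_square power3_eq_cube)
  with 0 have "pcong 3 (P * (of_nat k * (D' k - r)) + P ^ 3 * z) 0" by (simp only:)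
  then have "pcong 3 (P * (of_nat k * (D' k - r)) + P ^ 3 * z - P ^ 3 * z) (0 - 0)"
    using \<open>z \<in> R\<close> by (intro pcong_diff pcong_P_mult order_refl)
  then have "pcong (Suc 2) (P * (of_nat k * (D' k - r))) (P * (of_nat k * 0))" by simp
  then have "pcong 2 (D' k - r) 0"
    using k(3) pcong_cancel pcong_unscale1 by blast
  then show ?thesis unfolding r_def using pcong_eq_diff by blast
qed

lemma D_pcong1:
  assumes "even k" "k \<in> {2..p-3}"
  shows "pcong 1 (qsum 1 k) (- D k)"
proof -
  have "pcong 1 (D k) (D' k)" by (rule pcong_D_D')
  also have "pcong 1 (D' k) (- (1 + P) * qsum 1 k - (of_nat k - 1) / 2 * P * qsum 2 k)"
    by (rule pcong_le[OF D'_pcong[OF assms]]) simp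
  also have "\<dots> = - qsum 1 k + P ^ 1 * (- qsum 1 k - (of_nat k - 1) / 2 * qsum 2 k)"
    by (simp add: algebra_simps)
  also have "pcong 1 \<dots> (- qsum 1 k + 0)"
    by (intro pcong_add pcong_refl pcong_P_mult R_diff R_minus R_qsum R_mult R_divide_numeral) auto
  finally show ?thesis using pcong_minus[of 1 "D k" "- qsum 1 k"] by (simp add: pcong_sym)
qed

text \<open>Both Bernoulli numbers are read off from power sums one period apart. \<open>D'\<close>
  stands only at the smaller index, since \<open>B 1\<close> affects the power sum of exponent 2
  but, modulo \<open>p ^ 3\<close>, not the one of exponent \<open>p + 1\<close>.\<close>

lemma kummer_quotient:
  assumes "even k" "k \<in> {2..p-3}"
  shows "pcong 2 (D (k + (p - 1)) - D' k) (- (P / 2) * qsum 2 k)"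
proof -
  have k: "k > 0" "k < p - 1" using assms p_ge by auto
  have e: "even (k + (p - 1))" using assms even_p_minus_1 by simp
  have d: "\<not> (p - 1) dvd (k + (p - 1) - 2) \<or> k + (p - 1) = p + 1"
  proof (cases "k = 2")
    case False
    have "k + (p - 1) - 2 = (k - 2) + (p - 1)" using assms by auto
    moreover have "\<not> (p - 1) dvd (k - 2)" using False assms by (intro not_dvd_between) auto
    ultimately show ?thesis by (metis dvd_add_left_iff dvd_refl)
  qed (use p_ge in auto)
  have "pcong 3 (P * B (k + (p - 1))) (qsum 0 (int (k + (p - 1))))"
    using p_ge by (intro pcong_sym[OF qsum_0_pcong3] d e) auto
  also have "qsum 0 (int (k + (p - 1))) = qsum 0 k + P * qsum 1 k"
    using qsum_shift[of 0 k] by simp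
  also have "pcong 3 \<dots> (P * of_nat k * D' k + P * qsum 1 k)"
    by (intro pcong_add pcong_refl qsum_0_pcong_D' assms)
  finally have "pcong (Suc 2) (P * B (k + (p - 1))) (P * (of_nat k * D' k + qsum 1 k))"
    by (simp add: algebra_simps)
  then have "pcong 2 (B (k + (p - 1))) (of_nat k * D' k + qsum 1 k)" by (rule pcong_unscale1)
  then have "pcong 2 (B (k + (p - 1)) - of_nat (k + (p - 1)) * D' k) (of_nat k * D' k + qsum 1 k - of_nat (k + (p - 1)) * D' k)"
    by (rule pcong_diff) auto
  also have "B (k + (p - 1)) - of_nat (k + (p - 1)) * D' k = of_nat (k + (p - 1)) * (D (k + (p - 1)) - D' k)"
    using k by (simp add: B_eq_D algebra_simps)
  also have "of_nat k * D' k + qsum 1 k - of_nat (k + (p - 1)) * D' k = qsum 1 k + (1 - P) * D' k"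
    using p_ge by (simp add: of_nat_diff algebra_simps)
  also have "pcong 2 \<dots> (qsum 1 k + (1 - P) * (- (1 + P) * qsum 1 k - (of_nat k - 1) / 2 * P * qsum 2 k))"
    by (intro pcong_add pcong_refl pcong_cmult D'_pcong assms) auto
  also have "\<dots> = of_nat (k + (p - 1)) * (- (P / 2) * qsum 2 k) + P ^ 2 * (qsum 1 k + of_nat k / 2 * qsum 2 k)"
    using p_ge by (simp add: of_nat_diff field_simps power2_eq_square)
  also have "pcong 2 \<dots> (of_nat (k + (p - 1)) * (- (P / 2) * qsum 2 k) + 0)"
    by (intro pcong_add pcong_refl pcong_P_mult R_add R_mult R_qsum R_divide_numeral) auto
  finally have *: "pcong 2 (of_nat (k + (p - 1)) * (D (k + (p - 1)) - D' k)) (of_nat (k + (p - 1)) * (- (P / 2) * qsum 2 k))"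
    by simp
  \<comment> \<open>Modulo \<open>p\<close> the larger index is \<open>k - 1\<close>, which lies
    strictly between 0 and \<open>p\<close> and is therefore invertible.\<close>
  have "k + (p - 1) = (k - 1) + p" using k by simp
  moreover have "\<not> p dvd k - 1" using assms by (intro notI) (auto dest!: dvd_imp_le)
  ultimately have "\<not> p dvd k + (p - 1)" by (metis dvd_add_left_iff dvd_refl)
  with * show ?thesis by (rule pcong_cancel)
qed

section \<open>Reflection and orthogonality\<close>

lemma R_divide_of_nat' [simp, intro]: "\<not> p dvd a \<Longrightarrow> x \<in> R \<Longrightarrow> x / of_nat a \<in> R"
  by (rule R_divide_of_nat)

lemma pcong_cancel_int:
  assumes "pcong n (of_int c * x) (of_int c * y)" "\<not> int p dvd c"
  shows "pcong n x y"
proof -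
  have "c \<noteq> 0" using assms(2) by (metis dvd_0_right)
  with assms(2) have c: "1 / of_int c \<in> R" "of_int c \<noteq> (0::rat)"
    by (auto intro!: R_divide_of_int)
  with pcong_cmult[OF assms(1) c(1)] show ?thesis by simp
qed

lemma binomial_pcong3:
  assumes "x \<in> R"
  shows "pcong 3 ((1 + P * x) ^ n) (1 + of_nat n * P * x + of_nat n * (of_nat n - 1) / 2 * P ^ 2 * x ^ 2)"
proof (induction n)
  case 0
  then show ?case by simp
next
  case (Suc n)
  let ?r = "1 + of_nat n * P * x + of_nat n * (of_nat n - 1) / 2 * P ^ 2 * x ^ 2"
  have "pcong 3 ((1 + P * x) * (1 + P * x) ^ n) ((1 + P * x) * ?r)"
    using assms by (intro pcong_cmult Suc) auto
  also have "pcong 3 \<dots> (1 + of_nat (Suc n) * P * x + of_nat (Suc n) * (of_nat (Suc n) - 1) / 2 * P ^ 2 * x ^ 2)"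
    using assms by (intro pcongI[of _ _ _ "of_nat n * (of_nat n - 1) / 2 * x ^ 3"])
      (auto simp: field_simps power2_eq_square power3_eq_cube)
  finally show ?case by simp
qed

lemma powi_pcong1:
  assumes "\<not> p dvd a" shows "pcong 1 (of_nat a powi (k + int s * int (p - 1))) (of_nat a powi k)"
proof -
  have a: "a \<noteq> 0" using assms by (metis dvd_0_right)
  have "of_nat a powi (k + int s * int (p - 1)) = of_nat a powi k * (1 + P * q a) ^ s"
    using a by (simp add: power_int_add power_int_mult power_p_minus_1[unfolded One_nat_def, symmetric] mult.commute[of "int s"])
  also have "pcong 1 \<dots> (of_nat a powi k * (1 + 0) ^ s)"
    using assms pcong_P_mult[of "q a" 1 1] by (intro pcong_cmult pcong_power pcong_add) auto
  finally show ?thesis by simp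
qed

lemma reflect_pcong: "a \<le> p \<Longrightarrow> pcong 1 (of_nat (p - a)) (- of_nat a)"
  by (rule pcongI[of _ _ _ 1]) (auto simp: of_nat_diff)

lemma reflect_range: "a \<in> {1..p-1} \<Longrightarrow> p - a \<in> {1..p-1}"
  by auto

lemma sum_reflect: "(\<Sum>a=1..p-1. f a) = (\<Sum>a=1..p-1. f (p - a))"
  using sum.atLeastAtMost_rev[of f 1 "p - 1"] p_ge by simp

lemma reflect_powi_pcong:
  assumes "a \<in> {1..p-1}" "odd k"
  shows "pcong 1 (of_nat (p - a) powi k) (- (of_nat a powi k))"
proof -
  have a: "\<not> p dvd a" "\<not> p dvd p - a" using not_p_dvd assms(1) reflect_range by auto
  have *: "pcong 1 (of_nat (p - a) ^ n) (- (of_nat a ^ n))" if "odd n" for n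
    using pcong_power[OF reflect_pcong[of a], of n] that assms(1) by auto
  show ?thesis
  proof (cases "k \<ge> 0")
    case True
    then show ?thesis using *[of "nat k"] assms(2) by (simp add: power_int_def even_nat_iff)
  next
    case False
    define n where "n = nat (- k)"
    have n: "odd n" "of_nat b powi k = 1 / (of_nat b ^ n :: rat)" for b
      using False assms(2) by (auto simp: n_def power_int_def even_nat_iff power_inverse divide_simps)
    \<comment> \<open>Dividing the congruence for \<open>n\<close> by
      \<open>a ^ n * (p - a) ^ n\<close> exchanges \<open>a\<close> and \<open>p - a\<close> and
      gives the one for the exponent \<open>-n\<close>.\<close>
    have "pcong 1 (1 / (of_nat a ^ n * of_nat (p - a) ^ n) * (of_nat (p - a) ^ n)) (1 / (of_nat a ^ n * of_nat (p - a) ^ n) * - (of_nat a ^ n))"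
      using a R_divide_of_nat[of 1 "a ^ n * (p - a) ^ n"] prime
      by (intro pcong_cmult * n) (auto simp: prime_dvd_mult_iff prime_dvd_power_iff dest: prime_dvd_power)
    moreover have "1 / (x * y) * y = 1 / x" "1 / (x * y) * - x = - (1 / y)" if "x \<noteq> 0" "y \<noteq> 0" for x y :: rat
      using that by (simp_all add: field_simps)
    moreover have "of_nat a ^ n \<noteq> (0::rat)" "of_nat (p - a) ^ n \<noteq> (0::rat)" using assms by auto
    ultimately have "pcong 1 (1 / of_nat a ^ n) (- (1 / of_nat (p - a) ^ n))" by metis
    then show ?thesis unfolding n(2) using pcong_minus pcong_sym by fastforce
  qed
qed

text \<open>As \<open>p - 1\<close> is even,
  \<open>(p - a) ^ (p - 1) = a ^ (p - 1) * (1 - p / a) ^ (p - 1)\<close>. The last power is expanded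
  modulo \<open>p ^ 3\<close>, and one factor \<open>p\<close> is divided out.\<close>

lemma fermat_quotient_reflect:
  assumes "a \<in> {1..p-1}"
  shows "pcong 2 (q (p - a)) (q a + (1 + P * q a) * (1 / of_nat a - P / of_nat a + P / of_nat a ^ 2))"
proof -
  define u :: rat where "u = 1 / of_nat a"
  have a: "\<not> p dvd a" "of_nat a \<noteq> (0::rat)" using not_p_dvd assms by auto
  then have R: "u \<in> R" "q a \<in> R" unfolding u_def by auto
  have "of_nat (p - a) = - (of_nat a * (1 + P * (- u)))"
    using assms a by (auto simp: u_def of_nat_diff field_simps)
  then have "of_nat (p - a) ^ (p - 1) = of_nat a ^ (p - 1) * (1 + P * (- u)) ^ (p - 1)"
    using even_p_minus_1 by (simp only: power_minus_even power_mult_distrib)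
  also have "\<dots> = (1 + P * q a) * (1 + P * (- u)) ^ (p - 1)" by (simp only: power_p_minus_1)
  also have "pcong 3 \<dots> ((1 + P * q a) * (1 + of_nat (p - 1) * P * (- u) + of_nat (p - 1) * (of_nat (p - 1) - 1) / 2 * P ^ 2 * (- u) ^ 2))"
    using R by (intro pcong_cmult binomial_pcong3) auto
  also have "\<dots> = (1 + P * q a) * (1 + (P - 1) * P * (- u) + (P - 1) * (P - 2) / 2 * P ^ 2 * (- u) ^ 2)"
    using p_ge by (simp add: of_nat_diff)
  also have "pcong 3 \<dots> (1 + P * (q a + (1 + P * q a) * (u - P * u + P * u ^ 2)))"
    using R by (intro pcongI[of _ _ _ "(1 + P * q a) * (P - 3) / 2 * u ^ 2"])
      (auto simp: field_simps power2_eq_square power3_eq_cube)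
  finally have "pcong 3 (of_nat (p - a) ^ (p - 1) - 1) (1 + P * (q a + (1 + P * q a) * (u - P * u + P * u ^ 2)) - 1)"
    by (intro pcong_diff) auto
  then have "pcong (Suc 2) (P * q (p - a)) (P * (q a + (1 + P * q a) * (u - P * u + P * u ^ 2)))"
    by (simp add: power_p_minus_1[unfolded One_nat_def])
  then have "pcong 2 (q (p - a)) (q a + (1 + P * q a) * (u - P * u + P * u ^ 2))"
    by (rule pcong_unscale1)
  then show ?thesis by (simp add: u_def power_one_over)
qed

lemma fermat_quotient_reflect1:
  assumes "a \<in> {1..p-1}"
  shows "pcong 1 (q (p - a)) (q a + 1 / of_nat a)"
proof -
  define u :: rat where "u = 1 / of_nat a"
  have R: "u \<in> R" "q a \<in> R" unfolding u_def using not_p_dvd[OF assms] by auto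
  have "pcong 1 (q (p - a)) (q a + (1 + P * q a) * (1 / of_nat a - P / of_nat a + P / of_nat a ^ 2))"
    by (rule pcong_le[OF fermat_quotient_reflect[OF assms]]) simp
  also have "\<dots> = q a + (1 + P * q a) * (u - P * u + P * u ^ 2)" by (simp add: u_def power_one_over)
  also have "pcong 1 \<dots> (q a + u)"
    using R by (intro pcongI[of _ _ _ "q a * (u - P * u + P * u ^ 2) + u ^ 2 - u"])
      (auto simp: field_simps power2_eq_square)
  finally show ?thesis by (simp add: u_def)
qed

text \<open>Up to the factor \<open>p\<close>, this is the \<open>p\<close>-adic logarithm of \<open>a ^ (p - 1)\<close> modulo \<open>p ^ 3\<close>.\<close>

definition lq :: "nat \<Rightarrow> rat" where "lq a = q a - P * q a ^ 2 / 2"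

lemma R_lq [simp, intro]: "\<not> p dvd a \<Longrightarrow> lq a \<in> R"
  unfolding lq_def by auto

text \<open>The logarithm turns the product for \<open>(p - a) ^ (p - 1)\<close> into a sum: the
  correction is \<open>(p - 1) / p\<close> times the logarithm of \<open>1 - p / a\<close> and,
  unlike that of \<open>fermat_quotient_reflect\<close>, does not involve
  \<open>q a\<close>.\<close>

lemma lq_reflect:
  assumes "a \<in> {1..p-1}"
  shows "pcong 2 (lq (p - a)) (lq a + (1 - P) / of_nat a + P / of_nat a ^ 2 / 2)"
proof -
  define u :: rat where "u = 1 / of_nat a"
  define x where "x = q a"
  have R: "u \<in> R" "x \<in> R" unfolding u_def x_def using not_p_dvd[OF assms] by auto
  define y where "y = x + (1 + P * x) * (u - P * u + P * u ^ 2)"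
  have "y \<in> R" unfolding y_def using R by auto
  then have y: "pcong 2 (q (p - a)) y" "y \<in> R" "q (p - a) \<in> R"
    using fermat_quotient_reflect[OF assms] not_p_dvd[OF reflect_range[OF assms]]
    by (auto simp: y_def x_def u_def power_one_over)
  have "pcong 2 (lq (p - a)) (y - P / 2 * y ^ 2)"
    using pcong_diff[OF y(1) pcong_cmult[OF pcong_power[OF y(1,3)], of "P / 2" 2]] by (simp add: lq_def)
  also have "pcong 2 \<dots> (lq a + (1 - P) * u + P * u ^ 2 / 2)"
  proof (rule pcongI)
    define z where "z = x * (u ^ 2 - u) - (x + u) * (x * u + (1 + P * x) * (u ^ 2 - u))
      - P * (x * u + (1 + P * x) * (u ^ 2 - u)) ^ 2 / 2"
    show "y - P / 2 * y ^ 2 - (lq a + (1 - P) * u + P * u ^ 2 / 2) = P ^ 2 * z"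
      unfolding y_def lq_def x_def[symmetric] z_def
      by (simp add: field_simps power2_eq_square)
    show "z \<in> R" unfolding z_def using R by auto
  qed
  finally show ?thesis by (simp add: u_def power_one_over)
qed

section \<open>Power sums with integer exponents and parity of moments\<close>

lemma qsum_0_int_pcong:
  assumes "\<not> int (p - 1) dvd k"
  shows "pcong 1 (qsum 0 k) 0"
proof -
  define r where "r = k mod int (p - 1)"
  have pos: "int (p - 1) > 0" using p_ge by simp
  have "\<not> (p - 1) dvd nat r" using assms pos unfolding r_def
    by (metis dvd_mod_iff dvd_refl int_dvd_int_iff nat_0_le pos_mod_sign)
  from qsum_0_power_p[OF this, of 0] have r: "pcong 1 (qsum 0 r) 0"
    using pos by (simp add: r_def)
  define t where "t = k div int (p - 1)"
  have k: "k = r + t * int (p - 1)" unfolding r_def t_def by simp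
  show ?thesis
  proof (cases "t \<ge> 0")
    case True
    then show ?thesis using qsum_pcong1[of 0 r "nat t"] r pcong_trans k by auto
  next
    case False
    then have "r = k + int (nat (-t)) * int (p - 1)" using k by simp
    then show ?thesis using qsum_pcong1[of 0 k "nat (-t)"] r pcong_trans pcong_sym by metis
  qed
qed

lemma qsum_0_int_pcong_dvd:
  assumes "int (p - 1) dvd k"
  shows "pcong 1 (qsum 0 k) (- 1)"
proof -
  obtain t where k: "k = int (p - 1) * t" using assms by (elim dvdE)
  have *: "pcong 1 (qsum 0 0) (-1)" unfolding qsum_def
    using p_ge by (intro pcongI[of _ _ _ 1]) (auto simp: of_nat_diff)
  show ?thesis
  proof (cases "t \<ge> 0")
    case True
    then show ?thesis using qsum_pcong1[of 0 0 "nat t"] * pcong_trans k by (auto simp: mult.commute)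
  next
    case False
    then have "0 = k + int (nat (-t)) * int (p - 1)" using k by simp
    then show ?thesis using qsum_pcong1[of 0 k "nat (-t)"] * pcong_trans pcong_sym by metis
  qed
qed

text \<open>Under the reflection of \<open>a\<close> to \<open>p - a\<close> an odd power changes
  its sign while \<open>q\<close> gains \<open>1 / a\<close>; hence the moment is minus itself minus
  a power sum.\<close>

lemma qsum_1_odd:
  assumes "odd k"
  shows "pcong 1 (2 * qsum 1 k) (- qsum 0 (k - 1))"
proof -
  have "qsum 1 k = (\<Sum>a=1..p-1. of_nat (p - a) powi k * q (p - a))"
    unfolding qsum_def by (subst sum_reflect) simp
  also have "pcong 1 \<dots> (\<Sum>a=1..p-1. - (of_nat a powi k) * (q a + 1 / of_nat a))"
        by (intro pcong_sum pcong_mult reflect_powi_pcong fermat_quotient_reflect1 R_powi R_q R_add R_divide_of_nat R_1 not_p_dvd reflect_range)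
       (use assms in simp_all)
  also have "\<dots> = - qsum 1 k - qsum 0 (k - 1)"
    unfolding qsum_def sum_negf[symmetric] sum_subtractf[symmetric]
    by (intro sum.cong refl) (auto simp: algebra_simps power_int_diff)
  finally have "pcong 1 (qsum 1 k + qsum 1 k) (- qsum 1 k - qsum 0 (k - 1) + qsum 1 k)"
    by (intro pcong_add) auto
  then show ?thesis by simp
qed

lemma pcong_half: "pcong n (2 * x) (2 * y) \<Longrightarrow> pcong n x y"
  using pcong_cmult[of n "2 * x" "2 * y" "1/2"] by simp

lemma qsum_1_minus_even:
  assumes "even k" "k \<in> {2..p-3}"
  shows "pcong 1 (qsum 1 (- int k)) (- D (p - 1 - k))"
proof -
  have "- int k + int 1 * int (p - 1) = int (p - 1 - k)" using assms by auto
  then have "pcong 1 (qsum 1 (- int k)) (qsum 1 (int (p - 1 - k)))"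
    using qsum_pcong1[of 1 "- int k" 1] pcong_sym by metis
  also have "pcong 1 \<dots> (- D (p - 1 - k))"
    using assms even_p_minus_1 by (intro D_pcong1) auto
  finally show ?thesis .
qed

text \<open>The reflection is applied to the square of \<open>q\<close>: its cross term brings in
  the first moment at exponent -2, which is \<open>- D (p - 3)\<close>, and the power sum at -3
  vanishes.\<close>

lemma qsum_2_minus_1: "pcong 1 (qsum 2 (- 1)) (D (p - 3))"
proof -
  have "qsum 2 (-1) = (\<Sum>a=1..p-1. of_nat (p - a) powi (-1) * q (p - a) ^ 2)"
    unfolding qsum_def by (rule sum_reflect)
  also have "pcong 1 \<dots> (\<Sum>a=1..p-1. - (of_nat a powi (-1)) * (q a + 1 / of_nat a) ^ 2)"
    by (intro pcong_sum pcong_mult pcong_power reflect_powi_pcong fermat_quotient_reflect1 R_powi R_q R_power R_add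
          R_divide_of_nat R_1 not_p_dvd reflect_range) simp_all
  also have "\<dots> = - qsum 2 (-1) - 2 * qsum 1 (-2) - qsum 0 (-3)"
    unfolding qsum_def sum_distrib_left sum_negf[symmetric] sum_subtractf[symmetric]
  proof (intro sum.cong refl)
    fix a assume "a \<in> {1..p-1}"
    then show "- (of_nat a powi - 1) * (q a + 1 / rat_of_nat a)\<^sup>2 =
         - (of_nat a powi - 1 * q a ^ 2) - 2 * (of_nat a powi - 2 * q a ^ 1) - of_nat a powi - 3 * q a ^ 0"
      by (simp add: power_int_minus field_simps power2_eq_square power3_eq_cube)
  qed
  also have "pcong 1 \<dots> (- qsum 2 (-1) - 2 * (- D (p - 3)) - 0)"
  proof (intro pcong_diff pcong_refl pcong_cmult qsum_0_int_pcong)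
    show "pcong 1 (qsum 1 (- 2)) (- D (p - 3))" using qsum_1_minus_even[of 2] p_ge
      by (simp add: numeral_2_eq_2 numeral_3_eq_3)
    show "\<not> int (p - 1) dvd - 3" using p_ge by (auto dest!: zdvd_imp_le)
  qed auto
  finally have "pcong 1 (qsum 2 (-1) + qsum 2 (-1)) (- qsum 2 (-1) - 2 * (- D (p - 3)) - 0 + qsum 2 (-1))"
    by (intro pcong_add) auto
  then have "pcong 1 (2 * qsum 2 (-1)) (2 * D (p - 3))" by simp
  then show ?thesis by (rule pcong_half)
qed

text \<open>These are the indices of the nontrivial even characters modulo \<open>p\<close>, closed
  under \<open>r\<close> to \<open>p - 1 - r\<close>. The trivial character would bring in
  \<open>B (p - 1)\<close>, which is not p-integral.\<close>

definition E :: "nat set" where "E = {r \<in> {2..p-3}. even r}"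

lemma sum_E: "(\<Sum>r\<in>E. f r) = (\<Sum>m=1..(p - 3) div 2. f (2 * m))"
  by (rule sum.reindex_bij_witness[of _ "\<lambda>m. 2 * m" "\<lambda>r. r div 2"]) (auto simp: E_def)

lemma sum_E_reflect: "(\<Sum>r\<in>E. f r) = (\<Sum>r\<in>E. f (p - 1 - r))"
  using even_p_minus_1
  by (intro sum.reindex_bij_witness[of _ "\<lambda>r. p - 1 - r" "\<lambda>r. p - 1 - r"]) (auto simp: E_def)

lemma E_D: "r \<in> E \<Longrightarrow> r \<in> {2..p-3}" "r \<in> E \<Longrightarrow> even r"
  by (auto simp: E_def)

lemma power_p_pcong:
  assumes "\<not> p dvd a"
  shows "pcong 2 ((of_nat a ^ p) ^ (p - 1)) 1"
proof -
  have "[a ^ (p - 1) = 1] (mod p)" using prime assms by (rule fermat_theorem)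
  then have "int p dvd int a ^ (p - 1) - 1"
    by (metis cong_iff_dvd_diff cong_int_iff of_nat_1 of_nat_power)
  from lift_power_dvd[OF this, of 1]
  have "int p ^ 2 dvd int ((a ^ p) ^ (p - 1)) - 1" by (simp add: power_mult[symmetric] mult.commute numeral_2_eq_2)
  then have "pcong 2 (of_int (int ((a ^ p) ^ (p - 1)))) (of_int 1)" by (simp only: pcong_of_int)
  then show ?thesis by simp
qed

text \<open>Orthogonality of the even characters: modulo \<open>p ^ 2\<close>, \<open>a ^ p\<close> is the Teichmueller representative of \<open>a\<close>.\<close>

lemma even_kernel:
  assumes "a \<in> {1..p-1}" "b \<in> {1..p-1}"
  shows "pcong 2 (\<Sum>r\<in>E. of_nat b ^ (p * r) / of_nat a ^ (p * r))
    ((if b = a \<or> b = p - a then (P - 1) / 2 else 0) - 1)"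
proof -
  define N where "N = (p - 1) div 2"
  have N: "2 * N = p - 1" "(p - 3) div 2 = N - 1" "N \<ge> 1" 
    using even_p_minus_1 p_ge unfolding N_def by auto
  then have PN: "of_nat N = (P - 1) / 2" by (metis of_nat_diff of_nat_mult of_nat_numeral of_nat_1 
    nonzero_mult_div_cancel_left zero_neq_numeral prime prime_ge_1_nat)
  define y :: rat where "y = of_nat b ^ p / of_nat a ^ p"
  have nd: "\<not> p dvd a" "\<not> p dvd b" using assms not_p_dvd by auto
  have nda: "\<not> p dvd a ^ p" using nd prime by (metis prime_dvd_power)
  have a0: "of_nat a \<noteq> (0::rat)" using assms by auto
  have yR: "y \<in> R" unfolding y_def using nda R_divide_of_nat[of "of_nat b ^ p" "a ^ p"] by auto
  have "(\<Sum>r\<in>E. of_nat b ^ (p * r) / of_nat a ^ (p * r)) = (\<Sum>m=1..N-1. (y ^ 2) ^ m)"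
    unfolding sum_E N y_def by (simp add: power_divide power_mult)
  \<comment> \<open>The summand \<open>m = 0\<close>, the trivial character, is absent from
    \<open>E\<close>; it accounts for the \<open>- 1\<close> in the claim.\<close>
  also have "\<dots> = (\<Sum>m<N. (y ^ 2) ^ m) - 1"
  proof -
    have "{..<N} = insert 0 {1..N-1}" using N by auto
    then show ?thesis by simp
  qed
  finally have eq: "(\<Sum>r\<in>E. of_nat b ^ (p * r) / of_nat a ^ (p * r)) = (\<Sum>m<N. (y ^ 2) ^ m) - 1" .
  have "pcong 2 (\<Sum>m<N. (y ^ 2) ^ m) (if b = a \<or> b = p - a then (P - 1) / 2 else 0)"
  proof (cases "b = a \<or> b = p - a")
    case True
    have "pcong 2 (y ^ 2) 1"
    proof (cases "b = a")
      case False
      then have b: "b = p - a" using True by simp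
      have "int p dvd int b - (- int a)" using assms unfolding b by auto
      from lift_power_dvd[OF this, of 1]
      have "int p ^ 2 dvd int b ^ p - (- (int a ^ p))" using odd_p by (simp add: numeral_2_eq_2)
      then have "pcong 2 (of_int (int b ^ p)) (of_int (- (int a ^ p)))" by (simp only: pcong_of_int)
      then have "pcong 2 (1 / of_nat (a ^ p) * of_nat b ^ p) (1 / of_nat (a ^ p) * (- (of_nat a ^ p)))"
        using nda by (intro pcong_cmult R_divide_of_nat) auto
      then have "pcong 2 y (-1)" unfolding y_def using a0 by simp
      from pcong_power[OF this yR, of 2] show ?thesis by simp
    qed (use a0 in \<open>simp add: y_def\<close>)
    then have "pcong 2 (\<Sum>m<N. (y ^ 2) ^ m) (\<Sum>m<N. 1 ^ m)"
      using yR by (intro pcong_sum pcong_power) auto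
    then show ?thesis using True PN by simp
  next
    case False
    \<comment> \<open>The geometric series vanishes because \<open>y ^ (p - 1)\<close> is 1 modulo
      \<open>p ^ 2\<close> while \<open>y ^ 2 - 1\<close> is a unit. The factor
      \<open>(a ^ p) ^ (p - 1)\<close> clears the denominators, so that the unit to be cancelled
      becomes an integer.\<close>
    have "(y ^ 2 - 1) * (\<Sum>m<N. (y ^ 2) ^ m) = (y ^ 2) ^ N - 1"
      by (simp add: power_diff_1_eq)
    also have "(y ^ 2) ^ N = y ^ (p - 1)" by (simp only: N flip: power_mult)
    finally have "(of_nat a ^ p) ^ (p - 1) * ((y ^ 2 - 1) * (\<Sum>m<N. (y ^ 2) ^ m)) = (of_nat b ^ p) ^ (p - 1) - (of_nat a ^ p) ^ (p - 1)"
      using a0 unfolding y_def by (simp add: field_simps power_divide)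
    also have "pcong 2 \<dots> (1 - 1)" by (intro pcong_diff power_p_pcong nd)
    finally have "pcong 2 ((of_nat a ^ p) ^ (p - 1) * ((y ^ 2 - 1) * (\<Sum>m<N. (y ^ 2) ^ m))) 0" by simp
    moreover have "(of_nat a ^ p) ^ (p - 1) * (y ^ 2 - 1) = of_int (int a ^ (p * (p - 3)) * (int b ^ (2 * p) - int a ^ (2 * p)))"
    proof -
      have "(of_nat a ^ p) ^ (p - 1) = (of_nat a ^ (p * (p - 3)) * (of_nat a ^ p) ^ (2::nat) :: rat)"
      proof -
        have "p - 1 = (p - 3) + 2" using p_ge by simp
        then show ?thesis by (metis power_add power_mult)
      qed
      then show ?thesis using a0 unfolding y_def by (simp add: field_simps power_divide flip: power_mult)
    qed
    ultimately have "pcong 2 (of_int (int a ^ (p * (p - 3)) * (int b ^ (2 * p) - int a ^ (2 * p))) * (\<Sum>m<N. (y ^ 2) ^ m))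
       (of_int (int a ^ (p * (p - 3)) * (int b ^ (2 * p) - int a ^ (2 * p))) * 0)"
      by (simp only: mult.assoc[symmetric] mult_zero_right)
    moreover have "\<not> int p dvd int a ^ (p * (p - 3)) * (int b ^ (2 * p) - int a ^ (2 * p))"
    proof
      assume "int p dvd int a ^ (p * (p - 3)) * (int b ^ (2 * p) - int a ^ (2 * p))"
      moreover have "\<not> int p dvd int a ^ (p * (p - 3))"
        using nd prime by (metis int_dvd_int_iff of_nat_power prime_dvd_power)
      ultimately have d: "int p dvd int b ^ (2 * p) - int a ^ (2 * p)"
        using prime by (metis prime_dvd_mult_iff prime_nat_int_transfer)
      have little: "[int x ^ p = int x] (mod int p)" if "\<not> p dvd x" for x
      proof -
        have "[x * x ^ (p - 1) = x * 1] (mod p)" using fermat_theorem[OF prime that] by (intro cong_mult cong_refl)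
        moreover have "x * x ^ (p - 1) = x ^ p" using p_ge by (metis power_eq_if not_numeral_le_zero)
        ultimately show ?thesis by (metis cong_int_iff mult.right_neutral of_nat_power)
      qed
      have "[int b ^ (2 * p) - int a ^ (2 * p) = int b ^ 2 - int a ^ 2] (mod int p)"
        unfolding power_mult mult.commute[of 2] by (intro cong_diff cong_pow little nd)
      with d have "int p dvd int b ^ 2 - int a ^ 2" by (simp add: cong_dvd_iff)
      then have "int p dvd (int b - int a) * (int b + int a)" by (simp add: algebra_simps power2_eq_square)
      then have "int p dvd int b - int a \<or> int p dvd int b + int a"
        using prime by (metis prime_dvd_mult_iff prime_nat_int_transfer)
      then show False
      proof
        assume "int p dvd int b - int a"
        moreover have "\<bar>int b - int a\<bar> < int p" using assms by auto
        ultimately have "int b - int a = 0" by (metis dvd_imp_le_int linorder_not_less abs_of_nat)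
        then show False using False by simp
      next
        assume "int p dvd int b + int a"
        then have "p dvd b + a" by (metis int_dvd_int_iff of_nat_add)
        then obtain c where c: "b + a = p * c" by (elim dvdE)
        moreover have "b + a < p * 2" "0 < b + a" using assms by auto
        ultimately have "p * c < p * 2" "0 < p * c" by simp_all
        then have "c < 2" "0 < c" by (simp_all only: mult_less_cancel1 zero_less_mult_iff) auto
        then have "c = 1" by simp
        then show False using c False by auto
      qed
    qed
    ultimately have "pcong 2 (\<Sum>m<N. (y ^ 2) ^ m) 0" by (rule pcong_cancel_int)
    with False show ?thesis by simp
  qed
  then show ?thesis unfolding eq by (intro pcong_diff) auto
qed

text \<open>Fourier inversion over \<open>E\<close>: even characters see only
  \<open>x a + x (p - a)\<close>, and the missing trivial character subtracts the total sum of
  \<open>x\<close>.\<close>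

lemma even_kernel_sum:
  assumes "a \<in> {1..p-1}" "\<And>b. b \<in> {1..p-1} \<Longrightarrow> x b \<in> R"
  shows "pcong 2 (\<Sum>r\<in>E. (\<Sum>b=1..p-1. of_nat b ^ (p * r) * x b) / of_nat a ^ (p * r))
    ((P - 1) / 2 * (x a + x (p - a)) - (\<Sum>b=1..p-1. x b))"
proof -
  have "(\<Sum>r\<in>E. (\<Sum>b=1..p-1. of_nat b ^ (p * r) * x b) / of_nat a ^ (p * r))
      = (\<Sum>b=1..p-1. x b * (\<Sum>r\<in>E. of_nat b ^ (p * r) / of_nat a ^ (p * r)))"
    unfolding sum_divide_distrib sum_distrib_left by (subst sum.swap) (simp add: mult.commute)
  also have "pcong 2 \<dots> (\<Sum>b=1..p-1. x b * ((if b = a \<or> b = p - a then (P - 1) / 2 else 0) - 1))"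
    using assms by (intro pcong_sum pcong_cmult even_kernel)
  also have "\<dots> = (\<Sum>b=1..p-1. (if b = a \<or> b = p - a then (P - 1) / 2 * x b else 0)) - (\<Sum>b=1..p-1. x b)"
    unfolding sum_subtractf[symmetric] by (intro sum.cong refl) (simp add: algebra_simps)
  also have "(\<Sum>b=1..p-1. (if b = a \<or> b = p - a then (P - 1) / 2 * x b else 0)) = (\<Sum>b\<in>{a, p - a}. (P - 1) / 2 * x b)"
    using assms(1) by (intro sum.mono_neutral_cong_right) auto
  also have "\<dots> = (P - 1) / 2 * (x a + x (p - a))"
  proof -
    have "a \<noteq> p - a" using odd_p assms(1) by (metis atLeastAtMost_iff diff_le_self dvd_triv_left le_add_diff_inverse mult_2 le_trans)
    then show ?thesis by (simp add: distrib_left)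
  qed
  finally show ?thesis .
qed

section \<open>Wilson quotient and Fourier series\<close>

abbreviation w :: rat where "w \<equiv> wilson_quotient p"

lemma fact_eq_w: "fact (p - 1) = P * w - 1"
  using p_ge by (simp add: wilson_quotient_def)

lemma R_w [simp, intro]: "w \<in> R"
proof -
  have "int p dvd fact (p - 1) + 1" using wilson_theorem[OF prime] by (simp add: cong_iff_dvd_diff)
  then have "pcong 1 (of_int (fact (p - 1))) (of_int (-1))" by (subst pcong_of_int) simp
  then have "pcong (Suc 0) (P * w) (P * 0)"
    using p_ge by (subst (asm) pcong_eq_diff) (simp add: wilson_quotient_def)
  then have "pcong 0 w 0" by (rule pcong_unscale1)
  then show ?thesis by simp
qed

lemma binomial_pcong4:
  assumes "x \<in> R"
  shows "pcong 4 ((1 + P * x) ^ n) (1 + of_nat n * P * x + of_nat n * (of_nat n - 1) / 2 * P ^ 2 * x ^ 2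
     + of_nat n * (of_nat n - 1) * (of_nat n - 2) / 6 * P ^ 3 * x ^ 3)"
proof (induction n)
  case 0
  then show ?case by simp
next
  case (Suc n)
  let ?r = "\<lambda>n. 1 + of_nat n * P * x + of_nat n * (of_nat n - 1) / 2 * P ^ 2 * x ^ 2
     + of_nat n * (of_nat n - 1) * (of_nat n - 2) / 6 * P ^ 3 * x ^ 3"
  have "pcong 4 ((1 + P * x) * (1 + P * x) ^ n) ((1 + P * x) * ?r n)"
    using assms by (intro pcong_cmult Suc) auto
  also have "pcong 4 \<dots> (?r (Suc n))"
    using assms by (intro pcongI[of _ _ _ "of_nat n * (of_nat n - 1) * (of_nat n - 2) / 6 * x ^ 4"])
      (auto simp: field_simps power2_eq_square power3_eq_cube power4_eq_xxxx)
  finally show ?case by simp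
qed

text \<open>Newton's identities for the elementary symmetric functions of degree 1 to 3; those of
  higher degree carry \<open>P ^ 4\<close>.\<close>

lemma prod_1_plus_pcong4:
  assumes "finite A" "\<And>a. a \<in> A \<Longrightarrow> x a \<in> R"
  defines "s \<equiv> \<lambda>k. \<Sum>a\<in>A. x a ^ k"
  shows "pcong 4 (\<Prod>a\<in>A. 1 + P * x a)
     (1 + P * s 1 + P ^ 2 * ((s 1) ^ 2 - s 2) / 2 + P ^ 3 * ((s 1) ^ 3 - 3 * s 1 * s 2 + 2 * s 3) / 6)"
  using assms(1,2) unfolding s_def
proof (induction A rule: finite_induct)
  case empty
  then show ?case by simp
next
  case (insert b A)
  define s1 s2 s3 where s: "s1 = (\<Sum>a\<in>A. x a ^ 1)" "s2 = (\<Sum>a\<in>A. x a ^ 2)" "s3 = (\<Sum>a\<in>A. x a ^ 3)"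
  have R: "s1 \<in> R" "s2 \<in> R" "s3 \<in> R" "x b \<in> R" using insert.prems unfolding s by (auto intro!: R_sum)
  let ?r = "\<lambda>s1 s2 s3. 1 + P * s1 + P ^ 2 * (s1 ^ 2 - s2) / 2 + P ^ 3 * (s1 ^ 3 - 3 * s1 * s2 + 2 * s3) / 6"
  have "pcong 4 (\<Prod>a\<in>A. 1 + P * x a) (?r s1 s2 s3)"
    using insert unfolding s by simp
  then have "pcong 4 ((1 + P * x b) * (\<Prod>a\<in>A. 1 + P * x a)) ((1 + P * x b) * ?r s1 s2 s3)"
    using R by (intro pcong_cmult) auto
  also have "pcong 4 \<dots> (?r (x b ^ 1 + s1) (x b ^ 2 + s2) (x b ^ 3 + s3))"
  proof (rule pcongI)
    show "(1 + P * x b) * ?r s1 s2 s3 - ?r (x b ^ 1 + s1) (x b ^ 2 + s2) (x b ^ 3 + s3)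
      = P ^ 4 * (x b * (s1 ^ 3 - 3 * s1 * s2 + 2 * s3) / 6)"
      by (simp add: field_simps power2_eq_square power3_eq_cube power4_eq_xxxx)
  qed (use R in auto)
  finally show ?case using insert.hyps by (simp add: s)
qed

abbreviation Q :: "nat \<Rightarrow> rat" where "Q j \<equiv> qsum j 0"

lemma wilson_relation:
  "pcong 3 (w + P * (w ^ 2 - w) + P ^ 2 * (w ^ 3 - 3 / 2 * w ^ 2))
    (Q 1 + P * ((Q 1) ^ 2 - Q 2) / 2 + P ^ 2 * ((Q 1) ^ 3 - 3 * Q 1 * Q 2 + 2 * Q 3) / 6)"
proof -
  have "(\<Prod>a=1..p-1. 1 + P * q a) = (\<Prod>a=1..p-1. of_nat a ^ (p - 1))"
    by (simp only: power_p_minus_1)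
  also have "\<dots> = fact (p - 1) ^ (p - 1)" by (simp add: fact_prod prod_power_distrib)
  also have "\<dots> = (- (P * w - 1)) ^ (p - 1)" 
    unfolding fact_eq_w using even_p_minus_1 by (rule power_minus_even[symmetric])
  also have "- (P * w - 1) = 1 + P * (- w)" by simp
  also have "pcong 4 ((1 + P * (- w)) ^ (p - 1)) (1 + of_nat (p - 1) * P * (- w) + of_nat (p - 1) * (of_nat (p - 1) - 1) / 2 * P ^ 2 * (- w) ^ 2
     + of_nat (p - 1) * (of_nat (p - 1) - 1) * (of_nat (p - 1) - 2) / 6 * P ^ 3 * (- w) ^ 3)"
    by (intro binomial_pcong4) auto
  also have "of_nat (p - 1) = P - 1" using p_ge by (simp add: of_nat_diff)
  also have "pcong 4 (1 + (P - 1) * P * (- w) + (P - 1) * (P - 1 - 1) / 2 * P ^ 2 * (- w) ^ 2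
     + (P - 1) * (P - 1 - 1) * (P - 1 - 2) / 6 * P ^ 3 * (- w) ^ 3)
     (1 + P * (w + P * (w ^ 2 - w) + P ^ 2 * (w ^ 3 - 3 / 2 * w ^ 2)))"
    by (intro pcongI[of _ _ _ "w ^ 2 / 2 - (P ^ 2 - 6 * P + 11) / 6 * w ^ 3"])
      (auto simp: field_simps power2_eq_square power3_eq_cube power4_eq_xxxx)
  finally have 1: "pcong 4 (\<Prod>a=1..p-1. 1 + P * q a) (1 + P * (w + P * (w ^ 2 - w) + P ^ 2 * (w ^ 3 - 3 / 2 * w ^ 2)))" .
  have "Q k = (\<Sum>a=1..p-1. q a ^ k)" for k by (simp add: qsum_def)
  then have "pcong 4 (\<Prod>a=1..p-1. 1 + P * q a)
     (1 + P * (Q 1 + P * ((Q 1) ^ 2 - Q 2) / 2 + P ^ 2 * ((Q 1) ^ 3 - 3 * Q 1 * Q 2 + 2 * Q 3) / 6))"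
    using prod_1_plus_pcong4[of "{1..p-1}" q] not_p_dvd
    by (simp add: algebra_simps power2_eq_square power3_eq_cube del: atLeastAtMost_iff)
  from pcong_trans[OF pcong_sym[OF 1] this]
  have "pcong (Suc 3) (P * (w + P * (w ^ 2 - w) + P ^ 2 * (w ^ 3 - 3 / 2 * w ^ 2)))
    (P * (Q 1 + P * ((Q 1) ^ 2 - Q 2) / 2 + P ^ 2 * ((Q 1) ^ 3 - 3 * Q 1 * Q 2 + 2 * Q 3) / 6))"
    by (subst (asm) pcong_eq_diff, subst pcong_eq_diff) simp
  then show ?thesis by (rule pcong_unscale1)
qed

lemma pcong_solve: "pcong n (x + y) z \<Longrightarrow> pcong n y y' \<Longrightarrow> pcong n x (z - y')"
  using pcong_diff[of n "x + y" z y y'] by simp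

text \<open>\<open>wilson_relation\<close> is solved for \<open>Q 1\<close> by successive
  approximation: apart from the leading one, every occurrence of \<open>Q 1\<close> in it carries a
  factor \<open>P\<close>, so each approximation yields the next one with one more digit.\<close>

lemma Q1_pcong1: "pcong 1 (Q 1) w"
proof -
  have "pcong 1 (Q 1 + (P * ((Q 1) ^ 2 - Q 2) / 2 + P ^ 2 * ((Q 1) ^ 3 - 3 * Q 1 * Q 2 + 2 * Q 3) / 6))
     (w + P * (w ^ 2 - w) + P ^ 2 * (w ^ 3 - 3 / 2 * w ^ 2))"
    using pcong_le[OF wilson_relation, of 1] by (simp add: pcong_sym add.assoc)
  also have "pcong 1 \<dots> w"
    by (rule pcongI[of _ _ _ "(w ^ 2 - w) + P * (w ^ 3 - 3 / 2 * w ^ 2)"]) (auto simp: algebra_simps power2_eq_square)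
  finally have "pcong 1 (Q 1) (w - 0)"
  proof (rule pcong_solve)
    show "pcong 1 (P * ((Q 1) ^ 2 - Q 2) / 2 + P ^ 2 * ((Q 1) ^ 3 - 3 * Q 1 * Q 2 + 2 * Q 3) / 6) 0"
      by (rule pcongI[of _ _ _ "((Q 1) ^ 2 - Q 2) / 2 + P * ((Q 1) ^ 3 - 3 * Q 1 * Q 2 + 2 * Q 3) / 6"])
        (auto simp: algebra_simps power2_eq_square)
  qed
  then show ?thesis by simp
qed

lemma Q1_pcong2: "pcong 2 (Q 1) (w + P * (w ^ 2 / 2 - w + Q 2 / 2))"
proof -
  have "pcong 2 (Q 1 + (P * ((Q 1) ^ 2 - Q 2) / 2 + P ^ 2 * ((Q 1) ^ 3 - 3 * Q 1 * Q 2 + 2 * Q 3) / 6))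
     (w + P * (w ^ 2 - w) + P ^ 2 * (w ^ 3 - 3 / 2 * w ^ 2))"
    using pcong_le[OF wilson_relation, of 2] by (simp add: pcong_sym add.assoc)
  then have "pcong 2 (Q 1) (w + P * (w ^ 2 - w) + P ^ 2 * (w ^ 3 - 3 / 2 * w ^ 2) - (P * (w ^ 2 - Q 2) / 2 + 0))"
  proof (rule pcong_solve)
    have "pcong 2 (P * (((Q 1) ^ 2 - Q 2) / 2)) (P * ((w ^ 2 - Q 2) / 2))"
      using pcong_scale1[OF pcong_cmult[OF pcong_diff[OF pcong_power[OF Q1_pcong1] pcong_refl], of "1 / 2"]] by simp
    moreover have "pcong 2 (P ^ 2 * (((Q 1) ^ 3 - 3 * Q 1 * Q 2 + 2 * Q 3) / 6)) 0" by (intro pcong_P_mult) auto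
    ultimately show "pcong 2 (P * ((Q 1) ^ 2 - Q 2) / 2 + P ^ 2 * ((Q 1) ^ 3 - 3 * Q 1 * Q 2 + 2 * Q 3) / 6) (P * (w ^ 2 - Q 2) / 2 + 0)"
      by (intro pcong_add) (simp_all only: times_divide_eq_right)
  qed
  also have "pcong 2 \<dots> (w + P * (w ^ 2 / 2 - w + Q 2 / 2))"
    by (rule pcongI[of _ _ _ "w ^ 3 - 3 / 2 * w ^ 2"]) (auto simp: field_simps power2_eq_square)
  finally show ?thesis .
qed

lemma Q1_pcong3: "pcong 3 (Q 1) (w + P * (w ^ 2 / 2 - w + Q 2 / 2) + P ^ 2 * (w ^ 3 / 3 - w ^ 2 / 2 - Q 3 / 3))"
proof -
  \<comment> \<open>\<open>a\<close> is the first-order coefficient of \<open>Q 1\<close>. Only its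
    product with \<open>w\<close> has an effect, for its square first appears at
    \<open>P ^ 3\<close>.\<close>
  define a where "a = w ^ 2 / 2 - w + Q 2 / 2"
  have aR: "a \<in> R" unfolding a_def by auto
  have "pcong 3 (Q 1 + (P * ((Q 1) ^ 2 - Q 2) / 2 + P ^ 2 * ((Q 1) ^ 3 - 3 * Q 1 * Q 2 + 2 * Q 3) / 6))
     (w + P * (w ^ 2 - w) + P ^ 2 * (w ^ 3 - 3 / 2 * w ^ 2))"
    using wilson_relation by (simp add: pcong_sym add.assoc)
  then have "pcong 3 (Q 1) (w + P * (w ^ 2 - w) + P ^ 2 * (w ^ 3 - 3 / 2 * w ^ 2) 
     - (P * ((w + P * a) ^ 2 - Q 2) / 2 + P ^ 2 * (w ^ 3 - 3 * w * Q 2 + 2 * Q 3) / 6))"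
  proof (rule pcong_solve)
    have "pcong 3 (P * (((Q 1) ^ 2 - Q 2) / 2)) (P * (((w + P * a) ^ 2 - Q 2) / 2))"
      using pcong_scale1[OF pcong_cmult[OF pcong_diff[OF pcong_power[OF Q1_pcong2] pcong_refl], of "1 / 2"]]
      by (simp add: a_def)
    moreover have "pcong 3 (P ^ 2 * (1 / 6 * ((Q 1) ^ 3 - 3 * Q 1 * Q 2 + 2 * Q 3))) (P ^ 2 * (1 / 6 * (w ^ 3 - 3 * w * Q 2 + 2 * Q 3)))"
      by (intro pcong_scale[of 1] pcong_cmult pcong_add pcong_diff pcong_power pcong_mult Q1_pcong1 pcong_refl) auto
    ultimately show "pcong 3 (P * ((Q 1) ^ 2 - Q 2) / 2 + P ^ 2 * ((Q 1) ^ 3 - 3 * Q 1 * Q 2 + 2 * Q 3) / 6)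
       (P * ((w + P * a) ^ 2 - Q 2) / 2 + P ^ 2 * (w ^ 3 - 3 * w * Q 2 + 2 * Q 3) / 6)"
      by (intro pcong_add) simp_all
  qed
  also have "pcong 3 \<dots> (w + P * (w ^ 2 / 2 - w + Q 2 / 2) + P ^ 2 * (w ^ 3 / 3 - w ^ 2 / 2 - Q 3 / 3))"
  proof (rule pcongI)
    show "w + P * (w ^ 2 - w) + P ^ 2 * (w ^ 3 - 3 / 2 * w ^ 2) 
     - (P * ((w + P * a) ^ 2 - Q 2) / 2 + P ^ 2 * (w ^ 3 - 3 * w * Q 2 + 2 * Q 3) / 6)
     - (w + P * (w ^ 2 / 2 - w + Q 2 / 2) + P ^ 2 * (w ^ 3 / 3 - w ^ 2 / 2 - Q 3 / 3)) = P ^ 3 * (- (a ^ 2 / 2))"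
      unfolding a_def by (simp add: field_simps power2_eq_square power3_eq_cube)
  qed (use aR in auto)
  finally show ?thesis .
qed

section \<open>Fourier series with Bernoulli coefficients\<close>

definition fourier_D :: "nat \<Rightarrow> rat" where "fourier_D a = (\<Sum>r\<in>E. D r / of_nat a ^ r)"
definition fourier_B :: "nat \<Rightarrow> rat" where "fourier_B a = (\<Sum>r\<in>E. B r / of_nat a ^ r)"
text \<open>Moments of the series with coefficients \<open>B r = r * D r\<close>. The value
  \<open>gsum 2 0\<close> is carried along until it cancels: in units of \<open>P ^ 3\<close> the
  triple convolution contributes it to the bracket once, the double convolution and the double sum
  minus one half each.\<close>

definition gsum :: "nat \<Rightarrow> nat \<Rightarrow> rat" where
  "gsum j k = (\<Sum>r\<in>E. B r * qsum j (- int r - int k))"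

lemma R_B_E: "r \<in> E \<Longrightarrow> B r \<in> R" and R_D_E: "r \<in> E \<Longrightarrow> D r \<in> R"
  using p_ge by (auto simp: E_def intro!: R_D intro: R_bernoulli[OF not_dvd_between])

lemma R_div_power [simp, intro]: "\<not> p dvd a \<Longrightarrow> x \<in> R \<Longrightarrow> x / of_nat a ^ r \<in> R"
  using R_divide_of_nat[of x "a ^ r"] prime by (auto dest: prime_dvd_power)

lemma R_fourier_D: "\<not> p dvd a \<Longrightarrow> fourier_D a \<in> R" and R_fourier_B: "\<not> p dvd a \<Longrightarrow> fourier_B a \<in> R"
  unfolding fourier_D_def fourier_B_def using R_B_E R_D_E by (auto intro!: R_sum)

text \<open>By reflection the even part of \<open>q\<close> at \<open>a\<close> is
  \<open>q a + 1 / (2 * a)\<close>; the summand \<open>w\<close> comes from the missing trivial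
  coefficient, since \<open>Q 1\<close> is \<open>w\<close> modulo \<open>p\<close>.\<close>

lemma divided_bernoulli_fourier:
  assumes "a \<in> {1..p-1}"
  shows "pcong 1 (fourier_D a) (q a + w + 1 / of_nat a / 2)"
proof -
  have nd: "\<not> p dvd a" using not_p_dvd[OF assms] .
  have "pcong 1 (- fourier_D a) (\<Sum>r\<in>E. (\<Sum>b=1..p-1. of_nat b ^ (p * r) * q b) / of_nat a ^ (p * r))"
    unfolding fourier_D_def sum_negf[symmetric]
  proof (intro pcong_sum)
    fix r assume r: "r \<in> E"
    \<comment> \<open>The exponents \<open>r\<close> and \<open>p * r\<close> agree modulo
      \<open>p - 1\<close>, so modulo \<open>p\<close> the Teichmueller kernel applies to ordinary
      powers.\<close>
    have e: "int (p * r) = int r + int r * int (p - 1)" "- int r = - int (p * r) + int r * int (p - 1)"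
      using p_ge by (simp_all add: of_nat_diff algebra_simps)
    have "(\<Sum>b=1..p-1. of_nat b ^ (p * r) * q b) = qsum 1 (int (p * r))"
      unfolding qsum_def by (simp only: power_int_of_nat) simp
    also have "pcong 1 \<dots> (qsum 1 (int r))" unfolding e(1) by (rule qsum_pcong1)
    also have "pcong 1 \<dots> (- D r)" using E_D[OF r] by (intro D_pcong1)
    finally have 1: "pcong 1 (\<Sum>b=1..p-1. of_nat b ^ (p * r) * q b) (- D r)" .
    have "pcong 1 (of_nat a powi (- int r)) (of_nat a powi (- int (p * r)))"
      unfolding e(2) by (rule powi_pcong1[OF nd])
    then have 2: "pcong 1 (1 / of_nat a ^ r) (1 / of_nat a ^ (p * r))"
      by (simp only: power_int_minus power_int_of_nat inverse_eq_divide)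
    have "pcong 1 (- D r * (1 / of_nat a ^ r)) ((\<Sum>b=1..p-1. of_nat b ^ (p * r) * q b) * (1 / of_nat a ^ (p * r)))"
      using R_D_E[OF r] nd by (intro pcong_mult pcong_sym[OF 1] 2) auto
    then show "pcong 1 (- (D r / of_nat a ^ r)) ((\<Sum>b=1..p-1. of_nat b ^ (p * r) * q b) / of_nat a ^ (p * r))"
      by simp
  qed
  also have "pcong 1 \<dots> ((P - 1) / 2 * (q a + q (p - a)) - (\<Sum>b=1..p-1. q b))"
    using not_p_dvd by (intro pcong_le[OF even_kernel_sum] assms) auto
  also have "(\<Sum>b=1..p-1. q b) = Q 1" by (simp add: qsum_def)
  also have "pcong 1 ((P - 1) / 2 * (q a + q (p - a)) - Q 1) ((P - 1) / 2 * (q a + (q a + 1 / of_nat a)) - w)"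
    by (intro pcong_diff pcong_cmult pcong_add pcong_refl fermat_quotient_reflect1 Q1_pcong1 assms) auto
  also have "pcong 1 \<dots> (- (q a + w + 1 / of_nat a / 2))"
  proof (rule pcongI)
    have eq: "(P - 1) / 2 * (x + (x + u)) - y - - (x + y + u / 2) = P * ((x + (x + u)) / 2)" for x y u :: rat
      by (simp add: field_simps)
    show "(P - 1) / 2 * (q a + (q a + 1 / of_nat a)) - w - - (q a + w + 1 / of_nat a / 2) = P ^ 1 * ((q a + (q a + 1 / of_nat a)) / 2)"
      using eq[of "q a" "1 / of_nat a" w] by simp
  qed (use nd in auto)
  finally have "pcong 1 (- fourier_D a) (- (q a + w + 1 / of_nat a / 2))" .
  from pcong_minus[OF this] show ?thesis by (simp only: minus_minus)
qed

section \<open>Convolutions modulo a prime\<close>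

abbreviation d :: rat where "d \<equiv> D (p - 3)"
abbreviation C :: rat where "C \<equiv> bernoulli_conv2 (p - 1)"

lemma D_odd: "odd r \<Longrightarrow> r \<in> {2..p-3} \<Longrightarrow> D r = 0"
  unfolding divided_bernoulli_def by (subst bernoulli_odd) auto

lemma sum_E_eq:
  assumes "\<And>r. odd r \<Longrightarrow> r \<in> {2..p-3} \<Longrightarrow> f r = 0"
  shows "(\<Sum>r\<in>E. f r) = (\<Sum>r=2..p-3. f r)"
  unfolding E_def using assms by (intro sum.mono_neutral_left) auto

lemma bernoulli_conv2_E: "C = (\<Sum>r\<in>E. D r * D (p - 1 - r))"
  unfolding bernoulli_conv2_def using p_ge by (subst sum_E_eq) (auto simp: D_odd numeral_3_eq_3 numeral_2_eq_2)

lemma R_C [simp, intro]: "C \<in> R"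
  unfolding bernoulli_conv2_E by (intro R_sum R_mult R_D) (auto simp: E_def)

lemmas R_C' [simp, intro] = R_C[unfolded One_nat_def]

lemma qsum_0_pcong_small:
  assumes "0 < k" "k < p - 1"
  shows "pcong 1 (qsum 0 (- int k)) 0"
  using assms by (intro qsum_0_int_pcong) (auto dest!: zdvd_imp_le)

lemma qsum_small [simp]:
  shows "pcong 1 (qsum 0 (-1)) 0" "pcong 1 (qsum 0 (-2)) 0" "pcong 1 (qsum 0 (-3)) 0"
    and "pcong 1 (qsum 1 (-1)) 0" "pcong 1 (qsum 1 (-2)) (- d)"
proof -
  show "pcong 1 (qsum 0 (-1)) 0" "pcong 1 (qsum 0 (-2)) 0" "pcong 1 (qsum 0 (-3)) 0"
    using qsum_0_pcong_small[of 1] qsum_0_pcong_small[of 2] qsum_0_pcong_small[of 3] p_ge by auto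
  have "pcong 1 (2 * qsum 1 (-1)) (- qsum 0 (-1 - 1))" by (rule qsum_1_odd) simp
  also have "pcong 1 (- qsum 0 (-1 - 1)) (- 0)" using qsum_0_pcong_small[of 2] p_ge by (intro pcong_minus) simp
  finally show "pcong 1 (qsum 1 (-1)) 0" using pcong_half[of 1 _ 0] by simp
  show "pcong 1 (qsum 1 (-2)) (- d)" using qsum_1_minus_even[of 2] p_ge by (simp add: numeral_3_eq_3)
qed

lemma R_d [simp, intro]: "d \<in> R"
  using p_ge by (intro R_D) auto

lemma R_gsum [simp, intro]: "gsum j k \<in> R"
  unfolding gsum_def using R_B_E by (intro R_sum) auto

lemma sum_fourier_B: "(\<Sum>a=1..p-1. q a ^ j * fourier_B a / of_nat a ^ k) = gsum j k"
proof -
  have "(\<Sum>a=1..p-1. q a ^ j * fourier_B a / of_nat a ^ k) = (\<Sum>a=1..p-1. \<Sum>r\<in>E. B r * (of_nat a powi (- int r - int k) * q a ^ j))"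
  proof (intro sum.cong refl)
    fix a assume "a \<in> {1..p-1}"
    then show "q a ^ j * fourier_B a / of_nat a ^ k = (\<Sum>r\<in>E. B r * (of_nat a powi (- int r - int k) * q a ^ j))"
      unfolding fourier_B_def sum_distrib_left sum_divide_distrib
      by (intro sum.cong refl) (auto simp: power_int_diff power_int_minus field_simps)
  qed
  also have "\<dots> = gsum j k" unfolding gsum_def qsum_def sum_distrib_left by (rule sum.swap)
  finally show ?thesis .
qed

lemma p_minus_3_E: "p - 3 \<in> E"
  using p_ge odd_p by (auto simp: E_def)

lemma B_p_minus_3: "pcong 1 (B (p - 3)) (- 3 * d)"
proof (rule pcongI)
  show "B (p - 3) - (- 3 * d) = P ^ 1 * d" using p_ge by (subst B_eq_D) (auto simp: of_nat_diff algebra_simps)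
qed auto

text \<open>A power sum survives only where \<open>p - 1\<close> divides \<open>r + k\<close>. For
  \<open>k <= 2\<close> this leaves \<open>r = p - 3\<close> with \<open>k = 2\<close>, which
  contributes \<open>- B (p - 3)\<close>.\<close>

lemma gsum_0_pcong:
  assumes "k \<le> 2"
  shows "pcong 1 (gsum 0 k) (if k = 2 then 3 * d else 0)"
proof -
  have "pcong 1 (gsum 0 k) (\<Sum>r\<in>E. B r * (if r = p - 3 \<and> k = 2 then - 1 else 0))"
    unfolding gsum_def
  proof (intro pcong_sum pcong_cmult R_B_E)
    fix r assume r: "r \<in> E"
    show "pcong 1 (qsum 0 (- int r - int k)) (if r = p - 3 \<and> k = 2 then - 1 else 0)"
    proof (cases "r = p - 3 \<and> k = 2")
      case True
      then have "- int r - int k = - int (p - 1)" using p_ge by simp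
      then have "int (p - 1) dvd - int r - int k" by (metis dvd_minus_iff dvd_refl)
      then show ?thesis using True qsum_0_int_pcong_dvd by auto
    next
      case False
      then have "r + k < p - 1" "0 < r + k" using r assms p_ge by (auto simp: E_def)
      then have "pcong 1 (qsum 0 (- int (r + k))) 0" by (intro qsum_0_pcong_small)
      moreover have "- int (r + k) = - int r - int k" by simp
      ultimately show ?thesis using False by (metis (full_types))
    qed
  qed
  also have "\<dots> = (if k = 2 then - B (p - 3) else 0)"
  proof (cases "k = 2")
    case True
    have "(\<Sum>r\<in>E. B r * (if r = p - 3 \<and> k = 2 then - 1 else 0)) = (\<Sum>r\<in>E. if r = p - 3 then - B (p - 3) else 0)"
      using True by (intro sum.cong) auto
    then show ?thesis using p_minus_3_E True by (simp add: E_def)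
  qed simp
  also have "pcong 1 \<dots> (if k = 2 then 3 * d else 0)"
    using pcong_minus[OF B_p_minus_3] by simp
  finally show ?thesis .
qed

text \<open>All exponents \<open>- r - 1\<close> are odd, so \<open>qsum_1_odd\<close> replaces the
  moments by power sums at \<open>- r - 2\<close>, of which only the one for
  \<open>r = p - 3\<close> survives.\<close>

lemma gsum_1_1: "pcong 1 (gsum 1 1) (- 3 / 2 * d)"
proof -
  have "pcong 1 (2 * gsum 1 1) (\<Sum>r\<in>E. B r * (if r = p - 3 then 1 else 0))"
    unfolding gsum_def sum_distrib_left
  proof (intro pcong_sum)
    fix r assume r: "r \<in> E"
    have "odd (- int r - int 1)" using r by (auto simp: E_def)
    then have "pcong 1 (2 * qsum 1 (- int r - int 1)) (- qsum 0 (- int r - int 1 - 1))"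
      by (rule qsum_1_odd)
    also have "pcong 1 \<dots> (if r = p - 3 then 1 else 0)"
    proof (cases "r = p - 3")
      case True
      then have "- int r - int 1 - 1 = - int (p - 1)" using p_ge by simp
      then have "int (p - 1) dvd - int r - int 1 - 1" by (metis dvd_minus_iff dvd_refl)
      then show ?thesis using True pcong_minus[OF qsum_0_int_pcong_dvd] by fastforce
    next
      case False
      then have "r + 2 < p - 1" using r p_ge by (auto simp: E_def)
      then have "pcong 1 (- qsum 0 (- int (r + 2))) (- 0)" by (intro pcong_minus qsum_0_pcong_small) auto
      moreover have "- int (r + 2) = - int r - int 1 - 1" by simp
      ultimately show ?thesis using False by (metis (full_types) minus_zero)
    qed
    finally have "pcong 1 (B r * (2 * qsum 1 (- int r - int 1))) (B r * (if r = p - 3 then 1 else 0))"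
      using R_B_E[OF r] by (intro pcong_cmult)
    then show "pcong 1 (2 * (B r * qsum 1 (- int r - int 1))) (B r * (if r = p - 3 then 1 else 0))"
      by (simp only: mult.left_commute)
  qed
  also have "\<dots> = B (p - 3)"
    using p_minus_3_E by (simp add: E_def if_distrib[of "\<lambda>x. _ * x"] cong: if_cong)
  also have "pcong 1 \<dots> (2 * (- 3 / 2 * d))" using B_p_minus_3 by simp
  finally show ?thesis by (rule pcong_half)
qed

text \<open>The sum of \<open>r * D r * D (p - 1 - r)\<close> is averaged with its reflection. This
  replaces the weight \<open>r\<close> by \<open>(p - 1) / 2\<close>, which is
  \<open>- 1 / 2\<close> modulo \<open>p\<close>.\<close>

lemma gsum_1_0: "pcong 1 (gsum 1 0) (C / 2)"
proof -
  have "pcong 1 (gsum 1 0) (\<Sum>r\<in>E. B r * (- D (p - 1 - r)))"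
    unfolding gsum_def using E_D qsum_1_minus_even by (intro pcong_sum pcong_cmult R_B_E) auto
  then have "pcong 1 (2 * gsum 1 0) (2 * (\<Sum>r\<in>E. B r * (- D (p - 1 - r))))" by (intro pcong_cmult) auto
  also have "(\<Sum>r\<in>E. B r * (- D (p - 1 - r))) = - (\<Sum>r\<in>E. of_nat r * D r * D (p - 1 - r))"
    unfolding sum_negf[symmetric] by (intro sum.cong refl) (auto simp: E_def B_eq_D)
  also have "2 * - (\<Sum>r\<in>E. of_nat r * D r * D (p - 1 - r))
     = - (\<Sum>r\<in>E. of_nat r * D r * D (p - 1 - r)) - (\<Sum>r\<in>E. of_nat (p - 1 - r) * D (p - 1 - r) * D (p - 1 - (p - 1 - r)))"
    using sum_E_reflect[of "\<lambda>r. of_nat r * D r * D (p - 1 - r)"] by linarith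
  also have "\<dots> = - (\<Sum>r\<in>E. (P - 1) * (D r * D (p - 1 - r)))"
    unfolding sum_negf[symmetric] sum_subtractf[symmetric]
  proof (intro sum.cong refl)
    fix r assume "r \<in> E"
    then have "p - 1 - (p - 1 - r) = r" "of_nat (p - 1 - r) = P - 1 - of_nat r" using p_ge by (auto simp: E_def of_nat_diff)
    then show "- (of_nat r * D r * D (p - 1 - r)) - of_nat (p - 1 - r) * D (p - 1 - r) * D (p - 1 - (p - 1 - r)) =
         - ((P - 1) * (D r * D (p - 1 - r)))" by (simp add: algebra_simps)
  qed
  also have "\<dots> = - ((P - 1) * C)" unfolding bernoulli_conv2_E sum_distrib_left ..
  also have "pcong 1 \<dots> (2 * (C / 2))" by (rule pcongI[of _ _ _ "- C"]) (auto simp: algebra_simps)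
  finally show ?thesis by (rule pcong_half)
qed

lemma sum_q2_fourier_D: "pcong 1 (\<Sum>a=1..p-1. q a ^ 2 * fourier_D a) (Q 3 + w * Q 2 + d / 2)"
proof -
  have "pcong 1 (\<Sum>a=1..p-1. q a ^ 2 * fourier_D a) (\<Sum>a=1..p-1. q a ^ 2 * (q a + w + 1 / of_nat a / 2))"
    using not_p_dvd by (intro pcong_sum pcong_cmult divided_bernoulli_fourier) auto
  also have "\<dots> = Q 3 + w * Q 2 + 1 / 2 * qsum 2 (-1)"
    unfolding qsum_def sum_distrib_left sum.distrib[symmetric]
    by (intro sum.cong refl) (simp add: power_int_minus field_simps power2_eq_square power3_eq_cube)
  also have "pcong 1 \<dots> (Q 3 + w * Q 2 + 1 / 2 * d)"
    by (intro pcong_add pcong_refl pcong_cmult qsum_2_minus_1) auto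
  finally show ?thesis by simp
qed

text \<open>In the expanded cube \<open>Q 0 = - 1\<close> and \<open>Q 1 = w\<close> combine to
  \<open>2 * w ^ 3\<close>; the coefficient of \<open>d\<close> is \<open>3 / 2 - 3 / 4\<close>,
  from the second moment at -1 and the first moment at -2.\<close>

lemma sum_fourier_D_cube: "pcong 1 (\<Sum>a=1..p-1. fourier_D a ^ 3) (Q 3 + 3 * w * Q 2 + 2 * w ^ 3 + 3 / 4 * d)"
proof -
  have "pcong 1 (\<Sum>a=1..p-1. fourier_D a ^ 3) (\<Sum>a=1..p-1. (q a + w + 1 / of_nat a / 2) ^ 3)"
    using not_p_dvd R_fourier_D by (intro pcong_sum pcong_power divided_bernoulli_fourier) auto
  also have "\<dots> = Q 3 + w ^ 3 * Q 0 + 1 / 8 * qsum 0 (-3) + 3 * w * Q 2 + 3 / 2 * qsum 2 (-1) + 3 * w ^ 2 * Q 1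
      + 3 / 2 * w ^ 2 * qsum 0 (-1) + 3 / 4 * qsum 1 (-2) + 3 / 4 * w * qsum 0 (-2) + 3 * w * qsum 1 (-1)"
    unfolding qsum_def sum_distrib_left sum.distrib[symmetric]
    by (intro sum.cong refl) (simp add: power_int_minus field_simps power2_eq_square power3_eq_cube)
  also have "pcong 1 \<dots> (Q 3 + w ^ 3 * (- 1) + 1 / 8 * 0 + 3 * w * Q 2 + 3 / 2 * d + 3 * w ^ 2 * w
      + 3 / 2 * w ^ 2 * 0 + 3 / 4 * (- d) + 3 / 4 * w * 0 + 3 * w * 0)"
    using R_divide_numeral(1)[OF R_divide_numeral(3)[OF R_1]]
    by (intro pcong_add pcong_refl pcong_cmult qsum_2_minus_1 qsum_small Q1_pcong1 qsum_0_int_pcong_dvd) auto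
  also have "\<dots> = Q 3 + 3 * w * Q 2 + 2 * w ^ 3 + 3 / 4 * d"
    by (simp add: power2_eq_square power3_eq_cube)
  finally show ?thesis .
qed

lemma sum_fourier_D2_fourier_B: "pcong 1 (\<Sum>a=1..p-1. fourier_D a ^ 2 * fourier_B a) (gsum 2 0 + w * C - 3 / 4 * d)"
proof -
  have "pcong 1 (\<Sum>a=1..p-1. fourier_D a ^ 2 * fourier_B a) (\<Sum>a=1..p-1. (q a + w + 1 / of_nat a / 2) ^ 2 * fourier_B a)"
    using not_p_dvd R_fourier_D R_fourier_B by (intro pcong_sum pcong_mult pcong_refl pcong_power divided_bernoulli_fourier) auto
  also have "\<dots> = gsum 2 0 + w ^ 2 * gsum 0 0 + 1 / 4 * gsum 0 2 + 2 * w * gsum 1 0 + gsum 1 1 + w * gsum 0 1"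
    unfolding sum_fourier_B[symmetric] sum_distrib_left sum.distrib[symmetric]
    by (intro sum.cong refl) (simp add: field_simps power2_eq_square)
  also have "pcong 1 \<dots> (gsum 2 0 + w ^ 2 * (if (0::nat) = 2 then 3 * d else 0) + 1 / 4 * (if (2::nat) = 2 then 3 * d else 0)
     + 2 * w * (C / 2) + - 3 / 2 * d + w * (if (1::nat) = 2 then 3 * d else 0))"
    by (intro pcong_add pcong_refl pcong_cmult gsum_1_0 gsum_1_1 gsum_0_pcong) auto
  also have "\<dots> = gsum 2 0 + w * C - 3 / 4 * d" by simp
  finally show ?thesis .
qed

text \<open>Weighting an index triple by \<open>2 + 3 * i\<close> amounts, after symmetrization, to the weight
  \<open>2 + i + j + k\<close>. Modulo \<open>p\<close> this is 1 on the triples of sum \<open>p - 1\<close> and 0 on those of sum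
  \<open>2 * (p - 1)\<close>, so only the former survive.\<close>

lemma bernoulli_conv3_sum:
  "pcong 1 (bernoulli_conv3 (p - 1)) (- (\<Sum>a=1..p-1. 2 * fourier_D a ^ 3 + 3 * (fourier_D a ^ 2 * fourier_B a)))"
proof -
  define W where "W i j k = D i * D j * D k * qsum 0 (- int (i + j + k))" for i j k
  have WR: "W i j k \<in> R" if "i \<in> E" "j \<in> E" "k \<in> E" for i j k
    unfolding W_def using that R_D_E by auto
  have swap1: "(\<Sum>i\<in>E. \<Sum>j\<in>E. \<Sum>k\<in>E. of_nat i * W i j k) = (\<Sum>i\<in>E. \<Sum>j\<in>E. \<Sum>k\<in>E. of_nat j * W i j k)"
    by (subst sum.swap) (simp add: W_def ac_simps)
  have swap2: "(\<Sum>i\<in>E. \<Sum>j\<in>E. \<Sum>k\<in>E. of_nat j * W i j k) = (\<Sum>i\<in>E. \<Sum>j\<in>E. \<Sum>k\<in>E. of_nat k * W i j k)"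
    by (rule sum.cong[OF refl], subst sum.swap) (simp add: W_def ac_simps)
  have "(\<Sum>a=1..p-1. 2 * fourier_D a ^ 3 + 3 * (fourier_D a ^ 2 * fourier_B a)) 
      = (\<Sum>a=1..p-1. \<Sum>i\<in>E. \<Sum>j\<in>E. \<Sum>k\<in>E. (2 + 3 * of_nat i) * (D i * D j * D k * of_nat a powi (- int (i + j + k))))"
  proof (intro sum.cong refl)
    fix a assume a: "a \<in> {1..p-1}"
    have "2 * fourier_D a ^ 3 + 3 * (fourier_D a ^ 2 * fourier_B a) = (2 * fourier_D a + 3 * fourier_B a) * (fourier_D a * fourier_D a)"
      by (simp add: algebra_simps power2_eq_square power3_eq_cube)
    also have "2 * fourier_D a + 3 * fourier_B a = (\<Sum>i\<in>E. (2 + 3 * of_nat i) * (D i / of_nat a ^ i))"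
      unfolding fourier_D_def fourier_B_def sum_distrib_left sum.distrib[symmetric]
      by (intro sum.cong refl) (auto simp: E_def B_eq_D algebra_simps add_divide_distrib)
    also have "\<dots> * (fourier_D a * fourier_D a) = (\<Sum>i\<in>E. \<Sum>j\<in>E. \<Sum>k\<in>E. (2 + 3 * of_nat i) * (D i / of_nat a ^ i) * ((D j / of_nat a ^ j) * (D k / of_nat a ^ k)))"
      unfolding fourier_D_def sum_product by (simp add: sum_distrib_left sum_distrib_right)
    also have "\<dots> = (\<Sum>i\<in>E. \<Sum>j\<in>E. \<Sum>k\<in>E. (2 + 3 * of_nat i) * (D i * D j * D k * of_nat a powi (- int (i + j + k))))"
    proof (intro sum.cong refl)
      fix i j k
      have "(of_nat a :: rat) powi (- int (i + j + k)) = 1 / (of_nat a ^ i * of_nat a ^ j * of_nat a ^ k)"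
        by (simp only: power_int_minus power_int_of_nat inverse_eq_divide power_add)
      then show "(2 + 3 * of_nat i) * (D i / of_nat a ^ i) * ((D j / of_nat a ^ j) * (D k / of_nat a ^ k)) =
         (2 + 3 * of_nat i) * (D i * D j * D k * of_nat a powi (- int (i + j + k)))"
        by simp
    qed
    finally show "2 * fourier_D a ^ 3 + 3 * (fourier_D a ^ 2 * fourier_B a) = (\<Sum>i\<in>E. \<Sum>j\<in>E. \<Sum>k\<in>E. (2 + 3 * of_nat i) * (D i * D j * D k * of_nat a powi (- int (i + j + k))))" .
  qed
  also have "\<dots> = (\<Sum>i\<in>E. \<Sum>j\<in>E. \<Sum>k\<in>E. (2 + 3 * of_nat i) * W i j k)"
    unfolding W_def qsum_def sum_distrib_left power_0 mult_1_right
    by (subst sum.swap, rule sum.cong[OF refl], subst sum.swap, rule sum.cong[OF refl], rule sum.swap)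
  also have "\<dots> = 2 * (\<Sum>i\<in>E. \<Sum>j\<in>E. \<Sum>k\<in>E. W i j k) + 3 * (\<Sum>i\<in>E. \<Sum>j\<in>E. \<Sum>k\<in>E. of_nat i * W i j k)"
    by (simp add: distrib_right sum.distrib sum_distrib_left mult.assoc)
  also have "\<dots> = 2 * (\<Sum>i\<in>E. \<Sum>j\<in>E. \<Sum>k\<in>E. W i j k) + (\<Sum>i\<in>E. \<Sum>j\<in>E. \<Sum>k\<in>E. of_nat i * W i j k)
     + (\<Sum>i\<in>E. \<Sum>j\<in>E. \<Sum>k\<in>E. of_nat j * W i j k) + (\<Sum>i\<in>E. \<Sum>j\<in>E. \<Sum>k\<in>E. of_nat k * W i j k)"
    using swap1 swap2 by simp
  also have "\<dots> = (\<Sum>i\<in>E. \<Sum>j\<in>E. \<Sum>k\<in>E. of_nat (2 + (i + j + k)) * W i j k)"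
    by (simp add: distrib_right sum.distrib sum_distrib_left)
  also have "pcong 1 \<dots> (\<Sum>i\<in>E. \<Sum>j\<in>E. \<Sum>k\<in>E. if i + j + k = p - 1 then - (D i * D j * D k) else 0)"
  proof (intro pcong_sum)
    fix i j k assume ijk: "i \<in> E" "j \<in> E" "k \<in> E"
    define n where "n = i + j + k"
    define x where "x = D i * D j * D k"
    have xR: "x \<in> R" unfolding x_def using R_D_E ijk by auto
    have n: "0 < n" "n < 3 * (p - 1)" using ijk p_ge by (auto simp: n_def E_def)
    have W: "W i j k = x * qsum 0 (- int n)" by (simp add: W_def x_def n_def)
    have "pcong 1 (of_nat (2 + n) * (x * qsum 0 (- int n))) (if n = p - 1 then - x else 0)"
    proof (cases "(p - 1) dvd n")
      case True
      then have dv: "int (p - 1) dvd - int n" by (metis dvd_minus_iff int_dvd_int_iff)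
      from True obtain c where c: "n = (p - 1) * c" by (elim dvdE)
      have "(p - 1) * c < (p - 1) * 3" "0 < (p - 1) * c" using n c by auto
      then have "c < 3" "0 < c" by (simp_all only: mult_less_cancel1 zero_less_mult_iff) auto
      then have n': "n = p - 1 \<or> n = 2 * (p - 1)" using c by (cases "c = 1") auto
      have "pcong 1 (of_nat (2 + n) * (x * qsum 0 (- int n))) (of_nat (2 + n) * (x * (- 1)))"
        using xR dv by (intro pcong_cmult qsum_0_int_pcong_dvd) auto
      also have "pcong 1 \<dots> (if n = p - 1 then - x else 0)"
      proof (rule pcongI)
        show "of_nat (2 + n) * (x * (- 1)) - (if n = p - 1 then - x else 0) = P ^ 1 * (if n = p - 1 then - x else - (2 * x))"
          using n' p_ge by (auto simp: of_nat_diff algebra_simps)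
      qed (use xR in auto)
      finally show ?thesis .
    next
      case False
      then have dv: "\<not> int (p - 1) dvd - int n" by (metis dvd_minus_iff int_dvd_int_iff)
      have "pcong 1 (of_nat (2 + n) * (x * qsum 0 (- int n))) (of_nat (2 + n) * (x * 0))"
        using xR dv by (intro pcong_cmult qsum_0_int_pcong) auto
      moreover have "n \<noteq> p - 1" using False by auto
      ultimately show ?thesis by simp
    qed
    then show "pcong 1 (of_nat (2 + (i + j + k)) * W i j k) (if i + j + k = p - 1 then - (D i * D j * D k) else 0)"
      unfolding W n_def[symmetric] x_def[symmetric] .
  qed
  also have "\<dots> = - bernoulli_conv3 (p - 1)"
  proof -
    have "(\<Sum>i\<in>E. \<Sum>j\<in>E. \<Sum>k\<in>E. if i + j + k = p - 1 then - (D i * D j * D k) else 0)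
       = (\<Sum>i\<in>E. \<Sum>j\<in>E. \<Sum>k=2..p-3. if i + j + k = p - 1 then - (D i * D j * D k) else 0)"
      by (rule sum.cong[OF refl], rule sum.cong[OF refl], rule sum_E_eq) (auto simp: D_odd)
    also have "\<dots> = (\<Sum>i\<in>E. \<Sum>j=2..p-3. \<Sum>k=2..p-3. if i + j + k = p - 1 then - (D i * D j * D k) else 0)"
      by (rule sum.cong[OF refl], rule sum_E_eq) (auto simp: D_odd intro!: sum.neutral)
    also have "\<dots> = (\<Sum>i=2..p-3. \<Sum>j=2..p-3. \<Sum>k=2..p-3. if i + j + k = p - 1 then - (D i * D j * D k) else 0)"
      by (rule sum_E_eq) (auto simp: D_odd intro!: sum.neutral)
    also have "\<dots> = (\<Sum>i=2..p-3. \<Sum>j=2..p-3. if i + j \<le> p - 3 then - (D i * D j * D (p - 1 - i - j)) else 0)"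
    proof (intro sum.cong refl)
      fix i j assume ij: "i \<in> {2..p-3}" "j \<in> {2..p-3}"
      have "(\<Sum>k=2..p-3. if i + j + k = p - 1 then - (D i * D j * D k) else 0)
        = (\<Sum>k=2..p-3. if k = p - 1 - i - j then (if i + j \<le> p - 3 then - (D i * D j * D (p - 1 - i - j)) else 0) else 0)"
        using ij by (intro sum.cong refl) auto
      also have "\<dots> = (if i + j \<le> p - 3 then - (D i * D j * D (p - 1 - i - j)) else 0)"
        using ij p_ge by (subst sum.delta) auto
      finally show "(\<Sum>k=2..p-3. if i + j + k = p - 1 then - (D i * D j * D k) else 0) = \<dots>" .
    qed
    also have "\<dots> = (\<Sum>i=2..p-3. \<Sum>j=2..p-3-i. - (D i * D j * D (p - 1 - i - j)))"
    proof (rule sum.cong[OF refl])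
      fix i assume "i \<in> {2..p-3}"
      then show "(\<Sum>j=2..p-3. if i + j \<le> p - 3 then - (D i * D j * D (p - 1 - i - j)) else 0) = (\<Sum>j=2..p-3-i. - (D i * D j * D (p - 1 - i - j)))"
        by (intro sum.mono_neutral_cong_right) auto
    qed
    \<comment> \<open>Beyond \<open>i = p - 5\<close> the inner range is empty; this is the bound
      \<open>m - 4\<close> in the definition of \<open>bernoulli_conv3\<close>.\<close>
    also have "\<dots> = (\<Sum>i=2..p-5. \<Sum>j=2..p-3-i. - (D i * D j * D (p - 1 - i - j)))"
      by (intro sum.mono_neutral_right) auto
    also have "\<dots> = - bernoulli_conv3 (p - 1)"
      unfolding bernoulli_conv3_def bernoulli_conv2_def
      by (simp add: sum_distrib_left sum_negf mult.assoc numeral_3_eq_3 numeral_2_eq_2 eval_nat_numeral)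
    finally show ?thesis .
  qed
  finally show ?thesis using pcong_minus pcong_sym by fastforce
qed

lemma bernoulli_conv3_pcong:
  "pcong 1 (bernoulli_conv3 (p - 1))
     (- 2 * Q 3 - 6 * w * Q 2 - 4 * w ^ 3 - 3 * gsum 2 0 - 3 * w * C + 3 / 4 * d)"
proof -
  note bernoulli_conv3_sum
  also have "(\<Sum>a=1..p-1. 2 * fourier_D a ^ 3 + 3 * (fourier_D a ^ 2 * fourier_B a))
     = 2 * (\<Sum>a=1..p-1. fourier_D a ^ 3) + 3 * (\<Sum>a=1..p-1. fourier_D a ^ 2 * fourier_B a)"
    by (simp add: sum.distrib sum_distrib_left)
  also have "pcong 1 (- \<dots>) (- (2 * (Q 3 + 3 * w * Q 2 + 2 * w ^ 3 + 3 / 4 * d) + 3 * (gsum 2 0 + w * C - 3 / 4 * d)))"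
    by (intro pcong_minus pcong_add pcong_cmult sum_fourier_D_cube sum_fourier_D2_fourier_B) auto
  finally show ?thesis by (simp add: algebra_simps)
qed

section \<open>The double convolution modulo the square of a prime\<close>

text \<open>The Fourier coefficients of \<open>lq\<close> with respect to the Teichmueller characters modulo \<open>p ^ 2\<close>.\<close>

definition V :: "nat \<Rightarrow> rat" where "V r = (\<Sum>b=1..p-1. of_nat b ^ (p * r) * lq b)"
definition V' :: "nat \<Rightarrow> rat" where "V' r = (\<Sum>b=1..p-1. lq b / of_nat b ^ (p * r))"

lemma R_V [simp, intro]: "V r \<in> R" and R_V' [simp, intro]: "V' r \<in> R"
  unfolding V_def V'_def using not_p_dvd by (intro R_sum R_mult R_lq R_div_power; simp)+

lemma E_reflect_mem: "r \<in> E \<Longrightarrow> p - 1 - r \<in> E"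
  using even_p_minus_1 by (auto simp: E_def)

lemma V_pcong: "pcong 2 (V r) (qsum 1 r + (of_nat r - 1 / 2) * P * qsum 2 r)"
proof -
  have e: "int (p * r) = int r + int r * int (p - 1)"
    using p_ge by (simp_all add: of_nat_diff algebra_simps)
  have "V r = qsum 1 (int (p * r)) - P * (1 / 2 * qsum 2 (int (p * r)))"
    unfolding V_def qsum_def sum_distrib_left sum_subtractf[symmetric] power_int_of_nat
    by (intro sum.cong refl) (simp add: lq_def field_simps)
  also have "pcong 2 \<dots> ((qsum 1 r + of_nat r * P * qsum 2 r) - P * (1 / 2 * qsum 2 r))"
    unfolding e using qsum_pcong2[of 1 r r]
    by (intro pcong_diff pcong_scale1[of 1] pcong_cmult qsum_pcong1) (auto simp: numeral_2_eq_2)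
  also have "\<dots> = qsum 1 r + (of_nat r - 1 / 2) * P * qsum 2 r" by (simp add: algebra_simps)
  finally show ?thesis .
qed

text \<open>Up to the factor \<open>- (1 + P)\<close>, \<open>D'\<close> fails to be a true Fourier
  coefficient modulo \<open>p ^ 2\<close> only by a term proportional to \<open>r\<close>. That term
  carries \<open>P\<close>, so it is needed modulo \<open>p\<close> alone.\<close>

lemma D'_V:
  assumes "r \<in> E"
  shows "pcong 2 (D' r) (- (1 + P) * V r + of_nat r / 2 * P * qsum 2 r)"
proof -
  have "pcong 2 (- (1 + P) * V r + of_nat r / 2 * P * qsum 2 r)
     (- (1 + P) * (qsum 1 r + (of_nat r - 1 / 2) * P * qsum 2 r) + of_nat r / 2 * P * qsum 2 r)"
    by (intro pcong_add pcong_refl pcong_cmult V_pcong) auto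
  also have "pcong 2 \<dots> (- (1 + P) * qsum 1 r - (of_nat r - 1) / 2 * P * qsum 2 r)"
    by (rule pcongI[of _ _ _ "- (of_nat r - 1 / 2) * qsum 2 r"]) (auto simp: field_simps power2_eq_square)
  also have "pcong 2 \<dots> (D' r)"
    using E_D[OF assms] by (intro pcong_sym[OF D'_pcong])
  finally show ?thesis by (rule pcong_sym)
qed

lemma V_pcong1: "r \<in> E \<Longrightarrow> pcong 1 (V r) (- D r)"
proof -
  assume r: "r \<in> E"
  have "pcong 1 (V r) (qsum 1 r + (of_nat r - 1 / 2) * P * qsum 2 r)" by (rule pcong_le[OF V_pcong]) simp
  also have "pcong 1 \<dots> (qsum 1 r)"
    by (rule pcongI[of _ _ _ "(of_nat r - 1 / 2) * qsum 2 r"]) auto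
  also have "pcong 1 \<dots> (- D r)" using E_D[OF r] by (intro D_pcong1)
  finally show ?thesis .
qed

text \<open>Modulo \<open>p ^ 2\<close> the power \<open>b ^ p\<close> is a root of unity of order
  dividing \<open>p - 1\<close>, so the index \<open>p - 1 - r\<close> belongs to the inverse
  character.\<close>

lemma V_reflect: "r \<in> E \<Longrightarrow> pcong 2 (V (p - 1 - r)) (V' r)"
  unfolding V_def V'_def
proof (intro pcong_sum)
  fix b assume r: "r \<in> E" and b: "b \<in> {1..p-1}"
  have nd: "\<not> p dvd b" using not_p_dvd[OF b] .
  have "(of_nat b ^ p) ^ (p - 1) = (of_nat b ^ (p * (p - 1 - r)) * of_nat b ^ (p * r) :: rat)"
  proof -
    have "p - 1 = (p - 1 - r) + r" using r by (auto simp: E_def)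
    then show ?thesis by (metis distrib_left power_add power_mult)
  qed
  then have "of_nat b ^ (p * (p - 1 - r)) * lq b = (lq b / of_nat b ^ (p * r)) * (of_nat b ^ p) ^ (p - 1)"
    using b by simp
  also have "pcong 2 \<dots> ((lq b / of_nat b ^ (p * r)) * 1)"
    using nd by (intro pcong_cmult power_p_pcong) auto
  finally show "pcong 2 (of_nat b ^ (p * (p - 1 - r)) * lq b) (lq b / of_nat b ^ (p * r))" by simp
qed

lemma qsum_0_minus_2: "pcong 2 (qsum 0 (- 2)) (- 2 * P * d)"
proof -
  have "qsum 0 (- 2) = qsum 0 (int (p - 3)) - P * qsum 1 (- 2)"
    using qsum_shift[of 0 "-2"] p_ge by (simp add: of_nat_diff)
  also have "pcong 2 \<dots> (P * of_nat (p - 3) * D' (p - 3) - P * (- d))"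
    using E_D[OF p_minus_3_E] by (intro pcong_diff pcong_scale1[of 1] qsum_small pcong_le[OF qsum_0_pcong_D']) auto
  also have "\<dots> = P * (P - 3) * d + P * d" using p_ge by (simp add: D'_def of_nat_diff)
  also have "pcong 2 \<dots> (- 2 * P * d)"
    by (rule pcongI[of _ _ _ d]) (auto simp: algebra_simps power2_eq_square)
  finally show ?thesis .
qed

abbreviation L1 :: rat where "L1 \<equiv> \<Sum>a=1..p-1. lq a"
abbreviation L2 :: rat where "L2 \<equiv> \<Sum>a=1..p-1. lq a ^ 2"

lemma R_L [simp, intro]: "L1 \<in> R" "L2 \<in> R"
  using not_p_dvd by (auto intro!: R_sum)

lemmas R_L' [simp, intro] = R_L[unfolded One_nat_def]

text \<open>Polarization: \<open>lq_reflect\<close> makes the differences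
  \<open>lq (p - a) - lq a\<close> explicit, and both sums of squares equal \<open>L2\<close>, so
  the mixed sum follows from the squared differences.\<close>

lemma sum_lq_reflect: "pcong 2 (\<Sum>a=1..p-1. lq a * lq (p - a)) (L2 + P * d)"
proof -
  have "(\<Sum>a=1..p-1. (lq (p - a) - lq a) ^ 2) = (\<Sum>a=1..p-1. lq (p - a) ^ 2) + L2 - 2 * (\<Sum>a=1..p-1. lq a * lq (p - a))"
    unfolding sum_distrib_left sum.distrib[symmetric] sum_subtractf[symmetric]
    by (intro sum.cong refl) (simp add: power2_eq_square algebra_simps)
  also have "(\<Sum>a=1..p-1. lq (p - a) ^ 2) = L2" by (rule sum_reflect[symmetric])
  finally have eq: "2 * (\<Sum>a=1..p-1. lq a * lq (p - a)) = 2 * L2 - (\<Sum>a=1..p-1. (lq (p - a) - lq a) ^ 2)" by simp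
  have "pcong 2 (\<Sum>a=1..p-1. (lq (p - a) - lq a) ^ 2) (\<Sum>a=1..p-1. ((1 - P) / of_nat a + P / of_nat a ^ 2 / 2) ^ 2)"
  proof (intro pcong_sum pcong_power)
    fix a assume a: "a \<in> {1..p-1}"
    have "pcong 2 (lq (p - a) - lq a) (lq a + (1 - P) / of_nat a + P / of_nat a ^ 2 / 2 - lq a)"
      by (intro pcong_diff lq_reflect a pcong_refl)
    then show "pcong 2 (lq (p - a) - lq a) ((1 - P) / of_nat a + P / of_nat a ^ 2 / 2)" by simp
    show "lq (p - a) - lq a \<in> R"
      using not_p_dvd[OF a] not_p_dvd[OF reflect_range[OF a]] by (intro R_diff R_lq)
  qed
  also have "\<dots> = (1 - P) ^ 2 * qsum 0 (-2) + P * ((1 - P) * qsum 0 (-3)) + P ^ 2 * (1 / 4 * qsum 0 (-4))"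
    unfolding qsum_def sum_distrib_left sum.distrib[symmetric]
  proof (intro sum.cong refl)
    fix a assume "a \<in> {1..p-1}"
    then show "((1 - P) / of_nat a + P / of_nat a ^ 2 / 2) ^ 2 = (1 - P) ^ 2 * (of_nat a powi - 2 * q a ^ 0) +
         P * ((1 - P) * (of_nat a powi - 3 * q a ^ 0)) + P ^ 2 * (1 / 4 * (of_nat a powi - 4 * q a ^ 0))"
      by (simp add: power_int_minus field_simps power2_eq_square power3_eq_cube power4_eq_xxxx)
  qed
  also have "pcong 2 \<dots> ((1 - P) ^ 2 * (- 2 * P * d) + P * ((1 - P) * 0) + 0)"
    by (intro pcong_add pcong_cmult qsum_0_minus_2 pcong_scale1[of 1] qsum_small pcong_P_mult) auto
  also have "pcong 2 \<dots> (2 * (- P * d))"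
    by (rule pcongI[of _ _ _ "2 * (2 - P) * d"]) (auto simp: algebra_simps power2_eq_square)
  finally have "pcong 2 (2 * (\<Sum>a=1..p-1. lq a * lq (p - a))) (2 * L2 - 2 * (- P * d))"
    unfolding eq by (intro pcong_diff pcong_refl)
  then have "pcong 2 (2 * (\<Sum>a=1..p-1. lq a * lq (p - a))) (2 * (L2 + P * d))" by (simp add: algebra_simps)
  then show ?thesis by (rule pcong_half)
qed

text \<open>Plancherel's formula on \<open>E\<close>: inversion of \<open>V\<close> by
  \<open>even_kernel_sum\<close> leaves the mixed sum of \<open>lq a\<close> and
  \<open>lq (p - a)\<close>, and the missing trivial character leaves \<open>L1 ^ 2\<close>.\<close>

lemma sum_V_V': "pcong 2 (\<Sum>r\<in>E. V r * V' r) ((P - 1) * L2 - P * d / 2 - L1 ^ 2)"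
proof -
  have eq1: "(\<Sum>r\<in>E. V r * V' r) = (\<Sum>a=1..p-1. lq a * (\<Sum>r\<in>E. V r / of_nat a ^ (p * r)))"
    unfolding V'_def sum_distrib_left by (subst sum.swap) (simp add: mult.commute)
  have eq2: "(\<Sum>a=1..p-1. lq a * (c * (lq a + lq (p - a)) - x)) = c * (L2 + (\<Sum>a=1..p-1. lq a * lq (p - a))) - x * L1" for c x
  proof -
    have "(\<Sum>a=1..p-1. lq a * (c * (lq a + lq (p - a)) - x)) = (\<Sum>a=1..p-1. c * lq a ^ 2 + c * (lq a * lq (p - a)) - x * lq a)"
      by (intro sum.cong refl) (simp add: algebra_simps power2_eq_square)
    then show ?thesis by (simp add: sum.distrib sum_subtractf sum_distrib_left distrib_left)
  qed
  have "pcong 2 (\<Sum>r\<in>E. V r * V' r) (\<Sum>a=1..p-1. lq a * ((P - 1) / 2 * (lq a + lq (p - a)) - L1))"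
    unfolding eq1
  proof (rule pcong_sum)
    fix a assume a: "a \<in> {1..p-1}"
    have "pcong 2 (\<Sum>r\<in>E. V r / of_nat a ^ (p * r)) ((P - 1) / 2 * (lq a + lq (p - a)) - L1)"
      unfolding V_def using not_p_dvd by (rule even_kernel_sum[OF a R_lq])
    then show "pcong 2 (lq a * (\<Sum>r\<in>E. V r / of_nat a ^ (p * r))) (lq a * ((P - 1) / 2 * (lq a + lq (p - a)) - L1))"
      using not_p_dvd[OF a] by (intro pcong_cmult R_lq)
  qed
  then have "pcong 2 (\<Sum>r\<in>E. V r * V' r) ((P - 1) / 2 * (L2 + (\<Sum>a=1..p-1. lq a * lq (p - a))) - L1 * L1)"
    by (simp only: eq2)
  also have "pcong 2 ((P - 1) / 2 * (L2 + (\<Sum>a=1..p-1. lq a * lq (p - a))) - L1 * L1) ((P - 1) / 2 * (L2 + (L2 + P * d)) - L1 * L1)"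
    by (intro pcong_diff pcong_refl pcong_cmult pcong_add sum_lq_reflect) auto
  also have "pcong 2 ((P - 1) / 2 * (x + (x + P * d)) - y * y) ((P - 1) * x - P * d / 2 - y ^ 2)" for x y
    by (rule pcongI[of _ _ _ "d / 2"]) (auto simp: field_simps power2_eq_square)
  finally show ?thesis .
qed

text \<open>\<open>D 2\<close> exceeds \<open>D' 2\<close> by \<open>P / 4\<close> and occurs in the
  two summands \<open>r = 2\<close> and \<open>r = p - 3\<close>, each time next to
  \<open>d\<close>.\<close>

lemma bernoulli_conv2_D': "C = (\<Sum>r\<in>E. D' r * D' (p - 1 - r)) + P / 2 * d"
proof -
  define c :: "nat \<Rightarrow> rat" where "c r = (if r = 2 then P / 4 * d else 0)" for r
  have "C = (\<Sum>r\<in>E. D' r * D' (p - 1 - r) + (c r + c (p - 1 - r)))"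
    unfolding bernoulli_conv2_E
  proof (intro sum.cong refl)
    fix r assume r: "r \<in> E"
    consider "r = 2" | "p - 1 - r = 2" | "r \<noteq> 2" "p - 1 - r \<noteq> 2" by blast
    then show "D r * D (p - 1 - r) = D' r * D' (p - 1 - r) + (c r + c (p - 1 - r))"
    proof cases
      case 1
      then have "p - 1 - r = p - 3" by simp
      then show ?thesis using 1 p_ge unfolding D'_def c_def by (simp add: algebra_simps)
    next
      case 2
      then have "r = p - 3" using r by (auto simp: E_def)
      then show ?thesis using 2 p_ge unfolding D'_def c_def by (simp add: algebra_simps)
    qed (simp add: D'_def c_def)
  qed
  also have "\<dots> = (\<Sum>r\<in>E. D' r * D' (p - 1 - r)) + ((\<Sum>r\<in>E. c r) + (\<Sum>r\<in>E. c (p - 1 - r)))"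
    by (simp only: sum.distrib)
  also have "(\<Sum>r\<in>E. c (p - 1 - r)) = (\<Sum>r\<in>E. c r)" by (rule sum_E_reflect[symmetric])
  also have "(\<Sum>r\<in>E. c r) = P / 4 * d"
    using p_ge unfolding c_def by (subst sum.delta) (auto simp: E_def)
  finally show ?thesis by simp
qed

text \<open>The product of the two expansions from \<open>D'_V\<close> has main coefficient
  \<open>(1 + P) ^ 2\<close>. Its first-order terms, brought to a common index by reflection, have
  weight \<open>- (1 + r)\<close>; the part with \<open>r * D r = B r\<close> is
  \<open>gsum 2 0\<close>, the other one is the second moment of \<open>fourier_D\<close>.\<close>

lemma sum_D'_D': 
  "pcong 2 (\<Sum>r\<in>E. D' r * D' (p - 1 - r))
    ((1 + 2 * P) * (\<Sum>r\<in>E. V r * V' r) - P * (gsum 2 0 + (\<Sum>a=1..p-1. q a ^ 2 * fourier_D a)))"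
proof -
  have "pcong 2 (\<Sum>r\<in>E. D' r * D' (p - 1 - r)) (\<Sum>r\<in>E. (1 + 2 * P) * (V r * V' r)
     + P * (1 / 2 * (of_nat r * qsum 2 (int r) * D (p - 1 - r) - (1 + of_nat r) * qsum 2 (int (p - 1 - r)) * D r)))"
  proof (rule pcong_sum)
    fix r assume r: "r \<in> E"
    define s where "s = p - 1 - r"
    have s: "s \<in> E" unfolding s_def using r by (rule E_reflect_mem)
    have os: "of_nat s = P - 1 - of_nat r" using r by (auto simp: s_def E_def of_nat_diff)
    define a b where "a = qsum 2 (int r)" and "b = qsum 2 (int s)"
    have abR: "a \<in> R" "b \<in> R" by (auto simp: a_def b_def)
    have Vs: "pcong 2 (V s) (V' r)" unfolding s_def by (rule V_reflect[OF r])
    have 1: "pcong 2 (D' r) (- (1 + P) * V r + of_nat r / 2 * P * a)" 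
      unfolding a_def by (rule D'_V[OF r])
    have "pcong 2 (D' s) (- (1 + P) * V s + of_nat s / 2 * P * b)" 
      unfolding b_def by (rule D'_V[OF s])
    also have "pcong 2 \<dots> (- (1 + P) * V' r + of_nat s / 2 * P * b)"
      by (intro pcong_add pcong_refl pcong_cmult Vs) auto
    finally have 2: "pcong 2 (D' s) (- (1 + P) * V' r + of_nat s / 2 * P * b)" .
    have "pcong 2 (D' r * D' s) ((- (1 + P) * V r + of_nat r / 2 * P * a) * (- (1 + P) * V' r + of_nat s / 2 * P * b))"
      using abR by (intro pcong_mult 1 2 R_D' E_D r) auto
    also have "pcong 2 \<dots> ((1 + 2 * P) * (V r * V' r) + P * (1 / 2 * ((1 + of_nat r) * b * V r - of_nat r * a * V' r)))"
    proof (rule pcongI)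
      show "(- (1 + P) * V r + of_nat r / 2 * P * a) * (- (1 + P) * V' r + of_nat s / 2 * P * b)
         - ((1 + 2 * P) * (V r * V' r) + P * (1 / 2 * ((1 + of_nat r) * b * V r - of_nat r * a * V' r)))
       = P ^ 2 * (V r * V' r - of_nat r / 2 * a * V' r + of_nat r / 4 * of_nat s * a * b - (P - of_nat r) / 2 * b * V r)"
        unfolding os by (simp add: field_simps power2_eq_square)
    qed (use abR in auto)
    also have "pcong 2 \<dots> ((1 + 2 * P) * (V r * V' r) + P * (1 / 2 * ((1 + of_nat r) * b * (- D r) - of_nat r * a * (- D s))))"
    proof (intro pcong_add pcong_refl pcong_scale1[of 1] pcong_cmult pcong_diff)
      show "pcong 1 (V r) (- D r)" by (rule V_pcong1[OF r])
      have "pcong 1 (V' r) (V s)" by (rule pcong_le[OF pcong_sym[OF Vs]]) simp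
      also have "pcong 1 \<dots> (- D s)" by (rule V_pcong1[OF s])
      finally show "pcong 1 (V' r) (- D s)" .
    qed (use abR in auto)
    finally show "pcong 2 (D' r * D' (p - 1 - r)) ((1 + 2 * P) * (V r * V' r)
     + P * (1 / 2 * (of_nat r * qsum 2 (int r) * D (p - 1 - r) - (1 + of_nat r) * qsum 2 (int (p - 1 - r)) * D r)))"
      unfolding s_def[symmetric] a_def[symmetric] b_def[symmetric] by (simp add: algebra_simps)
  qed
  also have "\<dots> = (1 + 2 * P) * (\<Sum>r\<in>E. V r * V' r) + P * (1 / 2 * ((\<Sum>r\<in>E. of_nat r * qsum 2 (int r) * D (p - 1 - r))
      - (\<Sum>r\<in>E. (1 + of_nat r) * qsum 2 (int (p - 1 - r)) * D r)))"
    unfolding sum_distrib_left sum.distrib[symmetric] sum_subtractf[symmetric] ..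
  also have "(\<Sum>r\<in>E. of_nat r * qsum 2 (int r) * D (p - 1 - r)) = (\<Sum>r\<in>E. of_nat (p - 1 - r) * qsum 2 (int (p - 1 - r)) * D r)"
    by (subst sum_E_reflect) (auto simp: E_def intro!: sum.cong)
  also have "pcong 2 ((1 + 2 * P) * (\<Sum>r\<in>E. V r * V' r) + P * (1 / 2 * ((\<Sum>r\<in>E. of_nat (p - 1 - r) * qsum 2 (int (p - 1 - r)) * D r)
      - (\<Sum>r\<in>E. (1 + of_nat r) * qsum 2 (int (p - 1 - r)) * D r))))
     ((1 + 2 * P) * (\<Sum>r\<in>E. V r * V' r) + P * (1 / 2 * ((\<Sum>r\<in>E. - (1 + of_nat r) * (D r * qsum 2 (- int r)))
      - (\<Sum>r\<in>E. (1 + of_nat r) * (D r * qsum 2 (- int r))))))"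
  proof (intro pcong_add pcong_refl pcong_scale1[of 1] pcong_cmult pcong_diff pcong_sum)
    fix r assume r: "r \<in> E"
    define s where "s = p - 1 - r"
    have s: "of_nat s = P - 1 - of_nat r" using r by (auto simp: s_def E_def of_nat_diff)
    have "- int r + int 1 * int (p - 1) = int s" using r by (auto simp: s_def E_def)
    then have *: "pcong 1 (qsum 2 (int s)) (qsum 2 (- int r))" using qsum_pcong1[of 2 "- int r" 1] by metis
    have "pcong 1 ((1 + of_nat r) * D r * qsum 2 (int s)) ((1 + of_nat r) * D r * qsum 2 (- int r))"
      using R_D_E[OF r] by (intro pcong_cmult *) auto
    then show "pcong 1 ((1 + of_nat r) * qsum 2 (int (p - 1 - r)) * D r) ((1 + of_nat r) * (D r * qsum 2 (- int r)))"
      unfolding s_def[symmetric] by (simp add: mult_ac)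
    have "pcong 1 (of_nat s * qsum 2 (int s) * D r) (- (1 + of_nat r) * D r * qsum 2 (int s))"
      unfolding s using R_D_E[OF r] by (intro pcongI[of _ _ _ "qsum 2 (int s) * D r"]) (auto simp: algebra_simps)
    also have "pcong 1 \<dots> (- (1 + of_nat r) * D r * qsum 2 (- int r))"
      using R_D_E[OF r] by (intro pcong_cmult *) auto
    finally show "pcong 1 (of_nat (p - 1 - r) * qsum 2 (int (p - 1 - r)) * D r) (- (1 + of_nat r) * (D r * qsum 2 (- int r)))"
      unfolding s_def[symmetric] by (simp add: mult_ac)
  qed auto
  also have "(\<Sum>r\<in>E. - (1 + of_nat r) * (D r * qsum 2 (- int r))) = - (\<Sum>r\<in>E. (1 + of_nat r) * (D r * qsum 2 (- int r)))"
    by (simp only: sum_negf[symmetric] mult_minus_left)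
  also have "(\<Sum>r\<in>E. (1 + of_nat r) * (D r * qsum 2 (- int r))) = gsum 2 0 + (\<Sum>r\<in>E. D r * qsum 2 (- int r))"
    unfolding gsum_def sum.distrib[symmetric]
    by (intro sum.cong refl) (auto simp: E_def B_eq_D algebra_simps)
  also have "(\<Sum>r\<in>E. D r * qsum 2 (- int r)) = (\<Sum>a=1..p-1. q a ^ 2 * fourier_D a)"
    unfolding qsum_def fourier_D_def sum_distrib_left
    by (subst sum.swap, intro sum.cong refl) (simp add: power_int_minus field_simps)
  also have "(1 + 2 * P) * x + P * (1 / 2 * (- y - y)) = (1 + 2 * P) * x - P * y" for x y
    by (simp add: field_simps)
  finally show ?thesis .
qed

text \<open>Up to a factor \<open>p\<close> this sum of logarithms is the logarithm of
  \<open>fact (p - 1) ^ (p - 1)\<close>, so it depends on \<open>w\<close> only: the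
  \<open>Q 2\<close> of \<open>Q1_pcong2\<close> cancels.\<close>

lemma L1_pcong: "pcong 2 L1 (w + P * (w ^ 2 / 2 - w))"
proof -
  have "L1 = Q 1 - P * (1 / 2 * Q 2)"
    unfolding qsum_def sum_distrib_left sum_subtractf[symmetric]
    by (intro sum.cong refl) (simp add: lq_def)
  also have "pcong 2 \<dots> ((w + P * (w ^ 2 / 2 - w + Q 2 / 2)) - P * (1 / 2 * Q 2))"
    by (intro pcong_diff Q1_pcong2 pcong_refl)
  also have "\<dots> = w + P * (w ^ 2 / 2 - w)" by (simp add: algebra_simps)
  finally show ?thesis .
qed

lemma L2_pcong: "pcong 2 L2 (Q 2 - P * Q 3)"
proof -
  have "L2 - (Q 2 - P * Q 3) = P ^ 2 * (1 / 4 * Q 4)"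
    unfolding qsum_def sum_distrib_left sum_subtractf[symmetric]
    by (intro sum.cong refl) (simp add: lq_def power2_eq_square power3_eq_cube power4_eq_xxxx algebra_simps)
  then show ?thesis by (rule pcongI) auto
qed

text \<open>The \<open>Q 3\<close> contributed by \<open>L2_pcong\<close> cancels the one from
  \<open>sum_q2_fourier_D\<close>, while \<open>gsum 2 0\<close> stays unevaluated.\<close>

lemma bernoulli_conv2_pcong:
  "pcong 2 C (- Q 2 - w ^ 2 - P * (Q 2 + w ^ 3 + gsum 2 0 + w * Q 2 + d / 2))"
proof -
  have "pcong 2 C ((1 + 2 * P) * (\<Sum>r\<in>E. V r * V' r) - P * (gsum 2 0 + (\<Sum>a=1..p-1. q a ^ 2 * fourier_D a)) + P / 2 * d)"
    unfolding bernoulli_conv2_D' by (intro pcong_add sum_D'_D' pcong_refl)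
  also have "pcong 2 \<dots> ((1 + 2 * P) * ((P - 1) * L2 - P * d / 2 - L1 ^ 2) - P * (gsum 2 0 + (Q 3 + w * Q 2 + d / 2)) + P / 2 * d)"
    by (intro pcong_add pcong_diff pcong_cmult pcong_scale1[of 1] pcong_refl sum_V_V' sum_q2_fourier_D) auto
  also have "pcong 2 \<dots> ((1 + 2 * P) * ((P - 1) * (Q 2 - P * Q 3) - P * d / 2 - (w + P * (w ^ 2 / 2 - w)) ^ 2) 
       - P * (gsum 2 0 + (Q 3 + w * Q 2 + d / 2)) + P / 2 * d)"
    by (intro pcong_add pcong_diff pcong_cmult pcong_power pcong_refl L1_pcong L2_pcong) auto
  also have "pcong 2 \<dots> (- Q 2 - w ^ 2 - P * (Q 2 + w ^ 3 + gsum 2 0 + w * Q 2 + d / 2))"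
  proof (rule pcongI)
    show "(1 + 2 * P) * ((P - 1) * (Q 2 - P * Q 3) - P * d / 2 - (w + P * (w ^ 2 / 2 - w)) ^ 2) 
       - P * (gsum 2 0 + (Q 3 + w * Q 2 + d / 2)) + P / 2 * d
       - (- Q 2 - w ^ 2 - P * (Q 2 + w ^ 3 + gsum 2 0 + w * Q 2 + d / 2))
     = P ^ 2 * (2 * Q 2 + Q 3 - 2 * P * Q 3 - d - (1 + 2 * P) * (w ^ 2 / 2 - w) ^ 2 - 4 * w * (w ^ 2 / 2 - w))"
      by (simp add: field_simps power2_eq_square power3_eq_cube)
  qed auto
  finally show ?thesis .
qed

section \<open>Hensel digits\<close>

lemma pcong1_of_nat_less:
  assumes "pcong 1 (of_nat a) (of_nat b)" "a < p" "b < p"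
  shows "a = b"
  using assms by (simp add: pcong_of_nat cong_def)

lemma residue_exists:
  assumes "x \<in> R"
  shows "\<exists>c<p. pcong 1 x (of_nat c)"
proof -
  obtain a b where ab: "\<not> int p dvd b" "b \<noteq> 0" "x = of_int a / of_int b"
    using assms by (rule padic_integersE)
  have "coprime b (int p)" using ab(1) prime by (simp add: prime_imp_coprime coprime_commute[of b])
  then obtain b' where b': "[b * b' = 1] (mod int p)" using cong_solve_coprime_int by blast
  define c where "c = nat ((a * b') mod int p)"
  have c: "int c = (a * b') mod int p" using p_ge by (simp add: c_def)
  have "[b * int c = b * (a * b')] (mod int p)" unfolding c by (intro cong_mult) auto
  also have "b * (a * b') = a * (b * b')" by simp
  also have "[a * (b * b') = a * 1] (mod int p)" by (intro cong_mult b') auto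
  finally have "int p ^ 1 dvd a - b * int c" by (simp add: cong_iff_dvd_diff dvd_diff_commute)
  then have "pcong 1 (of_int a) (of_int (b * int c))" by (simp only: pcong_of_int)
  then have "pcong 1 (of_int b * x) (of_int b * of_nat c)" using ab by simp
  then have "pcong 1 x (of_nat c)" using ab(1) by (rule pcong_cancel_int)
  moreover have "int c < int p" unfolding c using p_ge by simp
  then have "c < p" by simp
  ultimately show ?thesis by blast
qed

definition residue :: "rat \<Rightarrow> nat" where
  "residue x = (SOME c. c < p \<and> pcong 1 x (of_nat c))"

lemma residue:
  assumes "x \<in> R"
  shows "residue x < p" "pcong 1 x (of_nat (residue x))"
  using someI_ex[OF residue_exists[OF assms, unfolded Bex_def]] unfolding residue_def by auto

primrec hensel_rest :: "rat \<Rightarrow> nat \<Rightarrow> rat" where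
  "hensel_rest x 0 = x"
| "hensel_rest x (Suc n) = (hensel_rest x n - of_nat (residue (hensel_rest x n))) / P"

lemma R_hensel_rest:
  assumes "x \<in> R" shows "hensel_rest x n \<in> R"
proof (induction n)
  case (Suc n)
  define r where "r = hensel_rest x n"
  from residue(2)[OF Suc] obtain z where z: "z \<in> R" "r = of_nat (residue r) + P ^ 1 * z"
    unfolding r_def by (rule pcongE)
  then have "r - of_nat (residue r) = P * z" by (metis add_diff_cancel_left' power_one_right)
  then have "hensel_rest x (Suc n) = z" using p_ge by (simp add: r_def)
  then show ?case using \<open>z \<in> R\<close> by (simp only:)
qed (use assms in auto)

lemma hensel_rest_expansion:
  "x = (\<Sum>j<n. of_nat (residue (hensel_rest x j)) * P ^ j) + P ^ n * hensel_rest x n"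
proof (induction n)
  case (Suc n)
  have "P ^ n * y = of_nat r * P ^ n + P ^ Suc n * ((y - of_nat r) / P)" for y r
    using p_ge by (simp add: field_simps)
  from this[of "hensel_rest x n" "residue (hensel_rest x n)"] Suc show ?case by simp
qed simp

lemma hensel_rest_Suc: "hensel_rest x (Suc n) = hensel_rest (hensel_rest x 1) n"
  by (induction n) auto

lemma is_hensel_expansion_unique:
  assumes "is_hensel_expansion p x c" "is_hensel_expansion p x c'"
  shows "c = c'"
proof (rule ccontr)
  assume "c \<noteq> c'"
  have exp: "\<exists>m::nat. (\<forall>i < - int m. e i = 0) \<and> (\<forall>N. pcong N x (\<Sum>i = - int m..<int N. of_nat (e i) * P powi i))"
    "\<forall>i. e i < p" if "is_hensel_expansion p x e" for e
    using that unfolding is_hensel_expansion_def by (rule conjunct2, rule conjunct1)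
  obtain m where m: "\<forall>i < - int m. c i = 0" "\<forall>N. pcong N x (\<Sum>i = - int m..<int N. of_nat (c i) * P powi i)"
    using exp(1)[OF assms(1)] by (elim exE conjE)
  obtain m' where m': "\<forall>i < - int m'. c' i = 0" "\<forall>N. pcong N x (\<Sum>i = - int m'..<int N. of_nat (c' i) * P powi i)"
    using exp(1)[OF assms(2)] by (elim exE conjE)
  have d: "\<And>i. c i < p" "\<And>i. i < - int m \<Longrightarrow> c i = 0"
      "\<And>N. pcong N x (\<Sum>i = - int m..<int N. of_nat (c i) * P powi i)"
    using m exp(2)[OF assms(1)] by auto
  have d': "\<And>i. c' i < p" "\<And>i. i < - int m' \<Longrightarrow> c' i = 0"
      "\<And>N. pcong N x (\<Sum>i = - int m'..<int N. of_nat (c' i) * P powi i)"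
    using m' exp(2)[OF assms(2)] by auto
  \<comment> \<open>The two expansions may start at different exponents. Below \<open>- M\<close>
    both vanish, so a first disagreement can be sought among natural numbers.\<close>
  define M where "M = max m m'"
  have "\<exists>n. c (int n - int M) \<noteq> c' (int n - int M)"
  proof (rule ccontr)
    assume *: "\<nexists>n. c (int n - int M) \<noteq> c' (int n - int M)"
    have "c i = c' i" for i
    proof (cases "i < - int M")
      case True
      then show ?thesis using d(2) d'(2) by (simp add: M_def)
    next
      case False
      then have "i = int (nat (i + int M)) - int M" by simp
      then show ?thesis using * by metis
    qed
    then show False using \<open>c \<noteq> c'\<close> by auto
  qed
  then have ex: "\<exists>n. (\<lambda>n. c (int n - int M) \<noteq> c' (int n - int M)) n" .
  define n where "n = (LEAST n. c (int n - int M) \<noteq> c' (int n - int M))"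
  have n: "c (int n - int M) \<noteq> c' (int n - int M)"
    "\<And>k. k < n \<Longrightarrow> c (int k - int M) = c' (int k - int M)"
    using LeastI_ex[OF ex] not_less_Least unfolding n_def by blast+
  define i0 where "i0 = int n - int M"
  \<comment> \<open>For negative \<open>i0\<close> this is 0, the lowest precision available. The
    terms strictly between \<open>i0\<close> and \<open>N\<close> carry at least
    \<open>P powi (i0 + 1)\<close>, so division by \<open>P powi i0\<close> still isolates the two
    digits modulo \<open>p\<close>.\<close>
  define N where "N = nat (i0 + 1)"
  have i0: "c i0 \<noteq> c' i0" "- int M \<le> i0" "i0 < int N" using n(1) by (auto simp: i0_def N_def)
  have low: "c i = c' i" if "i < i0" for i
    proof (cases "i < - int M")
      case True
      then show ?thesis using d(2) d'(2) by (simp add: M_def)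
    next
      case False
      then have "i = int (nat (i + int M)) - int M" "nat (i + int M) < n" using that by (auto simp: i0_def)
      then show ?thesis using n(2) by metis
    qed
  define f where "f i = (of_nat (c i) - of_nat (c' i)) * P powi i" for i
  have "(\<Sum>i = - int m..<int N. of_nat (c i) * P powi i) = (\<Sum>i = - int M..<int N. of_nat (c i) * P powi i)"
    "(\<Sum>i = - int m'..<int N. of_nat (c' i) * P powi i) = (\<Sum>i = - int M..<int N. of_nat (c' i) * P powi i)"
    by (intro sum.mono_neutral_left; use d(2) d'(2) in \<open>auto simp: M_def\<close>)+
  then have "pcong N (\<Sum>i = - int M..<int N. of_nat (c i) * P powi i) (\<Sum>i = - int M..<int N. of_nat (c' i) * P powi i)"
    using d(3)[of N] d'(3)[of N] pcong_sym pcong_trans by metis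
  then have "pcong N (\<Sum>i = - int M..<int N. f i) 0"
    by (subst (asm) pcong_eq_diff) (simp add: f_def sum_subtractf left_diff_distrib)
  also have "(\<Sum>i = - int M..<int N. f i) = (\<Sum>i = i0..<int N. f i)"
    using i0 low by (intro sum.mono_neutral_right) (auto simp: f_def)
  also have "{i0..<int N} = insert i0 {i0<..<int N}" using i0 by auto
  finally have "pcong N (f i0 + (\<Sum>i\<in>{i0<..<int N}. f i)) 0" by simp
  then obtain z where z: "z \<in> R" "f i0 + (\<Sum>i\<in>{i0<..<int N}. f i) = P ^ N * z"
    by (auto elim: pcongE)
  have P: "P \<noteq> 0" using p_ge by simp
  have shift: "P powi i * P powi (- i0) = P * P ^ nat (i - i0 - 1)" if "i > i0" for i
  proof -
    have "P powi i * P powi (- i0) = P powi (int (Suc (nat (i - i0 - 1))))"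
      using P that by (simp flip: power_int_add)
    then show ?thesis by (simp only: power_int_of_nat power_Suc)
  qed
  define S where "S = (\<Sum>i\<in>{i0<..<int N}. (of_nat (c i) - of_nat (c' i)) * P ^ nat (i - i0 - 1))"
  have SR: "S \<in> R" unfolding S_def by (intro R_sum) auto
  have "f i0 * P powi (- i0) = of_nat (c i0) - of_nat (c' i0)"
    using P by (simp add: f_def flip: power_int_add mult.assoc)
  moreover have "(\<Sum>i\<in>{i0<..<int N}. f i) * P powi (- i0) = P * (\<Sum>i\<in>{i0<..<int N}. (of_nat (c i) - of_nat (c' i)) * P ^ nat (i - i0 - 1))"
    unfolding sum_distrib_left sum_distrib_right f_def
    by (intro sum.cong refl) (simp add: shift mult.assoc)
  moreover have "P ^ N * z * P powi (- i0) = P * P ^ nat (int N - i0 - 1) * z"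
    using shift[OF i0(3)] by (simp add: mult_ac)
  moreover have "f i0 * P powi (- i0) + (\<Sum>i\<in>{i0<..<int N}. f i) * P powi (- i0) = P ^ N * z * P powi (- i0)"
    by (simp only: z(2) flip: distrib_right)
  ultimately have "of_nat (c i0) - of_nat (c' i0) + P * S = P * P ^ nat (int N - i0 - 1) * z"
    unfolding S_def by (simp only:)
  then have "of_nat (c i0) - of_nat (c' i0) = P ^ 1 * (P ^ nat (int N - i0 - 1) * z - S)"
    by (simp add: algebra_simps)
  then have "pcong 1 (of_nat (c i0)) (of_nat (c' i0))"
    by (rule pcongI) (use z(1) SR in auto)
  then show False using pcong1_of_nat_less d(1) d'(1) i0(1) by blast
qed

lemma hensel_digit_eq:
  assumes "x \<in> R"
  shows "hensel_digit p x (int n) = residue (hensel_rest x n)"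
proof -
  define c where "c i = (if i < 0 then 0 else residue (hensel_rest x (nat i)))" for i :: int
  have "is_hensel_expansion p x c"
    unfolding is_hensel_expansion_def
  proof (intro conjI allI exI[of _ 0] impI)
    fix N
    have "(\<Sum>i = - int 0..<int N. of_nat (c i) * P powi i) = (\<Sum>j<N. of_nat (residue (hensel_rest x j)) * P ^ j)"
      by (rule sum.reindex_bij_witness[of _ int nat]) (auto simp: c_def power_int_def)
    then show "pcong N x (\<Sum>i = - int 0..<int N. of_nat (c i) * P powi i)"
      using hensel_rest_expansion[of x N] R_hensel_rest[OF assms, of N]
      by (intro pcongI[of _ _ _ "hensel_rest x N"]) (simp_all add: algebra_simps)
  qed (use residue(1)[OF R_hensel_rest[OF assms]] p_ge in \<open>auto simp: c_def\<close>)
  then have "hensel_digit p x = c"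
    unfolding hensel_digit_def using is_hensel_expansion_unique by blast
  then show ?thesis by (simp add: c_def)
qed

lemma hensel_digit_less: "x \<in> R \<Longrightarrow> hensel_digit p x (int n) < p"
  by (simp add: hensel_digit_eq residue R_hensel_rest)

lemma hensel_digit_pcong2:
  assumes "x \<in> R"
  shows "pcong 2 x (of_nat (hensel_digit p x 0) + P * of_nat (hensel_digit p x 1))"
  using hensel_rest_expansion[of x 2] R_hensel_rest[OF assms, of 2]
    hensel_digit_eq[OF assms, of 0] hensel_digit_eq[OF assms, of 1]
  by (intro pcongI[of _ _ _ "hensel_rest x 2"]) (simp_all add: numeral_2_eq_2 algebra_simps)

text \<open>The digits below \<open>n\<close> vanish, so stripping each of them is a division by
  \<open>P\<close>, after which the digit in question is the residue of \<open>y\<close>.\<close>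

lemma hensel_digit_pcong1:
  assumes "x \<in> R" "y \<in> R" "pcong (Suc n) x (P ^ n * y)"
  shows "pcong 1 (of_nat (hensel_digit p x (int n))) y"
  using assms
proof (induction n arbitrary: x)
  case 0
  then show ?case using residue(2)[OF 0(1)] hensel_digit_eq[OF 0(1), of 0] pcong_sym pcong_trans
    by (metis One_nat_def hensel_rest.simps(1) mult_1 of_nat_0 power_0)
next
  case (Suc n)
  have P: "P \<noteq> 0" using p_ge by simp
  have "pcong 1 x (P ^ Suc n * y)" by (rule pcong_le[OF Suc.prems(3)]) simp
  also have "pcong 1 (P ^ Suc n * y) 0" using Suc.prems by (intro pcong_P_mult) auto
  finally have "pcong 1 (of_nat (residue x)) (of_nat 0)"
    using residue(2)[OF Suc.prems(1)] pcong_sym pcong_trans by (metis of_nat_0)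
  then have "residue x = 0" using residue(1)[OF Suc.prems(1)] p_ge by (intro pcong1_of_nat_less) auto
  then have rest: "hensel_rest x 1 = x / P" by simp
  have xR: "x / P \<in> R" by (rule R_hensel_rest[OF Suc.prems(1), of 1, unfolded rest])
  have "pcong (Suc (Suc n)) (P * (x / P)) (P * (P ^ n * y))" using Suc.prems(3) P by (simp add: mult.assoc)
  then have "pcong (Suc n) (x / P) (P ^ n * y)" by (rule pcong_unscale1)
  from Suc.IH[OF xR Suc.prems(2) this]
  show ?case unfolding hensel_digit_eq[OF xR] hensel_digit_eq[OF Suc.prems(1)] hensel_rest_Suc[of x] rest .
qed

section \<open>Bernoulli numbers at and just below multiples of \<open>p - 1\<close>\<close>

lemma bernoulli_shifted_pcong:
  "pcong 1 (B (p - 3 + k * (p - 1))) (- of_nat (k + 3) * d)"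
proof -
  have e: "p - 3 \<in> {2..p-3}" "even (p - 3)" using E_D[OF p_minus_3_E] by auto
  have "pcong 2 (P * B (p - 3 + k * (p - 1))) (qsum 0 (int (p - 3 + k * (p - 1))))"
    using e even_p_minus_1 p_ge by (intro pcong_sym[OF qsum_0_pcong_P_bernoulli]) auto
  also have "int (p - 3 + k * (p - 1)) = int (p - 3) + int k * int (p - 1)" by simp
  also have "pcong 2 (qsum 0 (int (p - 3) + int k * int (p - 1))) (qsum 0 (int (p - 3)) + of_nat k * P * qsum 1 (int (p - 3)))"
    using qsum_pcong2[of 0 "int (p - 3)" k] by simp
  also have "\<dots> = qsum 0 (int (p - 3)) + P * (of_nat k * qsum 1 (int (p - 3)))" by simp
  also have "pcong 2 \<dots> (P * of_nat (p - 3) * D' (p - 3) + P * (of_nat k * (- d)))"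
    using e by (intro pcong_add pcong_scale1[of 1] pcong_cmult D_pcong1 pcong_le[OF qsum_0_pcong_D']) auto
  also have "\<dots> = P * (of_nat (p - 3) * d + of_nat k * (- d))"
    using p_ge by (simp add: D'_def algebra_simps)
  finally have "pcong (Suc 1) (P * B (p - 3 + k * (p - 1))) (P * (of_nat (p - 3) * d + of_nat k * (- d)))"
    by (simp add: numeral_2_eq_2)
  then have "pcong 1 (B (p - 3 + k * (p - 1))) (of_nat (p - 3) * d + of_nat k * (- d))" by (rule pcong_unscale1)
  also have "pcong 1 \<dots> (- of_nat (k + 3) * d)"
    using p_ge by (intro pcongI[of _ _ _ d]) (auto simp: of_nat_diff algebra_simps)
  finally show ?thesis .
qed

text \<open>For \<open>n = k * (p - 1)\<close>, which is \<open>- k\<close> modulo \<open>p\<close>,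
  Faulhaber's correction \<open>(n choose 2) / 3 * P ^ 3 * B (n - 2)\<close> equals
  \<open>- k * (k + 1) * (k + 2) / 6 * P ^ 3 * d\<close>, because \<open>B (n - 2)\<close> is
  \<open>- (k + 2) * d\<close> modulo \<open>p\<close>. The values \<open>k = 1, 2, 3\<close> give
  the coefficients 1, 4, 10 of \<open>d\<close>.\<close>

lemma P_bernoulli_pcong4:
  assumes "k \<ge> 1"
  shows "pcong 4 (P * B (k * (p - 1))) (qsum 0 (int (k * (p - 1))) + of_nat k * (of_nat k + 1) * (of_nat k + 2) / 6 * P ^ 3 * d)"
proof -
  define n where "n = k * (p - 1)"
  obtain j where k: "k = Suc j" using assms by (cases k) auto
  have ev: "even n" "n \<ge> 4" using even_p_minus_1 p_ge by (auto simp: n_def k)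
  have n2: "n - 2 = p - 3 + j * (p - 1)" using p_ge by (simp add: n_def k)
  have on: "of_nat n = of_nat k * (P - 1)" using p_ge by (simp add: n_def of_nat_diff)
  have choose: "of_nat (n choose 2) = of_nat n * (of_nat n - 1) / (2 :: rat)"
  proof -
    have "even (n * (n - 1))" by (cases n) auto
    then have "2 * (n choose 2) = n * (n - 1)" unfolding choose_two by (rule dvd_mult_div_cancel)
    then have "of_nat (2 * (n choose 2)) = (of_nat (n * (n - 1)) :: rat)" by (simp only:)
    then show ?thesis using ev by (simp add: of_nat_diff field_simps)
  qed
  have "pcong 4 (qsum 0 (int n)) (P * B n + of_nat (n choose 2) * P ^ 3 / 3 * B (n - 2))"
    using sum_powers_pcong[OF ev] sum_lessThan_qsum[of n] ev by simp
  also have "of_nat (n choose 2) * P ^ 3 / 3 * B (n - 2) = P ^ 3 * (of_nat (n choose 2) / 3 * B (n - 2))" by simp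
  also have "pcong 4 (P * B n + \<dots>) (P * B n + P ^ 3 * (of_nat (n choose 2) / 3 * (- of_nat (j + 3) * d)))"
    unfolding n2 by (intro pcong_add pcong_refl pcong_scale[of 1] pcong_cmult bernoulli_shifted_pcong R_divide_numeral) auto
  also have "pcong 4 \<dots> (P * B n - of_nat k * (of_nat k + 1) * (of_nat k + 2) / 6 * P ^ 3 * d)"
  proof (rule pcongI)
    show "P * B n + P ^ 3 * (of_nat (n choose 2) / 3 * (- of_nat (j + 3) * d)) - (P * B n - of_nat k * (of_nat k + 1) * (of_nat k + 2) / 6 * P ^ 3 * d)
      = P ^ 4 * (of_nat k * (of_nat k * (2 - P) + 1) * (of_nat k + 2) / 6 * d)"
      unfolding choose on using k by (simp add: field_simps power2_eq_square power3_eq_cube power4_eq_xxxx)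
  qed auto
  finally have "pcong 4 (qsum 0 (int n)) (P * B n - of_nat k * (of_nat k + 1) * (of_nat k + 2) / 6 * P ^ 3 * d)" .
  from pcong_add[OF this pcong_refl, of "of_nat k * (of_nat k + 1) * (of_nat k + 2) / 6 * P ^ 3 * d"]
  show ?thesis unfolding n_def by (simp add: pcong_sym)
qed

lemma P_bernoulli_values:
  "pcong 4 (P * B (p - 1)) (P - 1 + P * Q 1 + P ^ 3 * d)"
  "pcong 4 (P * B (2 * (p - 1))) (P - 1 + 2 * P * Q 1 + P ^ 2 * Q 2 + 4 * P ^ 3 * d)"
  "pcong 4 (P * B (3 * (p - 1))) (P - 1 + 3 * P * Q 1 + 3 * P ^ 2 * Q 2 + P ^ 3 * Q 3 + 10 * P ^ 3 * d)"
proof -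
  have 0: "Q 0 = P - 1" using p_ge by (simp add: qsum_def of_nat_diff)
  have s: "qsum j (int (p - 1)) = Q j + P * Q (Suc j)" for j using qsum_shift[of j 0] by simp
  have s2: "qsum j (int (2 * (p - 1))) = qsum j (int (p - 1)) + P * qsum (Suc j) (int (p - 1))" for j
    using qsum_shift[of j "int (p - 1)"] by (simp only: mult_2 of_nat_add)
  have s3: "qsum j (int (3 * (p - 1))) = qsum j (int (2 * (p - 1))) + P * qsum (Suc j) (int (2 * (p - 1)))" for j
  proof -
    have "int (3 * (p - 1)) = int (2 * (p - 1)) + int (p - 1)" by simp
    then show ?thesis using qsum_shift[of j "int (2 * (p - 1))"] by (simp only:)
  qed
  show "pcong 4 (P * B (p - 1)) (P - 1 + P * Q 1 + P ^ 3 * d)"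
    using P_bernoulli_pcong4[of 1] unfolding mult_1 s by (simp add: 0)
  have e: "P - 1 + 2 * P * Q 1 + P ^ 2 * Q 2 + 4 * P ^ 3 * d = qsum 0 (int (2 * (p - 1))) + of_nat 2 * (of_nat 2 + 1) * (of_nat 2 + 2) / 6 * P ^ 3 * d"
    unfolding s2 s 0 by (simp add: algebra_simps power2_eq_square numeral_2_eq_2)
  show "pcong 4 (P * B (2 * (p - 1))) (P - 1 + 2 * P * Q 1 + P ^ 2 * Q 2 + 4 * P ^ 3 * d)"
    unfolding e by (rule P_bernoulli_pcong4) simp
  have e: "P - 1 + 3 * P * Q 1 + 3 * P ^ 2 * Q 2 + P ^ 3 * Q 3 + 10 * P ^ 3 * d = qsum 0 (int (3 * (p - 1))) + of_nat 3 * (of_nat 3 + 1) * (of_nat 3 + 2) / 6 * P ^ 3 * d"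
    unfolding s3 s2 s 0 by (simp add: algebra_simps power2_eq_square power3_eq_cube numeral_2_eq_2 numeral_3_eq_3)
  show "pcong 4 (P * B (3 * (p - 1))) (P - 1 + 3 * P * Q 1 + 3 * P ^ 2 * Q 2 + P ^ 3 * Q 3 + 10 * P ^ 3 * d)"
    unfolding e by (rule P_bernoulli_pcong4) simp
qed

lemma A_star_eq: "A_star p (p - 1) = 1 / fact (p - 1)"
proof -
  have "{S. S \<subseteq> {1..p-1} \<and> card S = p - 1} = {{1..p-1}}"
    using card_subset_eq[OF finite_atLeastAtMost, of _ 1 "p - 1"] by auto
  then show ?thesis unfolding A_star_def by (simp add: fact_prod prod_dividef)
qed

section \<open>Evaluation of the bracket\<close>

lemma R_divide_30 [simp, intro]: "x \<in> R \<Longrightarrow> x / 30 \<in> R"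
  using R_divide_numeral(5)[OF R_divide_numeral(4)[of x]] by simp

lemma kummer_quotient1:
  assumes "k \<in> E"
  shows "pcong 1 ((D (k + (p - 1)) - D' k) / P) (- (1 / 2) * qsum 2 k)"
proof -
  have "pcong (Suc 1) (P * ((D (k + (p - 1)) - D' k) / P)) (P * (- (1 / 2) * qsum 2 k))"
    using kummer_quotient[OF E_D(2,1)[OF assms]] p_ge by (simp add: numeral_2_eq_2)
  then show ?thesis by (rule pcong_unscale1)
qed

lemma qsum_reflect_index:
  assumes "k \<in> E"
  shows "pcong 1 (qsum j (int (p - 1 - k))) (qsum j (- int k))"
proof -
  have "- int k + int 1 * int (p - 1) = int (p - 1 - k)" using assms by (auto simp: E_def)
  then show ?thesis using qsum_pcong1[of j "- int k" 1] by metis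
qed

lemma E_mem: "2 \<in> E" "4 \<in> E" "p - 3 \<in> E" "p - 5 \<in> E"
  using E_reflect_mem[of 4] p_minus_3_E p_ge by (auto simp: E_def)

section \<open>Kummer difference quotients and the incomplete double sum\<close>

abbreviation e :: rat where "e \<equiv> D (p - 5)"
text \<open>\<open>delta\<close>, \<open>eps\<close> and \<open>beta\<close> are first differences
  in Kummer's congruence, needed modulo \<open>p\<close> only. In units of \<open>P ^ 3\<close>
  their coefficients in the bracket are \<open>1 / 4 - 1 / 6 - 1 / 12\<close>,
  \<open>1 / 30 - 1 / 30\<close> and \<open>3 * d - 3 * d\<close>, so they disappear.\<close>

definition delta :: rat where "delta = (D (2 * p - 4) - d) / P"
definition eps :: rat where "eps = (D (2 * p - 6) - e) / P"
definition beta :: rat where "beta = (D (p + 1) - 1 / 12) / P"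

text \<open>The second moment at \<open>- k\<close> is -2 times the Kummer quotient at
  \<open>p - 1 - k\<close>. The shift of \<open>beta\<close> by \<open>1 / 4\<close> arises because
  \<open>beta\<close> is formed with \<open>D 2 = 1 / 12\<close>, but the quotient with
  \<open>D' 2 = 1 / 12 - P / 4\<close>.\<close>

lemma delta_pcong: "pcong 1 (qsum 2 (- 2)) (- 2 * delta)"
  and eps_pcong: "pcong 1 (qsum 2 (- 4)) (- 2 * eps)"
  and beta_pcong: "pcong 1 (qsum 2 (- int (p - 3))) (- 2 * (beta + 1 / 4))"
proof -
  have *: "pcong 1 (qsum 2 (- int k)) (- 2 * ((D (p - 1 - k + (p - 1)) - D' (p - 1 - k)) / P))" if k: "k \<in> E" for k
  proof -
    have "pcong 1 (qsum 2 (- int k)) (qsum 2 (int (p - 1 - k)))"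
      by (rule pcong_sym[OF qsum_reflect_index[OF k]])
    also have "\<dots> = - 2 * (- (1 / 2) * qsum 2 (int (p - 1 - k)))" by simp
    also have "pcong 1 \<dots> (- 2 * ((D (p - 1 - k + (p - 1)) - D' (p - 1 - k)) / P))"
      by (intro pcong_cmult pcong_sym[OF kummer_quotient1] E_reflect_mem k) auto
    finally show ?thesis .
  qed
  have i: "p - 1 - 2 = p - 3" "p - 1 - 4 = p - 5" "p - 1 - (p - 3) = 2"
    "p - 3 + (p - 1) = 2 * p - 4" "p - 5 + (p - 1) = 2 * p - 6" "2 + (p - 1) = p + 1"
    "p - 3 \<noteq> 2" "p - 5 \<noteq> 2"
    using p_ge by auto
  show "pcong 1 (qsum 2 (- 2)) (- 2 * delta)" using *[OF E_mem(1)] unfolding i D'_def delta_def using i by simp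
  show "pcong 1 (qsum 2 (- 4)) (- 2 * eps)" using *[OF E_mem(2)] unfolding i D'_def eps_def using i by simp
  have "(D (p + 1) - D' 2) / P = beta + 1 / 4"
  proof -
    have "(x - (1 / 12 - P / 4)) / P = (x - 1 / 12) / P + 1 / 4" for x
      using p_ge by (simp add: field_simps)
    moreover have "D' 2 = 1 / 12 - P / 4" by (simp add: D'_def divided_bernoulli_def bernoulli_values)
    ultimately show ?thesis unfolding beta_def by simp
  qed
  then show "pcong 1 (qsum 2 (- int (p - 3))) (- 2 * (beta + 1 / 4))" using *[OF E_mem(3)] unfolding i by simp
qed

lemma R_delta [simp, intro]: "delta \<in> R" and R_eps [simp, intro]: "eps \<in> R" and R_beta [simp, intro]: "beta \<in> R"
proof -
  have h: "x \<in> R" if "- 2 * x \<in> R" for x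
    using R_mult[OF that, of "- (1 / 2)"] by simp
  show "delta \<in> R" "eps \<in> R" 
    using h pcong_R'[OF delta_pcong R_qsum] pcong_R'[OF eps_pcong R_qsum] by blast+
  have "beta + 1 / 4 \<in> R" using h pcong_R'[OF beta_pcong R_qsum] by blast
  then have "beta + 1 / 4 - 1 / 4 \<in> R" by (rule R_diff) auto
  then show "beta \<in> R" by simp
qed

lemma R_e [simp, intro]: "e \<in> R"
  using p_ge by (intro R_D) auto

text \<open>Compared with \<open>gsum 2 0\<close> the even indices 2, 4 and \<open>p - 3\<close> are
  missing. Their Bernoulli numbers are \<open>1 / 6\<close>, \<open>- 1 / 30\<close> and, modulo
  \<open>p\<close>, \<open>- 3 * d\<close>; their second moments are given by the Kummer
  quotients.\<close>

lemma fermat_quotient_double_sum: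
  "pcong 1 (\<Sum>a=1..p-1. \<Sum>i=6..p-5. B i / of_nat a ^ i * q a ^ 2)
     (gsum 2 0 + delta / 3 - eps / 15 - 6 * d * beta - 3 / 2 * d)"
proof -
  define f where "f i = B i * qsum 2 (- int i)" for i
  have "(\<Sum>a=1..p-1. \<Sum>i=6..p-5. B i / of_nat a ^ i * q a ^ 2) = (\<Sum>i=6..p-5. f i)"
    unfolding f_def qsum_def sum_distrib_left
    by (subst sum.swap, intro sum.cong refl) (simp add: power_int_minus field_simps)
  moreover have "gsum 2 0 = f 2 + f 4 + f (p - 3) + (\<Sum>i=6..p-5. f i)"
  proof -
    have odd0: "f r = 0" if "odd r" "r \<in> {2..p-3}" for r
      using that by (auto simp: f_def intro!: bernoulli_odd)
    have "gsum 2 0 = (\<Sum>i\<in>E. f i)" by (simp add: gsum_def f_def)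
    also have "\<dots> = (\<Sum>i\<in>{2,4,p-3} \<union> {6..p-5}. f i)"
    proof (rule sum.mono_neutral_left)
      show "E \<subseteq> {2, 4, p - 3} \<union> {6..p - 5}"
      proof
        fix r assume r: "r \<in> E"
        then have "r \<noteq> 3" "r \<noteq> 5" "r \<noteq> p - 4" using odd_p p_ge by (auto simp: E_def)
        then show "r \<in> {2, 4, p - 3} \<union> {6..p - 5}" using r by (auto simp: E_def)
      qed
      show "\<forall>i\<in>{2, 4, p - 3} \<union> {6..p - 5} - E. f i = 0"
        using odd0 E_mem by (auto simp: E_def)
    qed auto
    also have "\<dots> = f 2 + f 4 + f (p - 3) + (\<Sum>i=6..p-5. f i)"
      using p_ge by (subst sum.union_disjoint) auto
    finally show ?thesis .
  qed
  moreover have "f 2 = 1 / 6 * qsum 2 (- 2)" "f 4 = (- 1 / 30) * qsum 2 (- 4)" "f (p - 3) = B (p - 3) * qsum 2 (- int (p - 3))"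
    by (simp_all add: f_def bernoulli_values)
  ultimately have "(\<Sum>a=1..p-1. \<Sum>i=6..p-5. B i / of_nat a ^ i * q a ^ 2)
     = gsum 2 0 - 1 / 6 * qsum 2 (- 2) - (- 1 / 30) * qsum 2 (- 4) - B (p - 3) * qsum 2 (- int (p - 3))"
    by simp
  moreover have "pcong 1 (gsum 2 0 - 1 / 6 * qsum 2 (- 2) - (- 1 / 30) * qsum 2 (- 4) - B (p - 3) * qsum 2 (- int (p - 3)))
    (gsum 2 0 - 1 / 6 * (- 2 * delta) - (- 1 / 30) * (- 2 * eps) - (- 3 * d) * (- 2 * (beta + 1 / 4)))"
  proof (intro pcong_diff pcong_refl pcong_cmult pcong_mult delta_pcong eps_pcong beta_pcong B_p_minus_3)
    show "- 1 / 30 \<in> R" by (rule R_divide_30) auto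
    show "- 2 * (beta + 1 / 4) \<in> R" by (intro R_mult R_add R_beta R_divide_numeral R_minus R_numeral R_1)
  qed (use R_B_E E_mem in auto)
  moreover have "h - 1 / 6 * (- 2 * x) - (- 1 / 30) * (- 2 * y) - (- 3 * u) * (- 2 * (v + 1 / 4)) = h + x / 3 - y / 15 - 6 * u * v - 3 / 2 * u"
      for h x y u v :: rat by (simp add: field_simps)
  ultimately show ?thesis by (simp only:)
qed

lemma bernoulli_conv2_pcong1: "pcong 1 C (- Q 2 - w ^ 2)"
proof -
  have "pcong 1 C (- Q 2 - w ^ 2 - P * (Q 2 + w ^ 3 + gsum 2 0 + w * Q 2 + d / 2))"
    by (rule pcong_le[OF bernoulli_conv2_pcong]) simp
  also have "pcong 1 \<dots> (- Q 2 - w ^ 2)"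
    by (rule pcongI[of _ _ _ "- (Q 2 + w ^ 3 + gsum 2 0 + w * Q 2 + d / 2)"]) (auto simp: algebra_simps)
  finally show ?thesis .
qed

text \<open>After multiplication by \<open>(p - 1) ^ 2\<close> the two parts of \<open>X\<close>
  agree up to order \<open>P\<close>, so \<open>X\<close> has a factor \<open>P ^ 2\<close>. Its
  cofactor is \<open>- Q 2 - w ^ 2\<close> modulo \<open>p\<close>, the value of the double
  convolution.\<close>

lemma P_bernoulli_double_pcong3:
  defines "X \<equiv> 2 * P * D (2 * (p - 1)) - P ^ 2 * (D (p - 1)) ^ 2"
  shows "pcong 3 X (P ^ 2 * C)"
proof -
  define x y where "x = P * B (p - 1)" and "y = P * B (2 * (p - 1))"
  have P1: "of_nat (p - 1) = P - 1" "P - 1 \<noteq> 0" using p_ge by (auto simp: of_nat_diff)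
  have R: "x \<in> R" "y \<in> R" unfolding x_def y_def by auto
  have "pcong 3 x (P - 1 + P * Q 1 + P ^ 3 * d)" unfolding x_def by (rule pcong_le[OF P_bernoulli_values(1)]) simp
  also have "pcong 3 \<dots> (P - 1 + P * Q 1)" by (rule pcongI[of _ _ _ d]) auto
  finally have x: "pcong 3 x (P - 1 + P * Q 1)" .
  have "pcong 3 y (P - 1 + 2 * P * Q 1 + P ^ 2 * Q 2 + 4 * P ^ 3 * d)" unfolding y_def by (rule pcong_le[OF P_bernoulli_values(2)]) simp
  also have "pcong 3 \<dots> (P - 1 + 2 * P * Q 1 + P ^ 2 * Q 2)" by (rule pcongI[of _ _ _ "4 * d"]) auto
  finally have y: "pcong 3 y (P - 1 + 2 * P * Q 1 + P ^ 2 * Q 2)" .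
  have 1: "P * D (p - 1) = x / (P - 1)" "2 * P * D (2 * (p - 1)) = y / (P - 1)"
  proof -
    show "P * D (p - 1) = x / (P - 1)"
      unfolding x_def divided_bernoulli_def P1(1) by simp
    have "2 * P * (b / (2 * t)) = P * b / t" if "t \<noteq> 0" for b t :: rat using that by (simp add: field_simps)
    then show "2 * P * D (2 * (p - 1)) = y / (P - 1)"
      unfolding y_def divided_bernoulli_def of_nat_mult P1(1) of_nat_numeral using P1(2) by blast
  qed
  have "X = y / (P - 1) - (x / (P - 1)) ^ 2" unfolding X_def 1[symmetric] by (simp add: power_mult_distrib)
  then have "of_nat ((p - 1) ^ 2) * X = (P - 1) * y - x ^ 2"
  proof -
    have "t ^ 2 * (v / t - (u / t) ^ 2) = t * v - u ^ 2" if "t \<noteq> 0" for t u v :: rat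
      using that by (simp add: field_simps power2_eq_square)
    from this[OF P1(2)] show ?thesis
      unfolding \<open>X = y / (P - 1) - (x / (P - 1)) ^ 2\<close> of_nat_power P1(1) .
  qed
  also have "pcong 3 \<dots> ((P - 1) * (P - 1 + 2 * P * Q 1 + P ^ 2 * Q 2) - (P - 1 + P * Q 1) ^ 2)"
    using R by (intro pcong_diff pcong_cmult pcong_power x y) auto
  also have "\<dots> = P ^ 2 * ((P - 1) * Q 2 - (Q 1) ^ 2)" by (simp add: algebra_simps power2_eq_square)
  also have "pcong 3 \<dots> (P ^ 2 * (of_nat ((p - 1) ^ 2) * C))"
  proof (rule pcong_scale)
    have "pcong 1 ((P - 1) * Q 2 - (Q 1) ^ 2) ((P - 1) * Q 2 - w ^ 2)"
      by (intro pcong_diff pcong_refl pcong_power Q1_pcong1) auto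
    also have "pcong 1 \<dots> (- Q 2 - w ^ 2)" by (rule pcongI[of _ _ _ "Q 2"]) (auto simp: algebra_simps)
    also have "pcong 1 \<dots> C" by (rule pcong_sym[OF bernoulli_conv2_pcong1])
    also have "pcong 1 \<dots> (of_nat ((p - 1) ^ 2) * C)"
    proof (rule pcongI)
      show "C - of_nat ((p - 1) ^ 2) * C = P ^ 1 * ((2 - P) * C)"
        unfolding of_nat_power P1(1) by (simp add: algebra_simps power2_eq_square)
    qed auto
    finally show "pcong 1 ((P - 1) * Q 2 - (Q 1) ^ 2) (of_nat ((p - 1) ^ 2) * C)" .
  qed simp
  also have "P ^ 2 * (of_nat ((p - 1) ^ 2) * C) = of_nat ((p - 1) ^ 2) * (P ^ 2 * C)" by (rule mult.left_commute)
  finally show ?thesis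
  proof (rule pcong_cancel)
    have "\<not> p dvd p - 1" by (rule not_p_dvd) (use p_ge in auto)
    then show "\<not> p dvd (p - 1) ^ 2" using prime by (metis prime_dvd_power)
  qed
qed

text \<open>Digit 2 of \<open>X\<close> is digit 0 of \<open>C\<close>. Together with digit 1 of
  \<open>C\<close> it reassembles \<open>P ^ 2 / 2 * C\<close>; what is left of its coefficient is
  \<open>(w - 1) / 2\<close> times \<open>P ^ 3\<close>, where the digit may be replaced by
  \<open>C\<close>.\<close>

lemma hensel_digit_terms:
  fixes X :: rat
  assumes "X \<in> R" "pcong 3 X (P ^ 2 * C)"
  shows "pcong 4 (1 / 2 * P ^ 3 * of_nat (hensel_digit p C 1) + (1 - P) / 2 * (1 + P * w) * P ^ 2 * of_nat (hensel_digit p X 2))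
    (P ^ 2 / 2 * C + P ^ 3 * ((w - 1) / 2 * C))"
proof -
  define c0 c1 x2 :: rat where "c0 = of_nat (hensel_digit p C 0)" "c1 = of_nat (hensel_digit p C 1)" "x2 = of_nat (hensel_digit p X 2)"
  have C01: "pcong 2 C (c0 + P * c1)" unfolding c0_c1_x2_def by (rule hensel_digit_pcong2) auto
  have "pcong 1 x2 C"
    using hensel_digit_pcong1[of X C 2] assms by (simp add: c0_c1_x2_def numeral_3_eq_3)
  also have "pcong 1 C c0" using hensel_digit_pcong1[of C C 0] pcong_sym by (simp add: c0_c1_x2_def)
  \<comment> \<open>Equality and not only congruence is required, as the digit is multiplied by no
    more than \<open>P ^ 2\<close>; it holds because both digits lie below \<open>p\<close>.\<close>
  finally have "hensel_digit p X 2 = hensel_digit p C 0"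
    unfolding c0_c1_x2_def using hensel_digit_less[of X 2] hensel_digit_less[of C 0] assms(1)
    by (intro pcong1_of_nat_less) auto
  then have "x2 = c0" unfolding c0_c1_x2_def by simp
  from C01 obtain z where z: "z \<in> R" "C = c0 + P * c1 + P ^ 2 * z" by (rule pcongE)
  have R: "c0 \<in> R" "c1 \<in> R" unfolding c0_c1_x2_def by auto
  have c0: "c0 = C - P * c1 - P ^ 2 * z" using z(2) by simp
  have "pcong 4 (1 / 2 * P ^ 3 * c1 + (1 - P) / 2 * (1 + P * w) * P ^ 2 * (t - P * c1 - P ^ 2 * z))
    (P ^ 2 / 2 * t + P ^ 3 * ((w - 1) / 2 * t))" if "t \<in> R" for t
  proof (rule pcongI)
    show "1 / 2 * P ^ 3 * c1 + (1 - P) / 2 * (1 + P * w) * P ^ 2 * (t - P * c1 - P ^ 2 * z)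
       - (P ^ 2 / 2 * t + P ^ 3 * ((w - 1) / 2 * t))
       = P ^ 4 * (- w / 2 * t - (w - 1 - P * w) / 2 * c1 - (1 - P) / 2 * (1 + P * w) * z)"
      by (simp add: field_simps power2_eq_square power3_eq_cube power4_eq_xxxx)
  qed (use R z(1) that in auto)
  from this[OF R_C] show ?thesis
    unfolding c0_c1_x2_def(2,3)[symmetric] \<open>x2 = c0\<close> unfolding c0[symmetric] .
qed

text \<open>Modulo \<open>p ^ 4\<close> the values \<open>P * B (k * (p - 1))\<close> follow a cubic
  \<open>f\<close> in \<open>k\<close> with \<open>f 0 = P - 1\<close>, and
  \<open>4 * f 0 - 6 * f 1 + 4 * f 2 - f 3 = f (-1)\<close>. This is the truncated series for the
  sum of \<open>1 / (1 + P * q a)\<close>; the term in \<open>d\<close> vanishes at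
  \<open>k = -1\<close>. The parts with \<open>P ^ 3\<close> see only
  \<open>P * B (k * (p - 1)) = - 1\<close> modulo \<open>p\<close> and cancel by
  \<open>13 / 3 - 19 / 2 + 7 - 11 / 6 = 0\<close>.\<close>

lemma P_bernoulli_terms:
  "pcong 4 ((13 * P ^ 3 + 12 * P - 12) / 3 + (19 * P ^ 3 - 12) / 2 * (P * B (p - 1)) + (4 - 7 * P ^ 3) * (P * B (2 * (p - 1)))
      + (11 * P ^ 3 - 6) / 6 * (P * B (3 * (p - 1))))
    (P - 1 - P * Q 1 + P ^ 2 * Q 2 - P ^ 3 * Q 3)"
proof -
  have "pcong 4 ((13 * P ^ 3 + 12 * P - 12) / 3 + (19 * P ^ 3 - 12) / 2 * (P * B (p - 1)) + (4 - 7 * P ^ 3) * (P * B (2 * (p - 1)))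
      + (11 * P ^ 3 - 6) / 6 * (P * B (3 * (p - 1))))
    ((13 * P ^ 3 + 12 * P - 12) / 3 + (19 * P ^ 3 - 12) / 2 * (P - 1 + P * Q 1 + P ^ 3 * d)
      + (4 - 7 * P ^ 3) * (P - 1 + 2 * P * Q 1 + P ^ 2 * Q 2 + 4 * P ^ 3 * d)
      + (11 * P ^ 3 - 6) / 6 * (P - 1 + 3 * P * Q 1 + 3 * P ^ 2 * Q 2 + P ^ 3 * Q 3 + 10 * P ^ 3 * d))"
    by (intro pcong_add pcong_refl pcong_cmult P_bernoulli_values) auto
  also have "pcong 4 \<dots> (P - 1 - P * Q 1 + P ^ 2 * Q 2 - P ^ 3 * Q 3)"
  proof -
    have "pcong 4 ((13 * P ^ 3 + 12 * P - 12) / 3 + (19 * P ^ 3 - 12) / 2 * (P - 1 + P * s1 + P ^ 3 * u)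
      + (4 - 7 * P ^ 3) * (P - 1 + 2 * P * s1 + P ^ 2 * s2 + 4 * P ^ 3 * u)
      + (11 * P ^ 3 - 6) / 6 * (P - 1 + 3 * P * s1 + 3 * P ^ 2 * s2 + P ^ 3 * s3 + 10 * P ^ 3 * u))
      (P - 1 - P * s1 + P ^ 2 * s2 - P ^ 3 * s3)" if "s1 \<in> R" "s2 \<in> R" "s3 \<in> R" "u \<in> R" for s1 s2 s3 u
    proof (rule pcongI)
      show "(13 * P ^ 3 + 12 * P - 12) / 3 + (19 * P ^ 3 - 12) / 2 * (P - 1 + P * s1 + P ^ 3 * u)
        + (4 - 7 * P ^ 3) * (P - 1 + 2 * P * s1 + P ^ 2 * s2 + 4 * P ^ 3 * u)
        + (11 * P ^ 3 - 6) / 6 * (P - 1 + 3 * P * s1 + 3 * P ^ 2 * s2 + P ^ 3 * s3 + 10 * P ^ 3 * u)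
        - (P - 1 - P * s1 + P ^ 2 * s2 - P ^ 3 * s3)
        = P ^ 4 * (13 / 3 + s1 - 3 / 2 * P * s2 + P ^ 2 * (11 * s3 / 6 - u / 6))"
        by (simp add: field_simps power2_eq_square power3_eq_cube power4_eq_xxxx)
    qed (use that in auto)
    then show ?thesis by simp
  qed
  finally show ?thesis .
qed

lemma agoh_giuga_pcong: "pcong 1 (agoh_giuga_quotient p) (1 + w)"
  and P_bernoulli_pcong2: "pcong 2 (P * B (p - 1)) (P - 1 + P * w)"
proof -
  have "pcong 2 (P * B (p - 1)) (P - 1 + P * Q 1 + P ^ 3 * d)" by (rule pcong_le[OF P_bernoulli_values(1)]) simp
  also have "pcong 2 \<dots> (P - 1 + P * w + 0)"
  proof (intro pcong_add pcong_refl pcong_scale1[of 1] Q1_pcong1)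
    show "pcong 2 (P ^ 3 * d) 0" by (intro pcong_P_mult) auto
  qed simp
  finally show *: "pcong 2 (P * B (p - 1)) (P - 1 + P * w)" by simp
  have "pcong 2 (P * B (p - 1) + 1) (P - 1 + P * w + 1)" by (intro pcong_add * pcong_refl)
  moreover have "x = P * (x / P)" for x using p_ge by simp
  then have "P * B (p - 1) + 1 = P * agoh_giuga_quotient p" unfolding agoh_giuga_quotient_def .
  moreover have "P - 1 + P * w + 1 = P * (1 + w)" by (simp add: distrib_left)
  ultimately have "pcong (Suc 1) (P * agoh_giuga_quotient p) (P * (1 + w))"
    by (simp only: Suc_1)
  then show "pcong 1 (agoh_giuga_quotient p) (1 + w)" by (rule pcong_unscale1)
qed

text \<open>At order \<open>P ^ 2\<close> everything cancels:
  \<open>1 / 4 - 1 / 6 - 1 / 12 = 0\<close> for \<open>d\<close> and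
  \<open>1 / 30 - 1 / 30 = 0\<close> for \<open>e\<close>. The number \<open>D (p + 3)\<close> drops
  out identically within the last product. At order \<open>P ^ 3\<close> the constant
  \<open>7 / 720\<close> leaves \<open>1 / 30 - 7 / 360 = 1 / 72\<close> for
  \<open>e\<close>.\<close>

lemma kummer_terms:
  "pcong 4 (- (P ^ 2 / 6 * (1 + P * w) * (1 / 2 * d + 1 / 5 * e))
     + P * (2 * d - D (2 * p - 4)) * ((1 / 2 - 3 * B (p + 1)) * P - 4 / 3 * P ^ 2)
     + 2 * P * (D (2 * p - 4) - 2 * d) * (P / 12 - 11 * P ^ 2 / 24 + P ^ 2 / 12 * agoh_giuga_quotient p)
     + 4 * P * (D (2 * p - 6) - 2 * e)
         * (P * (2 * D 4 - D (p + 3)) + 1 / 2 * (7 / 720 * P ^ 2 + 2 * P * D (p + 3) + 2 * P * D 4 * (P * B (p - 1)))))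
    (P ^ 3 * (- d * w / 4 - 5 / 6 * d - 3 * d * beta - delta / 12 + e / 72 - eps / 30))"
proof -
  have P: "P \<noteq> 0" using p_ge by simp
  from agoh_giuga_pcong obtain y where y: "y \<in> R" "agoh_giuga_quotient p = 1 + w + P ^ 1 * y" by (rule pcongE)
  from P_bernoulli_pcong2 obtain z where z: "z \<in> R" "P * B (p - 1) = P - 1 + P * w + P ^ 2 * z" by (rule pcongE)
  have eqs: "D (2 * p - 4) = d + P * delta" "D (2 * p - 6) = e + P * eps" "D 4 = - (1 / 120)"
    "B (p + 1) = (P + 1) * (1 / 12 + P * beta)"
    using P B_eq_D[of "p + 1"] by (simp_all add: divided_bernoulli_def bernoulli_values add.commute delta_def eps_def beta_def)
  have "pcong 4 (- (P ^ 2 / 6 * (1 + P * v) * (1 / 2 * a + 1 / 5 * b))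
     + P * (2 * a - (a + P * s)) * ((1 / 2 - 3 * ((P + 1) * (1 / 12 + P * r))) * P - 4 / 3 * P ^ 2)
     + 2 * P * (a + P * s - 2 * a) * (P / 12 - 11 * P ^ 2 / 24 + P ^ 2 / 12 * (1 + v + P ^ 1 * y))
     + 4 * P * (b + P * t - 2 * b)
         * (P * (2 * (- (1 / 120)) - c) + 1 / 2 * (7 / 720 * P ^ 2 + 2 * P * c + 2 * P * (- (1 / 120)) * (P - 1 + P * v + P ^ 2 * z))))
    (P ^ 3 * (- a * v / 4 - 5 / 6 * a - 3 * a * r - s / 12 + b / 72 - t / 30))" 
    if "v \<in> R" "a \<in> R" "b \<in> R" "s \<in> R" "t \<in> R" "r \<in> R" for v a b s t r c
  proof (rule pcongI)
    define X where "X = - 3 * a * r + 3 * P * r * s + 5 / 6 * s + 3 * r * s + s * v / 6 - t / 72 - t * v / 5 / 6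
      + (P * s - a) * y / 6 - (P * t - b) * z / 5 / 6"
    show "- (P ^ 2 / 6 * (1 + P * v) * (1 / 2 * a + 1 / 5 * b))
     + P * (2 * a - (a + P * s)) * ((1 / 2 - 3 * ((P + 1) * (1 / 12 + P * r))) * P - 4 / 3 * P ^ 2)
     + 2 * P * (a + P * s - 2 * a) * (P / 12 - 11 * P ^ 2 / 24 + P ^ 2 / 12 * (1 + v + P ^ 1 * y))
     + 4 * P * (b + P * t - 2 * b)
         * (P * (2 * (- (1 / 120)) - c) + 1 / 2 * (7 / 720 * P ^ 2 + 2 * P * c + 2 * P * (- (1 / 120)) * (P - 1 + P * v + P ^ 2 * z)))
     - P ^ 3 * (- a * v / 4 - 5 / 6 * a - 3 * a * r - s / 12 + b / 72 - t / 30) = P ^ 4 * X"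
      unfolding X_def by (simp add: field_simps power2_eq_square power3_eq_cube power4_eq_xxxx)
    show "X \<in> R" unfolding X_def using that y(1) z(1) by auto
  qed
  from this[OF R_w R_d R_e R_delta R_eps R_beta, of "D (p + 3)"]
  show ?thesis unfolding eqs(1-3) y(2) z(2) unfolding eqs(4) .
qed

lemma hensel_digit_delta: "pcong 1 (of_nat (hensel_digit p (D (2 * p - 4) - d) 1)) delta"
proof -
  have eq: "D (2 * p - 4) - d = P ^ 1 * delta" using p_ge by (simp add: delta_def)
  have "D (2 * p - 4) - d \<in> R" unfolding eq by (intro R_mult) auto
  then show ?thesis using hensel_digit_pcong1[of "D (2 * p - 4) - d" delta 1] by (simp add: eq)
qed

lemma A_star_bracket:
  defines "X \<equiv> 2 * P * D (2 * (p - 1)) - P ^ 2 * (D (p - 1)) ^ 2"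
  shows "pcong 4 (A_star p (p - 1))
          (- (1 / (P - 1)) *
            (- (P^3 / 3) * bernoulli_conv3 (p - 1)
             + P^3 / 4 * (w * D (p - 3)
                 + of_nat (hensel_digit p (D (2 * p - 4) - D (p - 3)) 1))
             - P^3 / 72 * D (p - 5)
             + 7 * P^3 / 12 * D (p - 3)
             + 1 / 2 * P^3 * of_nat (hensel_digit p (bernoulli_conv2 (p - 1)) 1)
             + (1 - P) / 2 * (1 + P * w) * P^2 * of_nat (hensel_digit p X 2)
             - P^2 / 6 * (1 + P * w) * (1 / 2 * D (p - 3) + 1 / 5 * D (p - 5))
             - P^3 / 2 * (\<Sum>a = 1..p - 1. \<Sum>i = 6..p - 5.
                 B i / of_nat a ^ i * (fermat_quotient p a)^2)
             + (13 * P^3 + 12 * P - 12) / 3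
             + (19 * P^3 - 12) / 2 * (P * B (p - 1))
             + (4 - 7 * P^3) * (P * B (2 * (p - 1)))
             + (11 * P^3 - 6) / 6 * (P * B (3 * (p - 1)))
             + P * (2 * D (p - 3) - D (2 * p - 4))
                 * ((1 / 2 - 3 * B (p + 1)) * P - 4 / 3 * P^2)
             + 2 * P * (D (2 * p - 4) - 2 * D (p - 3))
                 * (P / 12 - 11 * P^2 / 24 + P^2 / 12 * agoh_giuga_quotient p)
             + 4 * P * (D (2 * p - 6) - 2 * D (p - 5))
                 * (P * (2 * D 4 - D (p + 3))
                    + 1 / 2 * (7 / 720 * P^2 + 2 * P * D (p + 3)
                               + 2 * P * D 4 * (P * B (p - 1))))))"
    (is "pcong 4 _ (- (1 / (P - 1)) * (?t1 + ?t2 - ?t3 + ?t4 + ?t5 + ?t6 - ?t7 - ?t8 + ?t9 + ?t10 + ?t11 + ?t12 + ?t13 + ?t14 + ?t15))")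
proof -
  define br where "br = ?t1 + ?t2 - ?t3 + ?t4 + ?t5 + ?t6 - ?t7 - ?t8 + ?t9 + ?t10 + ?t11 + ?t12 + ?t13 + ?t14 + ?t15"
  define h where "h = gsum 2 0"
  have hR: "h \<in> R" unfolding h_def by auto
  have Xc: "pcong 3 X (P ^ 2 * C)" unfolding X_def by (rule P_bernoulli_double_pcong3)
  then have XR: "X \<in> R" by (rule pcong_R) auto
  define T0 where "T0 = - 2 * Q 3 - 6 * w * Q 2 - 4 * w ^ 3 - 3 * h - 3 * w * (- Q 2 - w ^ 2) + 3 / 4 * d"
  have "pcong 1 (bernoulli_conv3 (p - 1)) (- 2 * Q 3 - 6 * w * Q 2 - 4 * w ^ 3 - 3 * h - 3 * w * C + 3 / 4 * d)"
    unfolding h_def by (rule bernoulli_conv3_pcong)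
  also have "pcong 1 \<dots> T0"
    unfolding T0_def by (intro pcong_add pcong_diff pcong_refl pcong_cmult bernoulli_conv2_pcong1) auto
  finally have T: "pcong 1 (bernoulli_conv3 (p - 1)) T0" .
  have a1: "pcong 4 ?t1 (- (P ^ 3 * (1 / 3 * T0)))"
  proof -
    have "pcong 4 (P ^ 3 * (1 / 3 * bernoulli_conv3 (p - 1))) (P ^ 3 * (1 / 3 * T0))"
      by (intro pcong_scale[of 1] pcong_cmult T) auto
    from pcong_minus[OF this] show ?thesis by simp
  qed
  have a2: "pcong 4 ?t2 (P ^ 3 * (1 / 4 * (w * d + delta)))"
  proof -
    have "pcong 4 (P ^ 3 * (1 / 4 * (w * d + of_nat (hensel_digit p (D (2 * p - 4) - d) 1)))) (P ^ 3 * (1 / 4 * (w * d + delta)))"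
      by (intro pcong_scale[of 1] pcong_cmult pcong_add pcong_refl hensel_digit_delta) auto
    then show ?thesis by simp
  qed
  define G0 where "G0 = h + delta / 3 - eps / 15 - 6 * d * beta - 3 / 2 * d"
  have a8: "pcong 4 ?t8 (P ^ 3 * (1 / 2 * G0))"
  proof -
    have "pcong 4 (P ^ 3 * (1 / 2 * (\<Sum>a = 1..p - 1. \<Sum>i = 6..p - 5. B i / of_nat a ^ i * (fermat_quotient p a)^2))) (P ^ 3 * (1 / 2 * G0))"
      unfolding G0_def h_def by (intro pcong_scale[of 1] pcong_cmult fermat_quotient_double_sum) auto
    then show ?thesis by simp
  qed
  define C0 where "C0 = - Q 2 - w ^ 2 - P * (Q 2 + w ^ 3 + h + w * Q 2 + d / 2)"
  have a56: "pcong 4 (?t5 + ?t6) (P ^ 2 * (1 / 2 * C0) + P ^ 3 * ((w - 1) / 2 * (- Q 2 - w ^ 2)))"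
  proof -
    have "pcong 4 (?t5 + ?t6) (P ^ 2 / 2 * C + P ^ 3 * ((w - 1) / 2 * C))"
      by (rule hensel_digit_terms[OF XR Xc])
    also have "P ^ 2 / 2 * C + P ^ 3 * ((w - 1) / 2 * C) = P ^ 2 * (1 / 2 * C) + P ^ 3 * ((w - 1) / 2 * C)" by simp
    also have "pcong 4 \<dots> (P ^ 2 * (1 / 2 * C0) + P ^ 3 * ((w - 1) / 2 * (- Q 2 - w ^ 2)))"
    proof (intro pcong_add)
      show "pcong 4 (P ^ 2 * (1 / 2 * C)) (P ^ 2 * (1 / 2 * C0))"
        unfolding C0_def h_def by (intro pcong_scale[of 2] pcong_cmult bernoulli_conv2_pcong) auto
      show "pcong 4 (P ^ 3 * ((w - 1) / 2 * C)) (P ^ 3 * ((w - 1) / 2 * (- Q 2 - w ^ 2)))"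
        by (intro pcong_scale[of 1] pcong_cmult bernoulli_conv2_pcong1) auto
    qed
    finally show ?thesis .
  qed
  define q1 where "q1 = w + P * (w ^ 2 / 2 - w + Q 2 / 2) + P ^ 2 * (w ^ 3 / 3 - w ^ 2 / 2 - Q 3 / 3)"
  have a9: "pcong 4 (?t9 + ?t10 + ?t11 + ?t12) (P - 1 - P * q1 + P ^ 2 * Q 2 - P ^ 3 * Q 3)"
  proof -
    note P_bernoulli_terms
    also have "pcong 4 (P - 1 - P * Q 1 + P ^ 2 * Q 2 - P ^ 3 * Q 3) (P - 1 - P * q1 + P ^ 2 * Q 2 - P ^ 3 * Q 3)"
      unfolding q1_def by (intro pcong_add pcong_diff pcong_refl pcong_scale1[of 3] Q1_pcong3) auto
    finally show ?thesis .
  qed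
  \<comment> \<open>The two digit terms are joined because only their sum is a function of
    \<open>C\<close>; the seventh term joins the last three because only together do their multiples
    of \<open>P ^ 2\<close> cancel.\<close>
  have regroup: "t1 + t2 - t3 + t4 + t5 + t6 - t7 - t8 + t9 + t10 + t11 + t12 + t13 + t14 + t15
    = t1 + t2 - t3 + t4 + (t5 + t6) - t8 + (t9 + t10 + t11 + t12) + (- t7 + t13 + t14 + t15)"
    for t1 t2 t3 t4 t5 t6 t7 t8 t9 t10 t11 t12 t13 t14 t15 :: rat by simp
  define br0 where "br0 = - (P ^ 3 * (1 / 3 * T0)) + P ^ 3 * (1 / 4 * (w * d + delta)) - P ^ 3 / 72 * e + 7 * P ^ 3 / 12 * d
     + (P ^ 2 * (1 / 2 * C0) + P ^ 3 * ((w - 1) / 2 * (- Q 2 - w ^ 2))) - P ^ 3 * (1 / 2 * G0)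
     + (P - 1 - P * q1 + P ^ 2 * Q 2 - P ^ 3 * Q 3)
     + P ^ 3 * (- d * w / 4 - 5 / 6 * d - 3 * d * beta - delta / 12 + e / 72 - eps / 30)"
  have br: "pcong 4 br br0"
    unfolding br_def br0_def regroup
    by (rule pcong_add[OF pcong_add[OF pcong_diff[OF pcong_add[OF pcong_add[OF pcong_diff[OF pcong_add[OF a1 a2] pcong_refl] pcong_refl] a56] a8] a9] kummer_terms])
  \<comment> \<open>The left-hand side ends at \<open>P ^ 3\<close>; the term
    \<open>P ^ 4 * w ^ 3\<close> produced by multiplying out the product is subtracted to obtain an
    identity.\<close>
  have br0: "br0 = (P - 1) * (1 + P * w + P ^ 2 * w ^ 2 + P ^ 3 * w ^ 3) - P ^ 4 * w ^ 3"
  proof -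
    have "- (P ^ 3 * (1 / 3 * (- 2 * s3 - 6 * v * s2 - 4 * v ^ 3 - 3 * h - 3 * v * (- s2 - v ^ 2) + 3 / 4 * a))) + P ^ 3 * (1 / 4 * (v * a + s)) - P ^ 3 / 72 * b + 7 * P ^ 3 / 12 * a
     + (P ^ 2 * (1 / 2 * (- s2 - v ^ 2 - P * (s2 + v ^ 3 + h + v * s2 + a / 2))) + P ^ 3 * ((v - 1) / 2 * (- s2 - v ^ 2))) - P ^ 3 * (1 / 2 * (h + s / 3 - t / 15 - 6 * a * r - 3 / 2 * a))
     + (P - 1 - P * (v + P * (v ^ 2 / 2 - v + s2 / 2) + P ^ 2 * (v ^ 3 / 3 - v ^ 2 / 2 - s3 / 3)) + P ^ 2 * s2 - P ^ 3 * s3)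
     + P ^ 3 * (- a * v / 4 - 5 / 6 * a - 3 * a * r - s / 12 + b / 72 - t / 30)
     = (P - 1) * (1 + P * v + P ^ 2 * v ^ 2 + P ^ 3 * v ^ 3) - P ^ 4 * v ^ 3" for s2 s3 v a b s t r :: rat
      by (simp add: field_simps power2_eq_square power3_eq_cube power4_eq_xxxx)
    then show ?thesis unfolding br0_def T0_def C0_def G0_def q1_def .
  qed
  \<comment> \<open>Instead of inverting the factorial the bracket is multiplied by it: against
    \<open>P * w - 1\<close> the geometric sum in \<open>br0\<close> collapses and leaves
    \<open>1 - P\<close> modulo \<open>p ^ 4\<close>.\<close>
  have 0: "pcong 4 (of_nat (fact (p - 1)) * br) (of_nat (fact (p - 1)) * br0)"
    by (intro pcong_cmult br R_of_nat)
  have fac: "of_nat (fact (p - 1)) = P * w - 1" using fact_eq_w by simp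
  have "pcong 4 ((P * v - 1) * ((P - 1) * (1 + P * v + P ^ 2 * v ^ 2 + P ^ 3 * v ^ 3) - P ^ 4 * v ^ 3)) (1 - P)" if "v \<in> R" for v
  proof (rule pcongI)
    show "(P * v - 1) * ((P - 1) * (1 + P * v + P ^ 2 * v ^ 2 + P ^ 3 * v ^ 3) - P ^ 4 * v ^ 3) - (1 - P)
      = P ^ 4 * ((P - 1) * v ^ 4 - (P * v - 1) * v ^ 3)"
      by (simp add: algebra_simps power2_eq_square power3_eq_cube power4_eq_xxxx)
  qed (use that in auto)
  from this[OF R_w] have "pcong 4 (of_nat (fact (p - 1)) * br0) (1 - P)" unfolding br0 fac .
  moreover have "1 - P = of_nat (fact (p - 1)) * (of_nat (p - 1) * (- A_star p (p - 1)))"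
    unfolding A_star_eq using p_ge by (simp add: of_nat_diff)
  ultimately have "pcong 4 (of_nat (fact (p - 1)) * br) (of_nat (fact (p - 1)) * (of_nat (p - 1) * (- A_star p (p - 1))))"
    using pcong_trans[OF 0] by (simp only:)
  moreover have "\<not> p dvd fact (p - 1)" using prime p_ge by (simp add: prime_dvd_fact_iff)
  ultimately have 1: "pcong 4 br (of_nat (p - 1) * (- A_star p (p - 1)))" by (rule pcong_cancel)
  have P1: "of_nat (p - 1) = P - 1" "P - 1 \<noteq> 0" using p_ge by (auto simp: of_nat_diff)
  have "- (1 / of_nat (p - 1)) \<in> R" using p_ge by (intro R_minus R_divide_less) auto
  from pcong_cmult[OF 1 this] have "pcong 4 (- (1 / (P - 1)) * br) (A_star p (p - 1))"
    using P1 by simp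
  then show ?thesis unfolding br_def by (rule pcong_sym)
qed

end

theorem theorem5:
  fixes p :: nat
  assumes "prime p" and "p \<ge> 11"
  shows "let P = (of_nat p :: rat);
             B = bernoulli;
             D = divided_bernoulli;
             w = wilson_quotient p;
             X = 2 * P * D (2 * (p - 1)) - P^2 * (D (p - 1))^2
         in padic_cong p 4 (A_star p (p - 1))
          (- (1 / (P - 1)) *
            (- (P^3 / 3) * bernoulli_conv3 (p - 1)
             + P^3 / 4 * (w * D (p - 3)
                 + of_nat (hensel_digit p (D (2 * p - 4) - D (p - 3)) 1))
             - P^3 / 72 * D (p - 5)
             + 7 * P^3 / 12 * D (p - 3)
             + 1 / 2 * P^3 * of_nat (hensel_digit p (bernoulli_conv2 (p - 1)) 1)
             + (1 - P) / 2 * (1 + P * w) * P^2 * of_nat (hensel_digit p X 2)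
             - P^2 / 6 * (1 + P * w) * (1 / 2 * D (p - 3) + 1 / 5 * D (p - 5))
             - P^3 / 2 * (\<Sum>a = 1..p - 1. \<Sum>i = 6..p - 5.
                 B i / of_nat a ^ i * (fermat_quotient p a)^2)
             + (13 * P^3 + 12 * P - 12) / 3
             + (19 * P^3 - 12) / 2 * (P * B (p - 1))
             + (4 - 7 * P^3) * (P * B (2 * (p - 1)))
             + (11 * P^3 - 6) / 6 * (P * B (3 * (p - 1)))
             + P * (2 * D (p - 3) - D (2 * p - 4))
                 * ((1 / 2 - 3 * B (p + 1)) * P - 4 / 3 * P^2)
             + 2 * P * (D (2 * p - 4) - 2 * D (p - 3))
                 * (P / 12 - 11 * P^2 / 24 + P^2 / 12 * agoh_giuga_quotient p)
             + 4 * P * (D (2 * p - 6) - 2 * D (p - 5))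
                 * (P * (2 * D 4 - D (p + 3))
                    + 1 / 2 * (7 / 720 * P^2 + 2 * P * D (p + 3)
                               + 2 * P * D 4 * (P * B (p - 1))))))"
proof -
  interpret padic_prime p using assms by unfold_locales
  show ?thesis unfolding Let_def by (rule A_star_bracket)
qed

end
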